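(* For every $d\in\mathbb{N}$ there exist $\beta_1,\beta_2,\beta_3,\beta_4>0$ such that, if $p_t:[0,1]\to P_{1,d}$ is a curve with $p_0,p_1\in P_{1,d}\setminus\Delta_{1,d}$ for which $t\mapsto\mu(p_t)$ is a constant-speed minimizing geodesic in $(\mathscr{P}(\mathbb{C}\mathrm{P}^1),W_2)$, then: (1) for every $t\in[0,1]$, $\mathrm{dist}(p_t,\Delta_{1,d})^2\ge\beta_1\min\{\mathrm{dist}(p_0,\Delta_{1,d}),\mathrm{dist}(p_1,\Delta_{1,d})\}^{\beta_2}$; in particular $p_t\notin\Delta_{1,d}$ for all $t$; (2) if $\gamma(t)=(p_t,z_t)$ is an absolutely continuous lift of $p_t$ to $V\setminus\Sigma'$, then $$L_{\mathrm{cond}}(\gamma)\le\beta_3\,L_V(\gamma)\,\max\{\nu_{\mathrm{norm}}(p_0,z_0),\nu_{\mathrm{norm}}(p_1,z_1)\}^{\beta_4}.$$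
   Context: $P_{1,d}$ is the projectivization of the space of complex binary forms of degree $d$; $\Delta_{1,d}\subset P_{1,d}$ those with a repeated projective root. For $p\in P_{1,d}$, $\mu(p)=\frac1d\sum_{z\in Z(p)}m_z(p)\delta_z\in\mathscr{P}(\mathbb{C}\mathrm{P}^1)$, $m_z(p)$ the multiplicity of the root $z$. $W_2$ is the quadratic Wasserstein distance with Fubini–Study cost on $\mathbb{C}\mathrm{P}^1$. The Bombieri–Weyl Hermitian product on binary forms makes $\sqrt{\binom{d}{k}}z_0^kz_1^{d-k}$ orthonormal; $\mathsf d_{\mathrm{BW}}$ is the induced Fubini–Study distance on $P_{1,d}$ and $\mathrm{dist}(p,\Delta_{1,d})=\mathsf d_{\mathrm{BW}}(p,\Delta_{1,d})$. $V=\{(p,z)\in P_{1,d}\times\mathbb{C}\mathrm{P}^1:p(z)=0\}$ with projection $\pi_1$ onto $P_{1,d}$, $\Sigma'$ the set of critical points of $\pi_1$; $g_V$ is the Riemannian metric on $V$ induced by the product of the Bombieri–Weyl Fubini–Study metric and the Fubini–Study metric of $\mathbb{C}\mathrm{P}^1$. For $z\in\mathbb{C}\mathrm{P}^1$, $\Delta_z$ is the set of $p$ with a multiple root at $z$, and $\nu_{\mathrm{norm}}(p,z)=\mathsf d_{\mathrm{BW}}(p,\Delta_z)^{-1}$. For an absolutely continuous curve $\gamma=(p_t,z_t)$ in $V\setminus\Sigma'$, $L_V(\gamma)=\int_0^1\|\dot\gamma_t\|_V\mathrm{d}t$ and $L_{\mathrm{cond}}(\gamma)=\int_0^1\nu_{\mathrm{norm}}(p_t,z_t)\|\dot\gamma_t\|_V\mathrm{d}t$.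 *)

theory Defs
  imports "HOL-Analysis.Analysis" "HOL-Probability.Probability"
    "HOL-Computational_Algebra.Polynomial"
begin

text \<open>A point of CP^1 is represented by a canonical homogeneous coordinate:
  Some w stands for [w:1], None stands for [1:0].\<close>
type_synonym cp1 = "complex option"

definition hom :: "cp1 \<Rightarrow> complex \<times> complex" where
  "hom x = (case x of Some w \<Rightarrow> (w, 1) | None \<Rightarrow> (1, 0))"

definition cls :: "complex \<times> complex \<Rightarrow> cp1" where
  "cls z = (if snd z \<noteq> 0 then Some (fst z / snd z) else None)"

definition herm2 :: "complex \<times> complex \<Rightarrow> complex \<times> complex \<Rightarrow> complex" where
  "herm2 z w = fst z * cnj (fst w) + snd z * cnj (snd w)"

definition hnorm2 :: "complex \<times> complex \<Rightarrow> real" where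
  "hnorm2 z = sqrt (Re (herm2 z z))"

definition fs_dist :: "cp1 \<Rightarrow> cp1 \<Rightarrow> real" where
  "fs_dist x y = arccos (cmod (herm2 (hom x) (hom y)) / (hnorm2 (hom x) * hnorm2 (hom y)))"

text \<open>A binary form of degree d is given by its coefficient vector a :: nat => complex,
  p(z0,z1) = sum_{k=0}^d a k * z0^k * z1^(d-k), with a k = 0 for k > d.
  An element of P_{1,d} is represented by a nonzero such vector (all notions below are
  invariant under scaling).\<close>
definition is_form :: "nat \<Rightarrow> (nat \<Rightarrow> complex) \<Rightarrow> bool" where
  "is_form d a \<longleftrightarrow> (\<forall>k>d. a k = 0) \<and> (\<exists>k\<le>d. a k \<noteq> 0)"

definition hom_eval :: "nat \<Rightarrow> (nat \<Rightarrow> complex) \<Rightarrow> complex \<times> complex \<Rightarrow> complex" where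
  "hom_eval d a z = (\<Sum>k\<le>d. a k * fst z ^ k * snd z ^ (d - k))"

definition form_poly :: "nat \<Rightarrow> (nat \<Rightarrow> complex) \<Rightarrow> complex poly" where
  "form_poly d a = Poly (map a [0..<Suc d])"

definition root_mult :: "nat \<Rightarrow> (nat \<Rightarrow> complex) \<Rightarrow> cp1 \<Rightarrow> nat" where
  "root_mult d a z = (case z of Some w \<Rightarrow> order w (form_poly d a)
                               | None \<Rightarrow> d - degree (form_poly d a))"

text \<open>Bombieri--Weyl Hermitian product (sqrt(binom d k) z0^k z1^(d-k) orthonormal).\<close>
definition bw_inner :: "nat \<Rightarrow> (nat \<Rightarrow> complex) \<Rightarrow> (nat \<Rightarrow> complex) \<Rightarrow> complex" where
  "bw_inner d a b = (\<Sum>k\<le>d. a k * cnj (b k) / of_nat (d choose k))"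

definition bw_norm :: "nat \<Rightarrow> (nat \<Rightarrow> complex) \<Rightarrow> real" where
  "bw_norm d a = sqrt (Re (bw_inner d a a))"

definition bw_dist :: "nat \<Rightarrow> (nat \<Rightarrow> complex) \<Rightarrow> (nat \<Rightarrow> complex) \<Rightarrow> real" where
  "bw_dist d a b = arccos (cmod (bw_inner d a b) / (bw_norm d a * bw_norm d b))"

definition Disc :: "nat \<Rightarrow> (nat \<Rightarrow> complex) set" where
  "Disc d = {a. is_form d a \<and> (\<exists>z. 2 \<le> root_mult d a z)}"

definition Disc_at :: "nat \<Rightarrow> cp1 \<Rightarrow> (nat \<Rightarrow> complex) set" where
  "Disc_at d z = {a. is_form d a \<and> 2 \<le> root_mult d a z}"

definition dist_Disc :: "nat \<Rightarrow> (nat \<Rightarrow> complex) \<Rightarrow> real" where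
  "dist_Disc d a = Inf (bw_dist d a ` Disc d)"

definition nu_norm :: "nat \<Rightarrow> (nat \<Rightarrow> complex) \<Rightarrow> cp1 \<Rightarrow> real" where
  "nu_norm d a z = 1 / Inf (bw_dist d a ` Disc_at d z)"

definition root_measure :: "nat \<Rightarrow> (nat \<Rightarrow> complex) \<Rightarrow> cp1 pmf" where
  "root_measure d a = embed_pmf (\<lambda>z. real (root_mult d a z) / real d)"

text \<open>Quadratic Wasserstein distance with Fubini--Study cost.  For the (discrete) measures
  considered here every coupling is discrete, so couplings are probability mass functions
  on the product with the prescribed marginals.\<close>
definition W2 :: "cp1 pmf \<Rightarrow> cp1 pmf \<Rightarrow> real" where
  "W2 \<mu> \<nu> = sqrt (Inf {measure_pmf.expectation \<pi> (\<lambda>(x, y). (fs_dist x y)\<^sup>2) | \<pi>.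
                        map_pmf fst \<pi> = \<mu> \<and> map_pmf snd \<pi> = \<nu>})"

definition W2_geodesic :: "(real \<Rightarrow> cp1 pmf) \<Rightarrow> bool" where
  "W2_geodesic m \<longleftrightarrow> (\<forall>s\<in>{0..1}. \<forall>t\<in>{0..1}. W2 (m s) (m t) = \<bar>t - s\<bar> * W2 (m 0) (m 1))"

definition abs_cont_on :: "real set \<Rightarrow> (real \<Rightarrow> 'a::real_normed_vector) \<Rightarrow> bool" where
  "abs_cont_on I f \<longleftrightarrow> (\<forall>\<epsilon>>0. \<exists>\<delta>>0. \<forall>(n::nat) (a::nat \<Rightarrow> real) b.
      (\<forall>i<n. a i \<le> b i \<and> {a i..b i} \<subseteq> I) \<and>
      (\<forall>i<n. \<forall>j<n. i \<noteq> j \<longrightarrow> b i \<le> a j \<or> b j \<le> a i) \<and>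
      (\<Sum>i<n. b i - a i) < \<delta> \<longrightarrow> (\<Sum>i<n. norm (f (b i) - f (a i))) < \<epsilon>)"

text \<open>Fubini--Study speed of the projective curve t |-> [P t] in P_{1,d}
  (P a curve of representatives, P' its derivative).\<close>
definition fs_speed_forms :: "nat \<Rightarrow> (nat \<Rightarrow> complex) \<Rightarrow> (nat \<Rightarrow> complex) \<Rightarrow> real" where
  "fs_speed_forms d a a' =
     sqrt ((bw_norm d a')\<^sup>2 * (bw_norm d a)\<^sup>2 - (cmod (bw_inner d a' a))\<^sup>2) / (bw_norm d a)\<^sup>2"

definition fs_speed_cp1 :: "complex \<times> complex \<Rightarrow> complex \<times> complex \<Rightarrow> real" where
  "fs_speed_cp1 z z' =
     sqrt ((hnorm2 z')\<^sup>2 * (hnorm2 z)\<^sup>2 - (cmod (herm2 z' z))\<^sup>2) / (hnorm2 z)\<^sup>2"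

definition speed_V :: "nat \<Rightarrow> (real \<Rightarrow> nat \<Rightarrow> complex) \<Rightarrow> (real \<Rightarrow> complex \<times> complex) \<Rightarrow> real \<Rightarrow> real" where
  "speed_V d P Z t =
     sqrt ((fs_speed_forms d (P t) (\<lambda>k. vector_derivative (\<lambda>s. P s k) (at t)))\<^sup>2 +
           (fs_speed_cp1 (Z t) (vector_derivative Z (at t)))\<^sup>2)"

definition L_V :: "nat \<Rightarrow> (real \<Rightarrow> nat \<Rightarrow> complex) \<Rightarrow> (real \<Rightarrow> complex \<times> complex) \<Rightarrow> ennreal" where
  "L_V d P Z = (\<integral>\<^sup>+ t. ennreal (speed_V d P Z t) * indicator {0..1} t \<partial>lborel)"

definition L_cond :: "nat \<Rightarrow> (real \<Rightarrow> nat \<Rightarrow> complex) \<Rightarrow> (real \<Rightarrow> complex \<times> complex) \<Rightarrow> ennreal" where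
  "L_cond d P Z = (\<integral>\<^sup>+ t. ennreal (nu_norm d (P t) (cls (Z t)) * speed_V d P Z t)
                             * indicator {0..1} t \<partial>lborel)"

end

theory Submission
  imports Defs "HOL-Computational_Algebra.Fundamental_Theorem_Algebra"
begin

text \<open>
  The Fubini--Study metric makes \<open>\<complex>P\<^sup>1\<close> a round sphere, hence nonnegatively curved. Toponogov's
  inequality together with cyclical monotonicity of optimal couplings gives, for two transport
  trajectories \<open>x, y, z\<close> and \<open>x', y', z'\<close> observed at the times \<open>0, t, 1\<close>, the flat estimate
  \<open>d(y, y')\<^sup>2 \<ge> (1 - t)\<^sup>2 d(x, x')\<^sup>2 + t\<^sup>2 d(z, z')\<^sup>2\<close>. So the roots of \<open>p\<^sub>t\<close> stay simple and their separation
  is controlled by that of the endpoints; by the uniform separation, a continuous root \<open>z\<^sub>t\<close> follows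
  one single trajectory. Finally the distance to the discriminant (or to \<open>\<Delta>\<^sub>z\<close>) is bounded above by
  a multiple of the root separation (move one root onto another one), and below by a power of it
  (a form with separated roots cannot be small together with its derivative).
\<close>

section \<open>Comparison on the unit sphere\<close>

text \<open>The obstacle is that optimal couplings are neither unique nor a priori given by maps,
  and that roots might collide at interior times. Trajectories are therefore never chosen: two atoms
  at two times are related when some optimal coupling charges the pair, and equality in a two-leg
  inequality makes these relations compose. Two trajectories meeting at an interior time must have a
  common source and a common target, so an atom receives its whole mass from one source. Masses are
  multiples of 1/d and equal to 1/d at both ends, hence no atom can split or grow. The separation
  estimate is kept relative to one fixed trajectory, because the condition number at a root only
  sees the distances from that root to the others. The exponents come from the lower estimate: a
  root gap s keeps the form at distance of order s^(2(d-1)) from the discriminant, where d-1 counts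
  the other factors and the square comes from balancing the value against the derivative.\<close>

lemma mult_cos_le_sin:
  fixes u :: real
  assumes "0 \<le> u" "u \<le> pi"
  shows "u * cos u \<le> sin u"
proof -
  have "(\<lambda>u. sin u - u * cos u) 0 \<le> (\<lambda>u. sin u - u * cos u) u"
  proof (rule DERIV_nonneg_imp_nondecreasing [OF assms(1)])
    fix x :: real assume x: "0 \<le> x" "x \<le> u"
    have "((\<lambda>u. sin u - u * cos u) has_real_derivative x * sin x) (at x)"
      by (auto intro!: derivative_eq_intros)
    moreover have "0 \<le> x * sin x" using x assms by (simp add: sin_ge_zero)
    ultimately show "\<exists>y. ((\<lambda>u. sin u - u * cos u) has_real_derivative y) (at x) \<and> 0 \<le> y" by blast
  qed
  then show ?thesis by simp
qed

lemma trig_combination_sq: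
  fixes A B \<tau> :: real
  shows "(A * cos \<tau> + B * sin \<tau>)\<^sup>2 + (B * cos \<tau> - A * sin \<tau>)\<^sup>2 = A\<^sup>2 + B\<^sup>2"
proof -
  have "(A * cos \<tau> + B * sin \<tau>)\<^sup>2 + (B * cos \<tau> - A * sin \<tau>)\<^sup>2
      = (A\<^sup>2 + B\<^sup>2) * ((sin \<tau>)\<^sup>2 + (cos \<tau>)\<^sup>2)"
    by algebra
  then show ?thesis by simp
qed

text \<open>This is the Hessian comparison for the squared distance on the sphere:
  \<open>A * cos \<tau> + B * sin \<tau>\<close> is the inner product of a fixed point with a
  unit-speed great circle, \<open>A\<close> and \<open>B\<close> being its components in the plane
  of the circle. The strict hypothesis keeps the point off that circle, so the distance stays inside
  (0, pi) and \<open>arccos\<close> is differentiable.\<close>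

lemma convex_on_sq_minus_arccos_sq:
  fixes A B :: real
  assumes "A\<^sup>2 + B\<^sup>2 < 1"
  shows "convex_on UNIV (\<lambda>\<tau>. \<tau>\<^sup>2 - (arccos (A * cos \<tau> + B * sin \<tau>))\<^sup>2)"
proof -
  define c where "c \<tau> = A * cos \<tau> + B * sin \<tau>" for \<tau>
  define e where "e \<tau> = B * cos \<tau> - A * sin \<tau>" for \<tau>
  define w where "w \<tau> = sqrt (1 - (c \<tau>)\<^sup>2)" for \<tau>
  have ce: "(c \<tau>)\<^sup>2 + (e \<tau>)\<^sup>2 < 1" for \<tau>
    using assms trig_combination_sq [of A \<tau> B] by (simp add: c_def e_def)
  have c1: "(c \<tau>)\<^sup>2 < 1" for \<tau>
    using ce [of \<tau>] zero_le_power2 [of "e \<tau>"] by linarith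
  have cb: "-1 < c \<tau>" "c \<tau> < 1" for \<tau>
    using c1 [of \<tau>] abs_square_less_1 [of "c \<tau>"] by auto
  have w0: "w \<tau> > 0" and w2: "(w \<tau>)\<^sup>2 = 1 - (c \<tau>)\<^sup>2" for \<tau>
    using c1 [of \<tau>] by (auto simp: w_def)
  have dc: "(c has_real_derivative e \<tau>) (at \<tau>)" for \<tau>
    unfolding c_def e_def by (auto intro!: derivative_eq_intros)
  have de: "(e has_real_derivative - c \<tau>) (at \<tau>)" for \<tau>
    unfolding c_def e_def by (auto intro!: derivative_eq_intros)
  have du: "((\<lambda>x. arccos (c x)) has_real_derivative - e \<tau> / w \<tau>) (at \<tau>)" for \<tau>
    using DERIV_chain2 [OF DERIV_arccos [OF cb] dc, of \<tau>]
    by (simp add: w_def divide_inverse mult.commute)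
  have dw: "(w has_real_derivative - c \<tau> * e \<tau> / w \<tau>) (at \<tau>)" for \<tau>
  proof -
    have "(w has_real_derivative (inverse (sqrt (1 - (c \<tau>)\<^sup>2)) / 2) * (- (2 * c \<tau> * e \<tau>))) (at \<tau>)"
      unfolding w_def
      by (rule DERIV_chain2 [OF DERIV_real_sqrt]) (use c1 [of \<tau>] dc in \<open>auto intro!: derivative_eq_intros\<close>)
    then show ?thesis by (simp add: w_def field_simps)
  qed
  \<comment> \<open>With u = \<open>arccos (c \<tau>)\<close> one has cos u =
    \<open>c \<tau>\<close>, sin u = \<open>w \<tau>\<close> and u' = -e/w. The second derivative
    factors as 2 (1 - u'^2) (1 - u cot u); the distance is 1-Lipschitz and u cot u is at most 1, so
    both factors are nonnegative.\<close>
  let ?G1 = "\<lambda>\<tau>. 2 * \<tau> + 2 * arccos (c \<tau>) * e \<tau> / w \<tau>"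
  let ?G2 = "\<lambda>\<tau>. 2 * (1 - (e \<tau>)\<^sup>2 / (w \<tau>)\<^sup>2) * (1 - arccos (c \<tau>) * c \<tau> / w \<tau>)"
  have "convex_on UNIV (\<lambda>\<tau>. \<tau>\<^sup>2 - (arccos (c \<tau>))\<^sup>2)"
  proof (rule f''_ge0_imp_convex [where f' = ?G1 and f'' = ?G2])
    fix \<tau> :: real
    show "((\<lambda>\<tau>. \<tau>\<^sup>2 - (arccos (c \<tau>))\<^sup>2) has_real_derivative ?G1 \<tau>) (at \<tau>)"
      by (rule derivative_eq_intros du refl)+ (simp add: field_simps)
    show "(?G1 has_real_derivative ?G2 \<tau>) (at \<tau>)"
    proof -
      define u where "u x = arccos (c x)" for x
      have du': "(u has_real_derivative - e \<tau> / w \<tau>) (at \<tau>)"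
        using du unfolding u_def .
      have "((\<lambda>\<tau>. 2 * \<tau> + 2 * u \<tau> * e \<tau> / w \<tau>) has_real_derivative
          2 + ((2 * (- e \<tau> / w \<tau>) * e \<tau> + 2 * u \<tau> * (- c \<tau>)) * w \<tau>
            - 2 * u \<tau> * e \<tau> * (- c \<tau> * e \<tau> / w \<tau>)) / (w \<tau> * w \<tau>)) (at \<tau>)"
        using w0 [of \<tau>] by (auto intro!: derivative_eq_intros du' de dw)
      moreover have "2 + ((2 * (- e \<tau> / w \<tau>) * e \<tau> + 2 * u \<tau> * (- c \<tau>)) * w \<tau>
            - 2 * u \<tau> * e \<tau> * (- c \<tau> * e \<tau> / w \<tau>)) / (w \<tau> * w \<tau>) = 2 * (1 - (e \<tau>)\<^sup>2 / (w \<tau>)\<^sup>2) * (1 - u \<tau> * c \<tau> / w \<tau>)"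
        using w0 [of \<tau>] by (simp add: field_simps power2_eq_square)
      ultimately show ?thesis by (simp add: u_def)
    qed
    have "arccos (c \<tau>) * cos (arccos (c \<tau>)) \<le> sin (arccos (c \<tau>))"
      using cb [of \<tau>] by (intro mult_cos_le_sin arccos_lbound arccos_ubound) auto
    then have "arccos (c \<tau>) * c \<tau> \<le> w \<tau>"
      using cb [of \<tau>] by (simp add: w_def sin_arccos)
    moreover have "(e \<tau>)\<^sup>2 \<le> (w \<tau>)\<^sup>2" using ce [of \<tau>] w2 [of \<tau>] by simp
    ultimately show "?G2 \<tau> \<ge> 0"
      using w0 [of \<tau>] by (intro mult_nonneg_nonneg) auto
  qed simp
  then show ?thesis by (simp add: c_def)
qed

text \<open>Points on the great circle itself, where \<open>arccos\<close> is not smooth, are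
  reached as limits: scaling by r < 1 restores the strict inequality, and \<open>arccos\<close> is
  continuous on [-1, 1]. The term \<open>t * (1 - t) * D\<^sup>2\<close> is the convexity gap of the
  square function between 0 and \<open>D\<close>.\<close>

lemma arccos_sq_great_circle:
  fixes A B D t :: real
  assumes "A\<^sup>2 + B\<^sup>2 \<le> 1" "0 \<le> t" "t \<le> 1"
  shows "(arccos (A * cos (t * D) + B * sin (t * D)))\<^sup>2 \<ge>
    (1 - t) * (arccos A)\<^sup>2 + t * (arccos (A * cos D + B * sin D))\<^sup>2 - t * (1 - t) * D\<^sup>2"
proof -
  define F where "F r \<tau> = (arccos (r * (A * cos \<tau> + B * sin \<tau>)))\<^sup>2" for r \<tau>
  have ineq: "F r (t * D) \<ge> (1 - t) * F r 0 + t * F r D - t * (1 - t) * D\<^sup>2"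
    if r: "0 < r" "r < 1" for r
  proof -
    have "(r * A)\<^sup>2 + (r * B)\<^sup>2 = r\<^sup>2 * (A\<^sup>2 + B\<^sup>2)"
      by (simp add: power_mult_distrib algebra_simps)
    also have "\<dots> \<le> r\<^sup>2" using assms by (simp add: mult_left_le)
    also have "\<dots> < 1" using r by (simp add: power_less_one_iff)
    finally have "convex_on UNIV (\<lambda>\<tau>. \<tau>\<^sup>2 - F r \<tau>)"
      using convex_on_sq_minus_arccos_sq [of "r * A" "r * B"] by (simp add: F_def algebra_simps)
    from convex_onD [OF this assms(2,3), of 0 D]
    show ?thesis by (simp add: algebra_simps power2_eq_square)
  qed
  have bd: "\<bar>A * cos \<tau> + B * sin \<tau>\<bar> \<le> 1" for \<tau>
  proof -
    have "(A * cos \<tau> + B * sin \<tau>)\<^sup>2 \<le> 1"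
      using trig_combination_sq [of A \<tau> B] assms(1) zero_le_power2 [of "B * cos \<tau> - A * sin \<tau>"]
      by linarith
    then show ?thesis by (simp add: abs_square_le_1)
  qed
  have cont: "continuous_on {0..1} (\<lambda>r. F r \<tau>)" for \<tau>
    unfolding F_def
  proof (intro continuous_intros ballI)
    fix r :: real assume "r \<in> {0..1}"
    then have "\<bar>r * (A * cos \<tau> + B * sin \<tau>)\<bar> \<le> 1"
      using bd [of \<tau>] by (simp add: abs_mult mult_le_one)
    then show "- 1 \<le> r * (A * cos \<tau> + B * sin \<tau>) \<and> r * (A * cos \<tau> + B * sin \<tau>) \<le> 1"
      by linarith
  qed
  have lim: "((\<lambda>r. F r \<tau>) \<longlongrightarrow> F 1 \<tau>) (at_left 1)" for \<tau>
  proof -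
    have "((\<lambda>r. F r \<tau>) \<longlongrightarrow> F 1 \<tau>) (at 1 within {0..1})"
      using cont [of \<tau>] by (auto simp: continuous_on_def)
    then show ?thesis by (simp add: at_within_Icc_at_left)
  qed
  have "(1 - t) * F 1 0 + t * F 1 D - t * (1 - t) * D\<^sup>2 \<le> F 1 (t * D)"
  proof (rule tendsto_le [OF _ lim])
    show "((\<lambda>r. (1 - t) * F r 0 + t * F r D - t * (1 - t) * D\<^sup>2) \<longlongrightarrow>
        (1 - t) * F 1 0 + t * F 1 D - t * (1 - t) * D\<^sup>2) (at_left 1)"
      by (intro tendsto_intros lim)
    have "\<forall>\<^sub>F r in at_left 1. r \<in> {0<..<1::real}"
      by (rule eventually_at_leftI [of 0]) auto
    then show "\<forall>\<^sub>F r in at_left 1. (1 - t) * F r 0 + t * F r D - t * (1 - t) * D\<^sup>2 \<le> F r (t * D)"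
      by eventually_elim (use ineq in auto)
  qed simp
  then show ?thesis by (simp add: F_def)
qed

lemma unit_inner_bounds:
  fixes X Y :: "'a::real_inner"
  assumes "norm X = 1" "norm Y = 1"
  shows "-1 \<le> X \<bullet> Y" "X \<bullet> Y \<le> 1"
  using Cauchy_Schwarz_ineq2 [of X Y] assms by auto

text \<open>Split \<open>X\<close> and \<open>Z\<close> into their components along \<open>Y\<close>
  and orthogonal to it. Cauchy-Schwarz on the orthogonal parts gives \<open>X \<bullet> Z\<close> at
  least the cosine of the sum of the two angles; if that sum exceeds pi there is nothing to
  show.\<close>

lemma arccos_inner_triangle:
  fixes X Y Z :: "'a::real_inner"
  assumes n: "norm X = 1" "norm Y = 1" "norm Z = 1"
  shows "arccos (X \<bullet> Z) \<le> arccos (X \<bullet> Y) + arccos (Y \<bullet> Z)"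
proof -
  define a b where "a = X \<bullet> Y" and "b = Y \<bullet> Z"
  have ab: "-1 \<le> a" "a \<le> 1" "-1 \<le> b" "b \<le> 1"
    using n unit_inner_bounds by (auto simp: a_def b_def)
  have yy: "X \<bullet> X = 1" "Y \<bullet> Y = 1" "Z \<bullet> Z = 1" using n by (auto simp: dot_square_norm)
  have nx: "norm (X - a *\<^sub>R Y) = sqrt (1 - a\<^sup>2)" "norm (Z - b *\<^sub>R Y) = sqrt (1 - b\<^sup>2)"
    by (auto simp: norm_eq_sqrt_inner inner_diff_left inner_diff_right yy a_def b_def
        inner_commute power2_eq_square)
  have "X \<bullet> Z = a * b + (X - a *\<^sub>R Y) \<bullet> (Z - b *\<^sub>R Y)"
    by (simp add: inner_diff_left inner_diff_right yy a_def b_def inner_commute)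
  also have "\<dots> \<ge> a * b - sqrt (1 - a\<^sup>2) * sqrt (1 - b\<^sup>2)"
    using Cauchy_Schwarz_ineq2 [of "X - a *\<^sub>R Y" "Z - b *\<^sub>R Y"] unfolding nx by linarith
  also have "a * b - sqrt (1 - a\<^sup>2) * sqrt (1 - b\<^sup>2) = cos (arccos a + arccos b)"
    using ab by (simp add: cos_add sin_arccos)
  finally have le: "cos (arccos a + arccos b) \<le> X \<bullet> Z" .
  show ?thesis
  proof (cases "arccos a + arccos b \<le> pi")
    case True
    have "arccos (X \<bullet> Z) \<le> arccos (cos (arccos a + arccos b))"
      using le n unit_inner_bounds by (intro arccos_le_arccos) auto
    also have "\<dots> = arccos a + arccos b"
      using True ab arccos_lbound by (intro arccos_cos) auto
    finally show ?thesis by (simp add: a_def b_def)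
  next
    case False
    then show ?thesis using arccos_ubound [of "X \<bullet> Z"] n unit_inner_bounds
      by (force simp: a_def b_def)
  qed
qed

text \<open>Toponogov comparison: the squared distance to a point, along a minimal geodesic of the sphere,
  is at least as concave as in the plane. The antipodal case needs only the triangle inequality.\<close>

lemma sphere_comparison:
  fixes X Y Z P :: "'a::real_inner"
  assumes n: "norm X = 1" "norm Y = 1" "norm Z = 1" "norm P = 1"
    and t: "0 \<le> t" "t \<le> 1"
    and XY: "arccos (X \<bullet> Y) = t * arccos (X \<bullet> Z)"
    and YZ: "arccos (Y \<bullet> Z) = (1 - t) * arccos (X \<bullet> Z)"
  shows "(arccos (Y \<bullet> P))\<^sup>2 \<ge> (1 - t) * (arccos (X \<bullet> P))\<^sup>2 + t * (arccos (Z \<bullet> P))\<^sup>2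
    - t * (1 - t) * (arccos (X \<bullet> Z))\<^sup>2"
proof -
  define D where "D = arccos (X \<bullet> Z)"
  note ub = unit_inner_bounds
  have cX: "X \<bullet> Y = cos (t * D)" "Y \<bullet> Z = cos ((1 - t) * D)" "X \<bullet> Z = cos D"
    using XY YZ n ub by (metis D_def cos_arccos)+
  have D: "0 \<le> D" "D \<le> pi" using ub [OF n(1,3)] by (auto simp: D_def intro: arccos_lbound arccos_ubound)
  have yy: "X \<bullet> X = 1" "Y \<bullet> Y = 1" "Z \<bullet> Z = 1" "P \<bullet> P = 1" using n by (auto simp: dot_square_norm)
  consider "D = 0" | "D = pi" | "0 < D" "D < pi" using D by linarith
  then show ?thesis
  proof cases
    case 1
    have "(X - Y) \<bullet> (X - Y) = 0" "(X - Z) \<bullet> (X - Z) = 0"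
      using cX 1 by (auto simp: inner_diff_left inner_diff_right yy inner_commute)
    then have "X = Y" "X = Z" by auto
    then show ?thesis using 1 by (simp add: D_def algebra_simps)
  next
    case 2
    have "(X + Z) \<bullet> (X + Z) = 0"
      using cX 2 by (auto simp: inner_add_left inner_add_right yy inner_commute)
    then have Z: "Z = - X" by (simp add: add_eq_0_iff)
    have az: "arccos (Z \<bullet> P) = pi - arccos (X \<bullet> P)"
      using Z n ub [of X P] by (simp add: arccos_minus)
    \<comment> \<open>The right-hand side of the claim collapses to
      \<open>(arccos (X \<bullet> P) - t * pi)\<^sup>2\<close> here, so this lower bound for the
      distance from \<open>Y\<close> to \<open>P\<close> is exactly what is required.\<close>
    have "\<bar>arccos (X \<bullet> P) - t * pi\<bar> \<le> arccos (Y \<bullet> P)"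
    proof -
      have "arccos (X \<bullet> P) \<le> t * pi + arccos (Y \<bullet> P)"
        using arccos_inner_triangle [of X Y P] n XY 2 by (simp add: D_def)
      moreover have "pi - arccos (X \<bullet> P) \<le> (1 - t) * pi + arccos (Y \<bullet> P)"
        using arccos_inner_triangle [of Z Y P] n YZ 2 az by (simp add: D_def inner_commute)
      ultimately show ?thesis by (simp add: algebra_simps)
    qed
    then have "(arccos (X \<bullet> P) - t * pi)\<^sup>2 \<le> (arccos (Y \<bullet> P))\<^sup>2"
      by (metis abs_ge_zero power2_abs power_mono)
    then show ?thesis
      using 2 unfolding az D_def [symmetric] by (simp add: algebra_simps power2_eq_square)
  next
    case 3
    then have s: "sin D > 0" by (simp add: sin_gt_zero)
    \<comment> \<open>\<open>E\<close> is the unit tangent at \<open>X\<close> pointing towards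
      \<open>Z\<close>. The two prescribed distances fix the components of \<open>Y\<close> along
      \<open>X\<close> and \<open>E\<close>; these already have norm 1, so \<open>Y\<close> has no
      further component.\<close>
    define E where "E = (1 / sin D) *\<^sub>R (Z - cos D *\<^sub>R X)"
    have XE: "X \<bullet> E = 0" by (simp add: E_def inner_diff_right yy cX)
    have "(Z - cos D *\<^sub>R X) \<bullet> (Z - cos D *\<^sub>R X) = (sin D)\<^sup>2"
      using cX yy sin_cos_squared_add [of D]
      by (simp add: inner_diff_left inner_diff_right inner_commute power2_eq_square)
    then have EE: "E \<bullet> E = 1" using s by (simp add: E_def power2_eq_square)
    have Zeq: "Z = cos D *\<^sub>R X + sin D *\<^sub>R E" using s by (simp add: E_def)
    have YE: "Y \<bullet> E = sin (t * D)"
    proof -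
      have "Y \<bullet> E = (cos ((1 - t) * D) - cos D * cos (t * D)) / sin D"
        using cX s by (simp add: E_def inner_diff_right inner_commute)
      moreover have "cos ((1 - t) * D) = cos D * cos (t * D) + sin D * sin (t * D)"
        by (simp add: left_diff_distrib cos_diff)
      ultimately show ?thesis using s by simp
    qed
    have "(Y - (cos (t * D) *\<^sub>R X + sin (t * D) *\<^sub>R E)) \<bullet> (Y - (cos (t * D) *\<^sub>R X + sin (t * D) *\<^sub>R E))
       = 1 - (cos (t * D))\<^sup>2 - (sin (t * D))\<^sup>2"
      using XE EE YE cX yy
      by (simp add: inner_diff_left inner_diff_right inner_add_left inner_add_right inner_commute
          power2_eq_square algebra_simps)
    then have "(Y - (cos (t * D) *\<^sub>R X + sin (t * D) *\<^sub>R E)) \<bullet> (Y - (cos (t * D) *\<^sub>R X + sin (t * D) *\<^sub>R E)) = 0"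
      using sin_cos_squared_add [of "t * D"] by linarith
    then have Yeq: "Y = cos (t * D) *\<^sub>R X + sin (t * D) *\<^sub>R E"
      unfolding inner_eq_zero_iff right_minus_eq .
    define A B where "A = X \<bullet> P" and "B = E \<bullet> P"
    \<comment> \<open>Bessel's inequality for the orthonormal pair \<open>X\<close>,
      \<open>E\<close>.\<close>
    have "0 \<le> (P - (A *\<^sub>R X + B *\<^sub>R E)) \<bullet> (P - (A *\<^sub>R X + B *\<^sub>R E))" by simp
    also have "\<dots> = 1 - (A\<^sup>2 + B\<^sup>2)"
      using XE EE yy
      by (simp add: inner_diff_left inner_diff_right inner_add_left inner_add_right inner_commute
          power2_eq_square algebra_simps A_def B_def)
    finally have AB: "A\<^sup>2 + B\<^sup>2 \<le> 1" by simp
    have "Y \<bullet> P = A * cos (t * D) + B * sin (t * D)"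
      by (subst Yeq) (simp add: inner_add_left A_def B_def mult.commute)
    moreover have "Z \<bullet> P = A * cos D + B * sin D"
      by (subst Zeq) (simp add: inner_add_left A_def B_def mult.commute)
    ultimately show ?thesis
      using arccos_sq_great_circle [OF AB t, of D] by (simp add: A_def D_def)
  qed
qed

section \<open>The Fubini--Study distance\<close>

definition sqn :: "complex \<times> complex \<Rightarrow> real" where
  "sqn v = (cmod (fst v))\<^sup>2 + (cmod (snd v))\<^sup>2"

text \<open>The Hopf map onto the unit sphere of \<complex> x \<real>. It identifies the projective
  line with that sphere up to a factor 2 in the distances, so spherical comparison applies to
  \<open>fs_dist\<close>, whose diameter is pi/2.\<close>

definition hopf :: "complex \<times> complex \<Rightarrow> complex \<times> real" where
  "hopf v = ((2 / sqn v) *\<^sub>R (fst v * cnj (snd v)), ((cmod (fst v))\<^sup>2 - (cmod (snd v))\<^sup>2) / sqn v)"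

lemma sqn_pos: "v \<noteq> 0 \<Longrightarrow> sqn v > 0"
  by (cases v) (auto simp: sqn_def zero_prod_def intro: add_pos_nonneg add_nonneg_pos)

lemma hnorm2_eq: "hnorm2 v = sqrt (sqn v)"
  by (simp add: hnorm2_def herm2_def sqn_def cmod_power2 complex_mult_cnj)

lemma hnorm2_sq: "(hnorm2 v)\<^sup>2 = sqn v"
  by (simp add: hnorm2_eq sqn_def)

lemma hnorm2_pos: "v \<noteq> 0 \<Longrightarrow> hnorm2 v > 0"
  by (simp add: hnorm2_eq sqn_pos)

lemma hom_nonzero [simp]: "hom x \<noteq> 0"
  by (cases x) (auto simp: hom_def zero_prod_def)

lemma lagrange_identity:
  "(cmod (fst v * snd w - snd v * fst w))\<^sup>2 + (cmod (herm2 v w))\<^sup>2 = sqn v * sqn w"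
  by (simp add: sqn_def herm2_def cmod_power2) algebra

lemma hopf_inner_numerator:
  fixes v w :: "complex \<times> complex"
  shows "4 * ((fst v * cnj (snd v)) \<bullet> (fst w * cnj (snd w)))
    + ((cmod (fst v))\<^sup>2 - (cmod (snd v))\<^sup>2) * ((cmod (fst w))\<^sup>2 - (cmod (snd w))\<^sup>2)
    = 2 * (cmod (herm2 v w))\<^sup>2 - sqn v * sqn w"
  by (simp add: sqn_def herm2_def cmod_power2 inner_complex_def) algebra

text \<open>The double angle formula: the cosine of the spherical distance is 2 k^2 - 1, where k is
  the cosine of the Fubini-Study distance.\<close>

lemma hopf_inner:
  assumes "v \<noteq> 0" "w \<noteq> 0"
  shows "hopf v \<bullet> hopf w = 2 * (cmod (herm2 v w) / (hnorm2 v * hnorm2 w))\<^sup>2 - 1"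
proof -
  have p: "sqn v > 0" "sqn w > 0" using assms sqn_pos by auto
  have "hopf v \<bullet> hopf w = (4 * ((fst v * cnj (snd v)) \<bullet> (fst w * cnj (snd w)))
    + ((cmod (fst v))\<^sup>2 - (cmod (snd v))\<^sup>2) * ((cmod (fst w))\<^sup>2 - (cmod (snd w))\<^sup>2)) / (sqn v * sqn w)"
    by (simp add: hopf_def add_divide_distrib)
  also have "\<dots> = 2 * (cmod (herm2 v w) / (hnorm2 v * hnorm2 w))\<^sup>2 - 1"
    unfolding hopf_inner_numerator using p
    by (simp add: power_divide power_mult_distrib hnorm2_sq field_simps)
  finally show ?thesis .
qed

lemma herm2_ratio_le_1:
  assumes "v \<noteq> 0" "w \<noteq> 0"
  shows "cmod (herm2 v w) / (hnorm2 v * hnorm2 w) \<le> 1"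
proof -
  have "(cmod (herm2 v w))\<^sup>2 \<le> (hnorm2 v * hnorm2 w)\<^sup>2"
    using lagrange_identity [of v w] zero_le_power2 [of "cmod (fst v * snd w - snd v * fst w)"]
    unfolding power_mult_distrib hnorm2_sq by linarith
  then have "cmod (herm2 v w) \<le> hnorm2 v * hnorm2 w"
    by (rule power2_le_imp_le) (simp add: hnorm2_pos assms less_imp_le)
  then show ?thesis using assms hnorm2_pos by (simp add: divide_le_eq_1)
qed

lemma two_arccos: "0 \<le> k \<Longrightarrow> k \<le> 1 \<Longrightarrow> arccos (2 * k\<^sup>2 - 1) = 2 * arccos k"
proof -
  assume k: "0 \<le> k" "k \<le> 1"
  have "arccos k \<le> pi / 2" using k by (intro arccos_le_pi2)
  then have "arccos (cos (2 * arccos k)) = 2 * arccos k"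
    using k arccos_lbound [of k] by (intro arccos_cos) auto
  then show ?thesis using k by (simp add: cos_double_cos)
qed

lemma norm_hopf: "v \<noteq> 0 \<Longrightarrow> norm (hopf v) = 1"
proof -
  assume v: "v \<noteq> 0"
  have "cmod (herm2 v v) = (hnorm2 v)\<^sup>2"
    using lagrange_identity [of v v] sqn_pos [OF v]
    by (simp add: hnorm2_sq power2_eq_iff_nonneg flip: power2_eq_square)
  then have "hopf v \<bullet> hopf v = 1"
    using hopf_inner [OF v v] hnorm2_pos [OF v] by (simp add: power2_eq_square)
  then show ?thesis by (simp add: norm_eq_sqrt_inner)
qed

lemma arccos_hopf:
  assumes "v \<noteq> 0" "w \<noteq> 0"
  shows "arccos (hopf v \<bullet> hopf w) = 2 * arccos (cmod (herm2 v w) / (hnorm2 v * hnorm2 w))"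
  using hopf_inner [OF assms] herm2_ratio_le_1 [OF assms] two_arccos hnorm2_pos assms
  by (simp add: less_imp_le)

lemma fs_dist_hopf: "fs_dist x y = arccos (hopf (hom x) \<bullet> hopf (hom y)) / 2"
  by (simp add: fs_dist_def arccos_hopf)

text \<open>\<open>hopf\<close> is invariant under scaling. Continuity of a projective curve can
  thus be read off its homogeneous coordinates, although the chart \<open>cls\<close> jumps at the
  point at infinity.\<close>

lemma hopf_hom_cls: "v \<noteq> 0 \<Longrightarrow> hopf (hom (cls v)) = hopf v"
proof -
  assume v: "v \<noteq> 0"
  show ?thesis
  proof (cases "snd v = 0")
    case True
    then have "fst v \<noteq> 0" using v by (cases v) (auto simp: zero_prod_def)
    then show ?thesis using True by (simp add: cls_def hom_def hopf_def sqn_def)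
  next
    case False
    define a b where "a = fst v" and "b = snd v"
    have b: "b \<noteq> 0" using False by (simp add: b_def)
    have s: "sqn (a / b, 1) = sqn (a, b) / (cmod b)\<^sup>2"
      using b by (simp add: sqn_def norm_divide power_divide add_divide_distrib)
    have sp: "sqn (a, b) > 0" using b by (intro sqn_pos) (auto simp: zero_prod_def)
    have "(2 / sqn (a / b, 1)) *\<^sub>R (a / b) = (2 / sqn (a, b)) *\<^sub>R (a * cnj b)"
    proof -
      have "complex_of_real ((cmod b)\<^sup>2) * (a / b) = a * cnj b"
        using b by (simp only: complex_norm_square) (simp add: field_simps)
      then show ?thesis using sp b
        by (simp add: s scaleR_conv_of_real field_simps)
    qed
    moreover have "((cmod (a / b))\<^sup>2 - 1) / sqn (a / b, 1) = ((cmod a)\<^sup>2 - (cmod b)\<^sup>2) / sqn (a, b)"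
      using b sp by (simp add: s norm_divide power_divide field_simps)
    ultimately show ?thesis using b False
      by (simp add: cls_def hom_def hopf_def a_def [symmetric] b_def [symmetric] sqn_def [of v]
          sqn_def [of "(a, b)"])
  qed
qed

lemma fs_dist_cls:
  "v \<noteq> 0 \<Longrightarrow> w \<noteq> 0 \<Longrightarrow> fs_dist (cls v) (cls w) = arccos (hopf v \<bullet> hopf w) / 2"
  by (simp add: fs_dist_hopf hopf_hom_cls)

lemma fs_dist_nonneg: "0 \<le> fs_dist x y" and fs_dist_le: "fs_dist x y \<le> pi / 2"
  using unit_inner_bounds [OF norm_hopf norm_hopf, of "hom x" "hom y"]
  by (auto simp: fs_dist_hopf arccos_lbound arccos_ubound)

lemma fs_dist_commute: "fs_dist x y = fs_dist y x"
  by (simp add: fs_dist_hopf inner_commute)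

lemma fs_dist_triangle: "fs_dist x z \<le> fs_dist x y + fs_dist y z"
  using arccos_inner_triangle [of "hopf (hom x)" "hopf (hom y)" "hopf (hom z)"]
  by (simp add: fs_dist_hopf norm_hopf)

lemma fs_dist_self: "fs_dist x x = 0"
  using norm_hopf [of "hom x"] by (simp add: fs_dist_hopf dot_square_norm)

text \<open>By the Lagrange identity the normalised determinant is the sine belonging to the cosine
  in \<open>fs_dist\<close>. The determinant is also the value at one point of a linear form
  vanishing at the other, which ties factors of a form to root distances.\<close>

lemma sin_fs_dist:
  "sin (fs_dist x y) = cmod (fst (hom x) * snd (hom y) - snd (hom x) * fst (hom y))
     / (hnorm2 (hom x) * hnorm2 (hom y))"
proof -
  let ?k = "cmod (herm2 (hom x) (hom y)) / (hnorm2 (hom x) * hnorm2 (hom y))"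
  let ?l = "cmod (fst (hom x) * snd (hom y) - snd (hom x) * fst (hom y))
     / (hnorm2 (hom x) * hnorm2 (hom y))"
  have p: "hnorm2 (hom x) > 0" "hnorm2 (hom y) > 0" by (auto simp: hnorm2_pos)
  have k: "0 \<le> ?k" "?k \<le> 1" using herm2_ratio_le_1 [of "hom x" "hom y"] p by auto
  have "?l\<^sup>2 + ?k\<^sup>2 = 1"
    using lagrange_identity [of "hom x" "hom y"] sqn_pos [of "hom x"] sqn_pos [of "hom y"]
    by (simp add: power_divide power_mult_distrib hnorm2_sq add_divide_distrib [symmetric])
  then have "1 - ?k\<^sup>2 = ?l\<^sup>2" by linarith
  then have "sqrt (1 - ?k\<^sup>2) = ?l" using p by simp
  then show ?thesis using k by (simp add: fs_dist_def sin_arccos)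
qed

lemma half_le_sin:
  fixes u :: real
  assumes "0 \<le> u" "u \<le> pi / 2"
  shows "u / 2 \<le> sin u"
proof (cases "u \<le> pi / 3")
  case True
  then have "cos (pi / 3) \<le> cos u" using assms by (intro cos_monotone_0_pi_le) auto
  then have "1 / 2 \<le> cos u" by (simp add: cos_60)
  then have "u * (1 / 2) \<le> u * cos u" using assms by (intro mult_left_mono) auto
  also have "\<dots> \<le> sin u" using assms by (intro mult_cos_le_sin) auto
  finally show ?thesis by simp
next
  case False
  then have "sin (pi / 3) \<le> sin u" using assms by (intro sin_monotone_2pi_le) auto
  moreover have "sin (pi / 3) = sqrt 3 / 2" by (rule sin_60)
  \<comment> \<open>Here u/2 is at most pi/4, hence at most 0.8, while the sine is at least 1.7/2 =
    0.85.\<close>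
  moreover have "1.7 \<le> sqrt 3" by (rule real_le_rsqrt) (simp add: power2_eq_square)
  moreover have "pi \<le> 3.2" using pi_approx(2) by simp
  ultimately show ?thesis using assms by linarith
qed

lemma fs_dist_eq_0_iff: "fs_dist x y = 0 \<longleftrightarrow> x = y"
proof
  assume "fs_dist x y = 0"
  then have "cmod (fst (hom x) * snd (hom y) - snd (hom x) * fst (hom y)) = 0"
    using sin_fs_dist [of x y] hnorm2_pos [of "hom x"] hnorm2_pos [of "hom y"] by auto
  then show "x = y" by (cases x; cases y) (auto simp: hom_def)
qed (simp add: fs_dist_self)

lemma fs_dist_comparison:
  assumes t: "0 \<le> t" "t \<le> 1"
    and xy: "fs_dist x y = t * fs_dist x z" and yz: "fs_dist y z = (1 - t) * fs_dist x z"
  shows "(fs_dist y p)\<^sup>2 \<ge> (1 - t) * (fs_dist x p)\<^sup>2 + t * (fs_dist z p)\<^sup>2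
    - t * (1 - t) * (fs_dist x z)\<^sup>2"
proof -
  have "(2 * fs_dist y p)\<^sup>2 \<ge> (1 - t) * (2 * fs_dist x p)\<^sup>2 + t * (2 * fs_dist z p)\<^sup>2
    - t * (1 - t) * (2 * fs_dist x z)\<^sup>2"
    using sphere_comparison [of "hopf (hom x)" "hopf (hom y)" "hopf (hom z)" "hopf (hom p)" t]
      assms by (simp add: fs_dist_hopf norm_hopf)
  then show ?thesis by (simp add: power_mult_distrib algebra_simps)
qed

text \<open>Three applications of the comparison inequality reduce to the flat computation
  \<open>\<bar>(1 - t) u + t v\<bar>\<^sup>2 \<ge> (1 - t)\<^sup>2 \<bar>u\<bar>\<^sup>2 + t\<^sup>2 \<bar>v\<bar>\<^sup>2\<close> for \<open>u \<bullet> v \<ge> 0\<close>.\<close>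

lemma monotone_pairs_separation:
  assumes t: "0 \<le> t" "t \<le> 1"
    and g: "fs_dist x y = t * fs_dist x z" "fs_dist y z = (1 - t) * fs_dist x z"
    and g': "fs_dist x' y' = t * fs_dist x' z'" "fs_dist y' z' = (1 - t) * fs_dist x' z'"
    and mono: "(fs_dist x z)\<^sup>2 + (fs_dist x' z')\<^sup>2 \<le> (fs_dist x z')\<^sup>2 + (fs_dist x' z)\<^sup>2"
  shows "(fs_dist y y')\<^sup>2 \<ge> (1 - t)\<^sup>2 * (fs_dist x x')\<^sup>2 + t\<^sup>2 * (fs_dist z z')\<^sup>2"
proof -
  define D where "D a b = (fs_dist a b)\<^sup>2" for a b
  have sym: "D a b = D b a" for a b by (simp add: D_def fs_dist_commute)
  have 1: "D y p \<ge> (1 - t) * D x p + t * D z p - t * (1 - t) * D x z" for p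
    using fs_dist_comparison [OF t g] by (simp add: D_def)
  have 2: "D y' p \<ge> (1 - t) * D x' p + t * D z' p - t * (1 - t) * D x' z'" for p
    using fs_dist_comparison [OF t g'] by (simp add: D_def)
  have "(1 - t) * ((1 - t) * D x x' + t * D z x' - t * (1 - t) * D x z) \<le> (1 - t) * D x' y"
    "t * ((1 - t) * D x z' + t * D z z' - t * (1 - t) * D x z) \<le> t * D z' y"
    using 1 [of x'] 1 [of z'] t by (auto intro!: mult_left_mono simp: sym)
  \<comment> \<open>Inserting both lower bounds into the comparison inequality for \<open>y'\<close>
    leaves, besides the two desired terms, precisely this multiple of the cyclical monotonicity
    gap.\<close>
  moreover have "0 \<le> t * (1 - t) * (D x z' + D x' z - D x z - D x' z')"
    using t mono by (intro mult_nonneg_nonneg) (auto simp: D_def)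
  ultimately have "D y' y \<ge> (1 - t)\<^sup>2 * D x x' + t\<^sup>2 * D z z'"
    using 2 [of y] by (simp add: sym [of z x'] algebra_simps power2_eq_square)
  then show ?thesis by (simp add: D_def fs_dist_commute [of y' y])
qed

section \<open>Optimal couplings of finitely supported measures\<close>

text \<open>Couplings are encoded as nonnegative matrices extended by 0: perturbing and averaging
  them is pointwise arithmetic, and they form a closed subset of a product space.\<close>

definition coupling :: "'a pmf \<Rightarrow> 'b pmf \<Rightarrow> ('a \<times> 'b \<Rightarrow> real) \<Rightarrow> bool" where
  "coupling \<mu> \<nu> f \<longleftrightarrow> (\<forall>p. 0 \<le> f p) \<and> (\<forall>p. p \<notin> set_pmf \<mu> \<times> set_pmf \<nu> \<longrightarrow> f p = 0) \<and>
     (\<forall>x\<in>set_pmf \<mu>. (\<Sum>y\<in>set_pmf \<nu>. f (x, y)) = pmf \<mu> x) \<and>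
     (\<forall>y\<in>set_pmf \<nu>. (\<Sum>x\<in>set_pmf \<mu>. f (x, y)) = pmf \<nu> y)"

definition cost :: "('a \<Rightarrow> 'b \<Rightarrow> real) \<Rightarrow> 'a pmf \<Rightarrow> 'b pmf \<Rightarrow> ('a \<times> 'b \<Rightarrow> real) \<Rightarrow> real" where
  "cost c \<mu> \<nu> f = (\<Sum>x\<in>set_pmf \<mu>. \<Sum>y\<in>set_pmf \<nu>. f (x, y) * c x y)"

definition optimal :: "('a \<Rightarrow> 'b \<Rightarrow> real) \<Rightarrow> 'a pmf \<Rightarrow> 'b pmf \<Rightarrow> ('a \<times> 'b \<Rightarrow> real) \<Rightarrow> bool" where
  "optimal c \<mu> \<nu> f \<longleftrightarrow> coupling \<mu> \<nu> f \<and> (\<forall>g. coupling \<mu> \<nu> g \<longrightarrow> cost c \<mu> \<nu> f \<le> cost c \<mu> \<nu> g)"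

lemma couplingD:
  assumes "coupling \<mu> \<nu> f"
  shows "0 \<le> f p" "p \<notin> set_pmf \<mu> \<times> set_pmf \<nu> \<Longrightarrow> f p = 0"
    "x \<in> set_pmf \<mu> \<Longrightarrow> (\<Sum>y\<in>set_pmf \<nu>. f (x, y)) = pmf \<mu> x"
    "y \<in> set_pmf \<nu> \<Longrightarrow> (\<Sum>x\<in>set_pmf \<mu>. f (x, y)) = pmf \<nu> y"
    "f (x, y) > 0 \<Longrightarrow> x \<in> set_pmf \<mu>" "f (x, y) > 0 \<Longrightarrow> y \<in> set_pmf \<nu>"
proof -
  show z: "p \<notin> set_pmf \<mu> \<times> set_pmf \<nu> \<Longrightarrow> f p = 0" for p
    using assms by (cases p) (simp add: coupling_def)
  show "0 \<le> f p"
    using assms by (cases p) (simp add: coupling_def)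
  show "f (x, y) > 0 \<Longrightarrow> x \<in> set_pmf \<mu>" "f (x, y) > 0 \<Longrightarrow> y \<in> set_pmf \<nu>"
    using z [of "(x, y)"] by auto
qed (use assms in \<open>simp_all add: coupling_def\<close>)

lemma coupling_pos_left:
  assumes "coupling \<mu> \<nu> f" "x \<in> set_pmf \<mu>"
  obtains y where "f (x, y) > 0"
proof -
  have "(\<Sum>y\<in>set_pmf \<nu>. f (x, y)) > 0"
    using couplingD(3) [OF assms] assms(2) by (simp add: pmf_positive)
  then obtain y where "f (x, y) > 0"
    by (meson not_less sum_nonpos)
  then show thesis using that by blast
qed

lemma coupling_pos_right:
  assumes "coupling \<mu> \<nu> f" "y \<in> set_pmf \<nu>"
  obtains x where "f (x, y) > 0"
proof -
  have "(\<Sum>x\<in>set_pmf \<mu>. f (x, y)) > 0"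
    using couplingD(4) [OF assms] assms(2) by (simp add: pmf_positive)
  then obtain x where "f (x, y) > 0"
    by (meson not_less sum_nonpos)
  then show thesis using that by blast
qed

lemma coupling_pmf:
  assumes fin: "finite (set_pmf \<mu>)" "finite (set_pmf \<nu>)"
    and m: "map_pmf fst \<pi> = \<mu>" "map_pmf snd \<pi> = \<nu>"
  shows "coupling \<mu> \<nu> (pmf \<pi>)"
    and "measure_pmf.expectation \<pi> (\<lambda>(x, y). c x y) = cost c \<mu> \<nu> (pmf \<pi>)"
proof -
  have sub: "set_pmf \<pi> \<subseteq> set_pmf \<mu> \<times> set_pmf \<nu>"
    using m by (metis set_map_pmf subset_fst_snd)
  then have fpi: "finite (set_pmf \<pi>)" using fin by (meson finite_SigmaI finite_subset)
  have a: "(\<Sum>y\<in>set_pmf \<nu>. pmf \<pi> (x, y)) = pmf \<mu> x" for x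
  proof -
    have "pmf \<mu> x = measure \<pi> (fst -` {x} \<inter> set_pmf \<pi>)"
      by (simp add: m(1) [symmetric] pmf_map measure_Int_set_pmf)
    also have "fst -` {x} \<inter> set_pmf \<pi> = ({x} \<times> set_pmf \<nu>) \<inter> set_pmf \<pi>" using sub by auto
    also have "measure \<pi> \<dots> = measure \<pi> ({x} \<times> set_pmf \<nu>)" by (simp add: measure_Int_set_pmf)
    also have "\<dots> = (\<Sum>p\<in>{x} \<times> set_pmf \<nu>. pmf \<pi> p)"
      by (rule measure_measure_pmf_finite) (use fin in auto)
    also have "\<dots> = (\<Sum>y\<in>set_pmf \<nu>. pmf \<pi> (x, y))"
      by (rule sum.reindex_cong [of "Pair x"]) (auto simp: inj_on_def)
    finally show ?thesis by simp
  qed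
  have b: "(\<Sum>x\<in>set_pmf \<mu>. pmf \<pi> (x, y)) = pmf \<nu> y" for y
  proof -
    have "pmf \<nu> y = measure \<pi> (snd -` {y} \<inter> set_pmf \<pi>)"
      by (simp add: m(2) [symmetric] pmf_map measure_Int_set_pmf)
    also have "snd -` {y} \<inter> set_pmf \<pi> = (set_pmf \<mu> \<times> {y}) \<inter> set_pmf \<pi>" using sub by auto
    also have "measure \<pi> \<dots> = measure \<pi> (set_pmf \<mu> \<times> {y})" by (simp add: measure_Int_set_pmf)
    also have "\<dots> = (\<Sum>p\<in>set_pmf \<mu> \<times> {y}. pmf \<pi> p)"
      by (rule measure_measure_pmf_finite) (use fin in auto)
    also have "\<dots> = (\<Sum>x\<in>set_pmf \<mu>. pmf \<pi> (x, y))"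
      by (rule sum.reindex_cong [of "\<lambda>x. (x, y)"]) (auto simp: inj_on_def)
    finally show ?thesis by simp
  qed
  show "coupling \<mu> \<nu> (pmf \<pi>)"
    unfolding coupling_def using a b sub by (auto simp: pmf_eq_0_set_pmf)
  have "measure_pmf.expectation \<pi> (\<lambda>(x, y). c x y)
      = (\<Sum>p\<in>set_pmf \<mu> \<times> set_pmf \<nu>. (case p of (x, y) \<Rightarrow> c x y) * pmf \<pi> p)"
    by (rule integral_measure_pmf_real) (use fin sub in auto)
  also have "\<dots> = cost c \<mu> \<nu> (pmf \<pi>)"
    by (simp add: cost_def sum.cartesian_product case_prod_beta mult.commute)
  finally show "measure_pmf.expectation \<pi> (\<lambda>(x, y). c x y) = cost c \<mu> \<nu> (pmf \<pi>)" .
qed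

text \<open>The total mass is 1, so \<open>f\<close> is a probability mass function. Its marginals
  are known on their own supports only; these fill \<open>set_pmf \<mu>\<close> and
  \<open>set_pmf \<nu>\<close> because each row and each column contains a positive entry.\<close>

lemma pmf_of_coupling:
  assumes fin: "finite (set_pmf \<mu>)" "finite (set_pmf \<nu>)" and f: "coupling \<mu> \<nu> f"
  obtains \<pi> where "map_pmf fst \<pi> = \<mu>" "map_pmf snd \<pi> = \<nu>" "pmf \<pi> = f"
proof -
  let ?S = "set_pmf \<mu> \<times> set_pmf \<nu>"
  have "(\<Sum>p\<in>?S. f p) = (\<Sum>x\<in>set_pmf \<mu>. \<Sum>y\<in>set_pmf \<nu>. f (x, y))"
    by (simp add: sum.cartesian_product)
  also have "\<dots> = (\<Sum>x\<in>set_pmf \<mu>. pmf \<mu> x)"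
    by (rule sum.cong) (auto simp: couplingD(3) [OF f])
  also have "\<dots> = 1" using fin by (intro sum_pmf_eq_1) auto
  finally have s1: "(\<Sum>p\<in>?S. f p) = 1" .
  have "(\<integral>\<^sup>+ p. ennreal (f p) \<partial>count_space UNIV) = (\<Sum>p\<in>?S. ennreal (f p))"
    using fin couplingD(2) [OF f]
    by (intro nn_integral_count_space') auto
  also have "\<dots> = 1" using s1 couplingD(1) [OF f] by (simp add: sum_ennreal)
  finally have pf: "pmf (embed_pmf f) p = f p" for p
    by (intro pmf_embed_pmf) (use couplingD(1) [OF f] in auto)
  define \<pi> where "\<pi> = embed_pmf f"
  have pf: "pmf \<pi> = f" using pf by (auto simp: \<pi>_def)
  have sub: "set_pmf \<pi> \<subseteq> ?S"
    using couplingD(2) [OF f] pf by (auto simp: set_pmf_iff)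
  then have sub': "set_pmf (map_pmf fst \<pi>) \<subseteq> set_pmf \<mu>" "set_pmf (map_pmf snd \<pi>) \<subseteq> set_pmf \<nu>"
    by auto
  then have fin': "finite (set_pmf (map_pmf fst \<pi>))" "finite (set_pmf (map_pmf snd \<pi>))"
    using fin finite_subset by blast+
  have c: "coupling (map_pmf fst \<pi>) (map_pmf snd \<pi>) f"
    using coupling_pmf(1) [OF fin' refl refl] pf by simp
  have 1: "pmf (map_pmf fst \<pi>) x = pmf \<mu> x" if x: "x \<in> set_pmf (map_pmf fst \<pi>)" for x
  proof -
    have "pmf (map_pmf fst \<pi>) x = (\<Sum>y\<in>set_pmf (map_pmf snd \<pi>). f (x, y))"
      using couplingD(3) [OF c x] by simp
    also have "\<dots> = (\<Sum>y\<in>set_pmf \<nu>. f (x, y))"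
      by (rule sum.mono_neutral_left) (use fin sub' couplingD(2) [OF c] in auto)
    also have "\<dots> = pmf \<mu> x" using couplingD(3) [OF f] x sub' by blast
    finally show ?thesis .
  qed
  have 2: "pmf (map_pmf snd \<pi>) y = pmf \<nu> y" if y: "y \<in> set_pmf (map_pmf snd \<pi>)" for y
  proof -
    have "pmf (map_pmf snd \<pi>) y = (\<Sum>x\<in>set_pmf (map_pmf fst \<pi>). f (x, y))"
      using couplingD(4) [OF c y] by simp
    also have "\<dots> = (\<Sum>x\<in>set_pmf \<mu>. f (x, y))"
      by (rule sum.mono_neutral_left) (use fin sub' couplingD(2) [OF c] in auto)
    also have "\<dots> = pmf \<nu> y" using couplingD(4) [OF f] y sub' by blast
    finally show ?thesis .
  qed
  have "set_pmf \<mu> \<subseteq> set_pmf (map_pmf fst \<pi>)"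
  proof
    fix x assume "x \<in> set_pmf \<mu>"
    then obtain y where "f (x, y) > 0" using coupling_pos_left [OF f] by blast
    then show "x \<in> set_pmf (map_pmf fst \<pi>)" using couplingD(5) [OF c] by blast
  qed
  with 1 have "map_pmf fst \<pi> = \<mu>"
    using sub' by (intro pmf_eqI) (metis pmf_eq_0_set_pmf subset_antisym)
  moreover have "set_pmf \<nu> \<subseteq> set_pmf (map_pmf snd \<pi>)"
  proof
    fix y assume "y \<in> set_pmf \<nu>"
    then obtain x where "f (x, y) > 0" using coupling_pos_right [OF f] by blast
    then show "y \<in> set_pmf (map_pmf snd \<pi>)" using couplingD(6) [OF c] by blast
  qed
  with 2 have "map_pmf snd \<pi> = \<nu>"
    using sub' by (intro pmf_eqI) (metis pmf_eq_0_set_pmf subset_antisym)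
  ultimately show thesis using that pf by blast
qed

lemma product_coupling:
  assumes fin: "finite (set_pmf \<mu>)" "finite (set_pmf \<nu>)"
  shows "coupling \<mu> \<nu> (pmf (pair_pmf \<mu> \<nu>))"
  using coupling_pmf(1) [OF fin map_fst_pair_pmf map_snd_pair_pmf] .

text \<open>Couplings lie in a cube with sides [0, 1], compact by Tychonoff even though the index
  set may be infinite, and the cost is a finite linear combination of coordinates.\<close>

lemma optimal_exists:
  assumes fin: "finite (set_pmf \<mu>)" "finite (set_pmf \<nu>)"
  obtains f where "optimal c \<mu> \<nu> f"
proof -
  let ?K = "PiE UNIV (\<lambda>_. {0..1}) :: ('a \<times> 'b \<Rightarrow> real) set"
  let ?S = "{f. coupling \<mu> \<nu> f}"
  have "compactin (product_topology (\<lambda>_. euclidean) UNIV) ?K"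
    by (subst compactin_PiE) (auto simp: compactin_euclidean_iff)
  then have K: "compact ?K"
    by (simp add: euclidean_product_topology compactin_euclidean_iff)
  have "?S \<subseteq> ?K"
  proof
    fix f assume "f \<in> ?S"
    then obtain \<pi> where "pmf \<pi> = f" using pmf_of_coupling [OF fin] by blast
    then show "f \<in> ?K" by (auto simp: pmf_nonneg pmf_le_1)
  qed
  moreover have "closed ?S"
    unfolding coupling_def Ball_def
    by (intro closed_Collect_conj closed_Collect_all closed_Collect_le closed_Collect_eq
        closed_Collect_imp open_Collect_const continuous_intros continuous_on_product_coordinates) 
  ultimately have "compact ?S" using K by (metis compact_Int_closed inf.absorb_iff2)
  moreover have "?S \<noteq> {}" using product_coupling [OF fin] by blast
  moreover have "continuous_on ?S (cost c \<mu> \<nu>)"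
    unfolding cost_def
    by (intro continuous_intros continuous_on_subset [OF continuous_on_product_coordinates] subset_UNIV)
  ultimately obtain f where "f \<in> ?S" "\<forall>g\<in>?S. cost c \<mu> \<nu> f \<le> cost c \<mu> \<nu> g"
    using continuous_attains_inf by blast
  then show thesis using that by (auto simp: optimal_def)
qed

lemma optimal_W2:
  assumes fin: "finite (set_pmf \<mu>)" "finite (set_pmf \<nu>)"
    and f: "optimal (\<lambda>x y. (fs_dist x y)\<^sup>2) \<mu> \<nu> f"
  shows "cost (\<lambda>x y. (fs_dist x y)\<^sup>2) \<mu> \<nu> f = (W2 \<mu> \<nu>)\<^sup>2"
proof -
  let ?c = "\<lambda>x y. (fs_dist x y)\<^sup>2"
  let ?S = "{measure_pmf.expectation \<pi> (\<lambda>(x, y). (fs_dist x y)\<^sup>2) | \<pi>.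
                        map_pmf fst \<pi> = \<mu> \<and> map_pmf snd \<pi> = \<nu>}"
  have cf: "coupling \<mu> \<nu> f" using f by (simp add: optimal_def)
  obtain \<pi> where pi: "map_pmf fst \<pi> = \<mu>" "map_pmf snd \<pi> = \<nu>" "pmf \<pi> = f"
    using pmf_of_coupling [OF fin cf] .
  have "Inf ?S = cost ?c \<mu> \<nu> f"
  proof (rule cInf_eq_minimum)
    show "cost ?c \<mu> \<nu> f \<in> ?S"
      using coupling_pmf(2) [OF fin pi(1,2), of ?c] pi by (intro CollectI exI [of _ \<pi>]) simp
    show "cost ?c \<mu> \<nu> f \<le> x" if "x \<in> ?S" for x
      using that f coupling_pmf [OF fin] by (auto simp: optimal_def)
  qed
  moreover have "0 \<le> cost ?c \<mu> \<nu> f"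
    unfolding cost_def using couplingD(1) [OF cf] by (intro sum_nonneg) auto
  ultimately show ?thesis unfolding W2_def by simp
qed

text \<open>The union of the supports of all optimal couplings. Working with this relation avoids
  selecting one coupling per pair of times in a consistent way.\<close>

definition opt_rel :: "cp1 pmf \<Rightarrow> cp1 pmf \<Rightarrow> cp1 \<Rightarrow> cp1 \<Rightarrow> bool" where
  "opt_rel \<mu> \<nu> x y \<longleftrightarrow> (\<exists>f. optimal (\<lambda>x y. (fs_dist x y)\<^sup>2) \<mu> \<nu> f \<and> f (x, y) > 0)"

lemma opt_rel_left:
  assumes "finite (set_pmf \<mu>)" "finite (set_pmf \<nu>)" "x \<in> set_pmf \<mu>"
  obtains y where "opt_rel \<mu> \<nu> x y"
proof -
  obtain f where f: "optimal (\<lambda>x y. (fs_dist x y)\<^sup>2) \<mu> \<nu> f" using optimal_exists [OF assms(1,2)] .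
  then have "coupling \<mu> \<nu> f" by (simp add: optimal_def)
  from coupling_pos_left [OF this assms(3)] show thesis using f that by (auto simp: opt_rel_def)
qed

lemma opt_rel_right:
  assumes "finite (set_pmf \<mu>)" "finite (set_pmf \<nu>)" "y \<in> set_pmf \<nu>"
  obtains x where "opt_rel \<mu> \<nu> x y"
proof -
  obtain f where f: "optimal (\<lambda>x y. (fs_dist x y)\<^sup>2) \<mu> \<nu> f" using optimal_exists [OF assms(1,2)] .
  then have "coupling \<mu> \<nu> f" by (simp add: optimal_def)
  from coupling_pos_right [OF this assms(3)] show thesis using f that by (auto simp: opt_rel_def)
qed

lemma opt_rel_mem:
  assumes "opt_rel \<mu> \<nu> x y"
  shows "x \<in> set_pmf \<mu>" "y \<in> set_pmf \<nu>"
proof -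
  obtain f where f: "coupling \<mu> \<nu> f" "f (x, y) > 0"
    using assms by (auto simp: opt_rel_def optimal_def)
  show "x \<in> set_pmf \<mu>" "y \<in> set_pmf \<nu>"
    using couplingD(5,6) [OF f(1) f(2)] by auto
qed

text \<open>The average of two optimal couplings is again optimal and charges both pairs. Cyclical
  monotonicity and the mass counts require a single coupling.\<close>

lemma opt_rel_mix:
  assumes "opt_rel \<mu> \<nu> x y" "opt_rel \<mu> \<nu> x' y'"
  obtains f where "optimal (\<lambda>x y. (fs_dist x y)\<^sup>2) \<mu> \<nu> f" "f (x, y) > 0" "f (x', y') > 0"
proof -
  let ?c = "\<lambda>x y. (fs_dist x y)\<^sup>2"
  obtain f g where f: "optimal ?c \<mu> \<nu> f" "f (x, y) > 0" and g: "optimal ?c \<mu> \<nu> g" "g (x', y') > 0"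
    using assms by (auto simp: opt_rel_def)
  have cf: "coupling \<mu> \<nu> f" and cg: "coupling \<mu> \<nu> g" using f g by (auto simp: optimal_def)
  have eq: "cost ?c \<mu> \<nu> f = cost ?c \<mu> \<nu> g" using f g by (intro antisym) (auto simp: optimal_def)
  define h where "h p = (f p + g p) / 2" for p
  have "coupling \<mu> \<nu> h"
    using cf cg unfolding coupling_def h_def
    by (auto simp: sum_divide_distrib [symmetric] sum.distrib)
  moreover have "cost ?c \<mu> \<nu> h = (cost ?c \<mu> \<nu> f + cost ?c \<mu> \<nu> g) / 2"
    by (simp add: cost_def h_def sum_divide_distrib sum.distrib [symmetric] add_divide_distrib algebra_simps)
  ultimately have "optimal ?c \<mu> \<nu> h" using f eq by (simp add: optimal_def)
  moreover have "h (x, y) > 0" "h (x', y') > 0"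
    using f g couplingD(1) [OF cf] couplingD(1) [OF cg]
    by (auto simp: h_def intro: add_pos_nonneg add_nonneg_pos)
  ultimately show thesis using that by blast
qed

lemma optimal_cyclically_monotone:
  assumes fin: "finite (set_pmf \<mu>)" "finite (set_pmf \<nu>)"
    and f: "optimal c \<mu> \<nu> f" and p: "f (a, b) > 0" "f (a', b') > 0"
  shows "c a b + c a' b' \<le> c a b' + c a' b"
proof (cases "a = a' \<or> b = b'")
  case True
  then show ?thesis by auto
next
  case False
  then have ne: "a \<noteq> a'" "b \<noteq> b'" by auto
  have cf: "coupling \<mu> \<nu> f" using f by (auto simp: optimal_def)
  have mem: "a \<in> set_pmf \<mu>" "a' \<in> set_pmf \<mu>" "b \<in> set_pmf \<nu>" "b' \<in> set_pmf \<nu>"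
    using couplingD(5,6) [OF cf] p by auto
  \<comment> \<open>The largest mass that can be taken from both entries without making either of
    them negative.\<close>
  define e where "e = min (f (a, b)) (f (a', b'))"
  have e: "e > 0" "e \<le> f (a, b)" "e \<le> f (a', b')" using p by (auto simp: e_def)
  \<comment> \<open>The product of \<open>u\<close> and \<open>v\<close> is +1 at
    \<open>(a, b')\<close> and \<open>(a', b)\<close>, -1 at \<open>(a, b)\<close> and
    \<open>(a', b')\<close>, and 0 elsewhere. Both functions have sum 0, so the swap preserves the
    marginals.\<close>
  define u v :: "_ \<Rightarrow> real" where "u x = of_bool (x = a) - of_bool (x = a')"
    and "v y = of_bool (y = b') - of_bool (y = b)" for x y
  define g where "g p = f p + e * (u (fst p) * v (snd p))" for p
  have su: "(\<Sum>x\<in>set_pmf \<mu>. u x * k x) = k a - k a'" for k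
    using fin mem unfolding u_def left_diff_distrib
    by (simp add: sum_subtractf of_bool_def if_distrib [where f = "\<lambda>x. x * _"] sum.delta cong: if_cong)
  have sv: "(\<Sum>y\<in>set_pmf \<nu>. v y * k y) = k b' - k b" for k
    using fin mem unfolding v_def left_diff_distrib
    by (simp add: sum_subtractf of_bool_def if_distrib [where f = "\<lambda>x. x * _"] sum.delta cong: if_cong)
  have "coupling \<mu> \<nu> g"
    unfolding coupling_def
  proof (intro conjI allI ballI impI)
    fix p show "0 \<le> g p"
      using couplingD(1) [OF cf, of p] e ne
      by (cases p) (auto simp: g_def u_def v_def)
  next
    fix p assume "p \<notin> set_pmf \<mu> \<times> set_pmf \<nu>"
    then show "g p = 0" using couplingD(2) [OF cf, of p] mem
      by (cases p) (auto simp: g_def u_def v_def)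
  next
    fix x assume "x \<in> set_pmf \<mu>"
    then show "(\<Sum>y\<in>set_pmf \<nu>. g (x, y)) = pmf \<mu> x"
      using couplingD(3) [OF cf] sv [of "\<lambda>_. 1"]
      by (simp add: g_def sum.distrib sum_distrib_left [symmetric])
  next
    fix y assume "y \<in> set_pmf \<nu>"
    then show "(\<Sum>x\<in>set_pmf \<mu>. g (x, y)) = pmf \<nu> y"
      using couplingD(4) [OF cf] su [of "\<lambda>_. v y"]
      by (simp add: g_def sum.distrib sum_distrib_left [symmetric])
  qed
  then have "cost c \<mu> \<nu> f \<le> cost c \<mu> \<nu> g" using f by (simp add: optimal_def)
  also have "cost c \<mu> \<nu> g = cost c \<mu> \<nu> f + e * (\<Sum>x\<in>set_pmf \<mu>. u x * (\<Sum>y\<in>set_pmf \<nu>. v y * c x y))"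
    by (simp add: cost_def g_def algebra_simps sum.distrib sum_distrib_left)
  also have "(\<Sum>x\<in>set_pmf \<mu>. u x * (\<Sum>y\<in>set_pmf \<nu>. v y * c x y)) = c a b' - c a b - (c a' b' - c a' b)"
    by (simp add: sv su)
  finally have "0 \<le> e * (c a b' - c a b - (c a' b' - c a' b))" by simp
  then show ?thesis using e by (simp add: zero_le_mult_iff)
qed

section \<open>Wasserstein geodesics of finitely supported measures\<close>

text \<open>The weighted sum of squares exceeds \<open>(p + q)\<^sup>2\<close> by a multiple of a
  square that vanishes exactly when the legs have ratio \<open>l\<close> to \<open>1 - l\<close>.
  Equality therefore says that the middle point divides a minimal geodesic in this ratio.\<close>

lemma two_leg_sq_bound:
  fixes l p q r :: real
  assumes l: "0 < l" "l < 1" and "0 \<le> p" "0 \<le> q" "0 \<le> r" "r \<le> p + q"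
  shows "r\<^sup>2 \<le> p\<^sup>2 / l + q\<^sup>2 / (1 - l)"
    and "r\<^sup>2 = p\<^sup>2 / l + q\<^sup>2 / (1 - l) \<Longrightarrow> p = l * r \<and> q = (1 - l) * r"
proof -
  have id: "p\<^sup>2 / l + q\<^sup>2 / (1 - l) = (p + q)\<^sup>2 + ((1 - l) * p - l * q)\<^sup>2 / (l * (1 - l))"
  proof -
    have "l * (1 - l) * (p\<^sup>2 / l + q\<^sup>2 / (1 - l)) = (1 - l) * p\<^sup>2 + l * q\<^sup>2"
      using l by (simp add: field_simps)
    also have "\<dots> = l * (1 - l) * (p + q)\<^sup>2 + ((1 - l) * p - l * q)\<^sup>2" by algebra
    finally have "p\<^sup>2 / l + q\<^sup>2 / (1 - l) = (l * (1 - l) * (p + q)\<^sup>2 + ((1 - l) * p - l * q)\<^sup>2) / (l * (1 - l))"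
      using l by (metis (no_types) nonzero_mult_div_cancel_left less_irrefl mult_eq_0_iff right_minus_eq)
    then show ?thesis using l by (simp add: add_divide_distrib)
  qed
  have r2: "r\<^sup>2 \<le> (p + q)\<^sup>2" using assms by (intro power_mono) auto
  have nn: "0 \<le> ((1 - l) * p - l * q)\<^sup>2 / (l * (1 - l))" using l by simp
  show "r\<^sup>2 \<le> p\<^sup>2 / l + q\<^sup>2 / (1 - l)" unfolding id using r2 nn by linarith
  assume "r\<^sup>2 = p\<^sup>2 / l + q\<^sup>2 / (1 - l)"
  then have "r\<^sup>2 = (p + q)\<^sup>2" "((1 - l) * p - l * q)\<^sup>2 / (l * (1 - l)) = 0"
    unfolding id using r2 nn by linarith+
  then have "r = p + q" "(1 - l) * p = l * q"
    using l assms by (auto simp: power2_eq_iff_nonneg)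
  then show "p = l * r \<and> q = (1 - l) * r" by (auto simp: algebra_simps)
qed

text \<open>The gluing construction: given the middle point, the two outer points are made
  independent. Dividing by \<open>pmf \<nu> y\<close> normalises the conditional laws.\<close>

lemma glued_coupling:
  assumes fin: "finite (set_pmf \<mu>)" "finite (set_pmf \<nu>)" "finite (set_pmf \<kappa>)"
    and f: "coupling \<mu> \<nu> f" and g: "coupling \<nu> \<kappa> g"
  shows "coupling \<mu> \<kappa> (\<lambda>p. \<Sum>y\<in>set_pmf \<nu>. f (fst p, y) * g (y, snd p) / pmf \<nu> y)"
  unfolding coupling_def
proof (intro conjI allI ballI impI)
  fix p
  show "0 \<le> (\<Sum>y\<in>set_pmf \<nu>. f (fst p, y) * g (y, snd p) / pmf \<nu> y)"
    using couplingD(1) [OF f] couplingD(1) [OF g] by (intro sum_nonneg) auto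
  assume "p \<notin> set_pmf \<mu> \<times> set_pmf \<kappa>"
  then have "f (fst p, y) = 0 \<or> g (y, snd p) = 0" for y
    using couplingD(2) [OF f, of "(fst p, y)"] couplingD(2) [OF g, of "(y, snd p)"]
    by (cases p) auto
  then show "(\<Sum>y\<in>set_pmf \<nu>. f (fst p, y) * g (y, snd p) / pmf \<nu> y) = 0"
    by (intro sum.neutral) auto
next
  fix x assume x: "x \<in> set_pmf \<mu>"
  have "(\<Sum>z\<in>set_pmf \<kappa>. \<Sum>y\<in>set_pmf \<nu>. f (x, y) * g (y, z) / pmf \<nu> y)
      = (\<Sum>y\<in>set_pmf \<nu>. f (x, y) / pmf \<nu> y * (\<Sum>z\<in>set_pmf \<kappa>. g (y, z)))"
    by (subst sum.swap) (simp add: sum_distrib_left)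
  also have "\<dots> = (\<Sum>y\<in>set_pmf \<nu>. f (x, y))"
    by (rule sum.cong) (auto simp: couplingD(3) [OF g] pmf_eq_0_set_pmf)
  finally show "(\<Sum>z\<in>set_pmf \<kappa>. \<Sum>y\<in>set_pmf \<nu>. f (fst (x, z), y) * g (y, snd (x, z)) / pmf \<nu> y) = pmf \<mu> x"
    using couplingD(3) [OF f x] by simp
next
  fix z assume z: "z \<in> set_pmf \<kappa>"
  have "(\<Sum>x\<in>set_pmf \<mu>. \<Sum>y\<in>set_pmf \<nu>. f (x, y) * g (y, z) / pmf \<nu> y)
      = (\<Sum>y\<in>set_pmf \<nu>. g (y, z) / pmf \<nu> y * (\<Sum>x\<in>set_pmf \<mu>. f (x, y)))"
    by (subst sum.swap) (simp add: sum_distrib_left sum_divide_distrib mult_ac)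
  also have "\<dots> = (\<Sum>y\<in>set_pmf \<nu>. g (y, z))"
    by (rule sum.cong) (auto simp: couplingD(4) [OF f] pmf_eq_0_set_pmf)
  finally show "(\<Sum>x\<in>set_pmf \<mu>. \<Sum>y\<in>set_pmf \<nu>. f (fst (x, z), y) * g (y, snd (x, z)) / pmf \<nu> y) = pmf \<kappa> z"
    using couplingD(4) [OF g z] by simp
qed

text \<open>Summing the defect of the two-leg inequality over the glued triples gives the optimal
  cost minus the cost of the glued coupling. The first viewpoint makes this nonnegative, optimality
  makes it nonpositive, so it is 0: the glued coupling is optimal, and every charged triple lies on
  a geodesic at ratio \<open>l\<close>.\<close>

lemma opt_rel_glue:
  assumes fin: "finite (set_pmf \<mu>)" "finite (set_pmf \<nu>)" "finite (set_pmf \<kappa>)"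
    and l: "0 < l" "l < 1"
    and W: "W2 \<mu> \<nu> = l * W2 \<mu> \<kappa>" "W2 \<nu> \<kappa> = (1 - l) * W2 \<mu> \<kappa>"
    and xy: "opt_rel \<mu> \<nu> x y" and yz: "opt_rel \<nu> \<kappa> y z"
  shows "opt_rel \<mu> \<kappa> x z \<and> fs_dist x y = l * fs_dist x z \<and> fs_dist y z = (1 - l) * fs_dist x z"
proof -
  let ?c = "\<lambda>x y. (fs_dist x y)\<^sup>2"
  obtain f where f: "optimal ?c \<mu> \<nu> f" "f (x, y) > 0" using xy by (auto simp: opt_rel_def)
  obtain g where g: "optimal ?c \<nu> \<kappa> g" "g (y, z) > 0" using yz by (auto simp: opt_rel_def)
  have cf: "coupling \<mu> \<nu> f" and cg: "coupling \<nu> \<kappa> g" using f g by (auto simp: optimal_def)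
  define K where "K = (W2 \<mu> \<kappa>)\<^sup>2"
  have costf: "cost ?c \<mu> \<nu> f = l\<^sup>2 * K" and costg: "cost ?c \<nu> \<kappa> g = (1 - l)\<^sup>2 * K"
    using optimal_W2 [OF fin(1,2) f(1)] optimal_W2 [OF fin(2,3) g(1)]
    by (auto simp: W K_def power_mult_distrib)
  define h where "h p = (\<Sum>y\<in>set_pmf \<nu>. f (fst p, y) * g (y, snd p) / pmf \<nu> y)" for p
  have ch: "coupling \<mu> \<kappa> h"
    using glued_coupling [OF fin cf cg] by (simp add: h_def [abs_def])
  obtain h0 where h0: "optimal ?c \<mu> \<kappa> h0" using optimal_exists [OF fin(1,3)] .
  have K: "cost ?c \<mu> \<kappa> h0 = K" using optimal_W2 [OF fin(1,3) h0] by (simp add: K_def)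
  have Kh: "K \<le> cost ?c \<mu> \<kappa> h" using h0 ch K by (auto simp: optimal_def)
  \<comment> \<open>\<open>w\<close> is the mass of the glued measure on triples, \<open>b\<close>
    the defect of the two-leg inequality; both are nonnegative.\<close>
  define w where "w = (\<lambda>(x, y, z). f (x, y) * g (y, z) / pmf \<nu> y)"
  define b where "b = (\<lambda>(x, y, z). ?c x y / l + ?c y z / (1 - l) - ?c x z)"
  let ?T = "set_pmf \<mu> \<times> set_pmf \<nu> \<times> set_pmf \<kappa>"
  have b0: "0 \<le> b p" for p
    using two_leg_sq_bound(1) [OF l fs_dist_nonneg fs_dist_nonneg fs_dist_nonneg fs_dist_triangle]
    by (auto simp: b_def split: prod.split)
  have w0: "0 \<le> w p" for p
    using couplingD(1) [OF cf] couplingD(1) [OF cg] by (auto simp: w_def split: prod.split)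
  have triple: "sum F ?T = (\<Sum>x\<in>set_pmf \<mu>. \<Sum>y\<in>set_pmf \<nu>. \<Sum>z\<in>set_pmf \<kappa>. F (x, y, z))" for F :: "_ \<Rightarrow> real"
    by (simp add: sum.cartesian_product)
  have s1: "(\<Sum>(x, y, z)\<in>?T. w (x, y, z) * ?c x y) = cost ?c \<mu> \<nu> f"
  proof -
    have "(\<Sum>z\<in>set_pmf \<kappa>. w (x, y, z) * ?c x y) = f (x, y) * ?c x y" if "y \<in> set_pmf \<nu>" for x y
    proof -
      have "(\<Sum>z\<in>set_pmf \<kappa>. w (x, y, z) * ?c x y)
          = f (x, y) * ?c x y / pmf \<nu> y * (\<Sum>z\<in>set_pmf \<kappa>. g (y, z))"
        by (simp add: w_def sum_distrib_left sum_divide_distrib mult_ac)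
      then show ?thesis using that couplingD(3) [OF cg that] by (simp add: pmf_eq_0_set_pmf)
    qed
    then show ?thesis unfolding triple cost_def by (intro sum.cong refl) simp
  qed
  have s2: "(\<Sum>(x, y, z)\<in>?T. w (x, y, z) * ?c y z) = cost ?c \<nu> \<kappa> g"
  proof -
    have "(\<Sum>x\<in>set_pmf \<mu>. w (x, y, z) * ?c y z) = g (y, z) * ?c y z" if "y \<in> set_pmf \<nu>" for y z
    proof -
      have "(\<Sum>x\<in>set_pmf \<mu>. w (x, y, z) * ?c y z)
          = g (y, z) * ?c y z / pmf \<nu> y * (\<Sum>x\<in>set_pmf \<mu>. f (x, y))"
        by (simp add: w_def sum_distrib_left sum_divide_distrib mult_ac)
      then show ?thesis using that couplingD(4) [OF cf that] by (simp add: pmf_eq_0_set_pmf)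
    qed
    moreover have "(\<Sum>(x, y, z)\<in>?T. w (x, y, z) * ?c y z)
        = (\<Sum>y\<in>set_pmf \<nu>. \<Sum>z\<in>set_pmf \<kappa>. \<Sum>x\<in>set_pmf \<mu>. w (x, y, z) * ?c y z)"
      unfolding triple prod.case
      by (subst sum.swap) (intro sum.cong refl sum.swap)
    ultimately show ?thesis unfolding cost_def by simp
  qed
  have s3: "(\<Sum>(x, y, z)\<in>?T. w (x, y, z) * ?c x z) = cost ?c \<mu> \<kappa> h"
  proof -
    have "cost ?c \<mu> \<kappa> h = (\<Sum>x\<in>set_pmf \<mu>. \<Sum>z\<in>set_pmf \<kappa>. \<Sum>y\<in>set_pmf \<nu>. w (x, y, z) * ?c x z)"
      by (simp add: cost_def h_def w_def sum_distrib_right)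
    also have "\<dots> = (\<Sum>x\<in>set_pmf \<mu>. \<Sum>y\<in>set_pmf \<nu>. \<Sum>z\<in>set_pmf \<kappa>. w (x, y, z) * ?c x z)"
      by (intro sum.cong refl sum.swap)
    finally show ?thesis unfolding triple by simp
  qed
  have "(\<Sum>p\<in>?T. w p * b p) = (\<Sum>(x, y, z)\<in>?T. w (x, y, z) * ?c x y) / l
      + (\<Sum>(x, y, z)\<in>?T. w (x, y, z) * ?c y z) / (1 - l) - (\<Sum>(x, y, z)\<in>?T. w (x, y, z) * ?c x z)"
    unfolding sum_divide_distrib sum.distrib [symmetric] sum_subtractf [symmetric]
    by (intro sum.cong refl) (auto simp: b_def algebra_simps)
  also have "\<dots> = l\<^sup>2 * K / l + (1 - l)\<^sup>2 * K / (1 - l) - cost ?c \<mu> \<kappa> h"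
    unfolding s1 s2 s3 costf costg ..
  \<comment> \<open>Constant speed enters here: the legs cost \<open>l\<^sup>2 * K\<close> and
    \<open>(1 - l)\<^sup>2 * K\<close>, and the weights turn them into \<open>l * K\<close> and
    \<open>(1 - l) * K\<close>.\<close>
  also have "l\<^sup>2 * K / l + (1 - l)\<^sup>2 * K / (1 - l) = K"
  proof -
    have "l\<^sup>2 * K / l = l * K" "(1 - l)\<^sup>2 * K / (1 - l) = (1 - l) * K"
      using l by (simp_all add: power2_eq_square)
    then show ?thesis by (simp add: algebra_simps)
  qed
  finally have tot: "(\<Sum>p\<in>?T. w p * b p) = K - cost ?c \<mu> \<kappa> h" .
  have nonneg: "0 \<le> (\<Sum>p\<in>?T. w p * b p)" using w0 b0 by (intro sum_nonneg) auto
  then have costh: "cost ?c \<mu> \<kappa> h = K" using tot Kh by linarith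
  then have opth: "optimal ?c \<mu> \<kappa> h" using h0 K ch by (auto simp: optimal_def)
  have mem: "x \<in> set_pmf \<mu>" "y \<in> set_pmf \<nu>" "z \<in> set_pmf \<kappa>"
    using couplingD(5) [OF cf f(2)] couplingD(6) [OF cf f(2)] couplingD(6) [OF cg g(2)] by auto
  have wp: "w (x, y, z) > 0" using f g mem by (simp add: w_def pmf_positive)
  have "(\<Sum>p\<in>?T. w p * b p) = 0" using tot costh by simp
  then have "w (x, y, z) * b (x, y, z) = 0"
    using sum_nonneg_eq_0_iff [of ?T "\<lambda>p. w p * b p"] fin w0 b0 mem by auto
  then have "b (x, y, z) = 0" using wp by simp
  then have "?c x z = ?c x y / l + ?c y z / (1 - l)" by (simp add: b_def)
  then have legs: "fs_dist x y = l * fs_dist x z \<and> fs_dist y z = (1 - l) * fs_dist x z"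
    using two_leg_sq_bound(2) [OF l fs_dist_nonneg fs_dist_nonneg fs_dist_nonneg fs_dist_triangle] by blast
  have "w (x, y, z) \<le> h (x, z)"
    unfolding h_def using fin mem couplingD(1) [OF cf] couplingD(1) [OF cg]
    by (simp add: w_def) (rule member_le_sum, auto)
  then have "h (x, z) > 0" using wp by simp
  then show ?thesis using legs opth by (auto simp: opt_rel_def)
qed

section \<open>Trajectories of atoms along a geodesic\<close>

locale finite_geodesic =
  fixes m :: "real \<Rightarrow> cp1 pmf"
  assumes fin: "\<And>t. t \<in> {0..1} \<Longrightarrow> finite (set_pmf (m t))"
    and geo: "W2_geodesic m"
begin

abbreviation R :: "real \<Rightarrow> real \<Rightarrow> cp1 \<Rightarrow> cp1 \<Rightarrow> bool" where
  "R s t \<equiv> opt_rel (m s) (m t)"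

lemma W2_eq: "0 \<le> s \<Longrightarrow> s \<le> t \<Longrightarrow> t \<le> 1 \<Longrightarrow> W2 (m s) (m t) = (t - s) * W2 (m 0) (m 1)"
  using geo unfolding W2_geodesic_def
  by (metis abs_of_nonneg atLeastAtMost_iff diff_ge_0_iff_ge order.trans)

lemma R_refl_eq:
  assumes s: "s \<in> {0..1}" and xy: "R s s x y"
  shows "x = y"
proof -
  let ?c = "\<lambda>x y. (fs_dist x y)\<^sup>2"
  obtain f where f: "optimal ?c (m s) (m s) f" "f (x, y) > 0" using xy by (auto simp: opt_rel_def)
  have cf: "coupling (m s) (m s) f" using f by (auto simp: optimal_def)
  have "W2 (m s) (m s) = 0" using W2_eq [of s s] s by auto
  then have "cost ?c (m s) (m s) f = 0" using optimal_W2 [OF fin fin f(1)] s by simp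
  then have "(\<Sum>p\<in>set_pmf (m s) \<times> set_pmf (m s). f p * ?c (fst p) (snd p)) = 0"
    by (simp add: cost_def sum.cartesian_product case_prod_beta)
  moreover have "(x, y) \<in> set_pmf (m s) \<times> set_pmf (m s)"
    using couplingD(5,6) [OF cf f(2)] by auto
  ultimately have "f (x, y) * ?c x y = 0"
    using sum_nonneg_eq_0_iff [of "set_pmf (m s) \<times> set_pmf (m s)" "\<lambda>p. f p * ?c (fst p) (snd p)"]
      fin [OF s] couplingD(1) [OF cf] by fastforce
  then show ?thesis using f fs_dist_eq_0_iff by auto
qed

text \<open>The proportions are stated without division, so that the degenerate cases
  \<open>s = t\<close> and \<open>t = u\<close> are included; there a coupling of a measure with
  itself has cost 0 and sits on the diagonal.\<close>

lemma R_glue: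
  assumes s: "0 \<le> s" "s \<le> t" "t \<le> u" "u \<le> 1" and xy: "R s t x y" and yz: "R t u y z"
  shows "R s u x z" "(u - s) * fs_dist x y = (t - s) * fs_dist x z"
    "(u - s) * fs_dist y z = (u - t) * fs_dist x z"
proof -
  consider "s = t" | "t = u" | "s < t" "t < u" using s by linarith
  then have "R s u x z \<and> (u - s) * fs_dist x y = (t - s) * fs_dist x z \<and>
    (u - s) * fs_dist y z = (u - t) * fs_dist x z"
  proof cases
    case 1
    then show ?thesis using R_refl_eq [of s x y] s xy yz by (auto simp: fs_dist_self)
  next
    case 2
    then show ?thesis using R_refl_eq [of t y z] s xy yz by (auto simp: fs_dist_self)
  next
    case 3
    define l where "l = (t - s) / (u - s)"
    have l: "0 < l" "l < 1" using 3 by (auto simp: l_def)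
    have l': "1 - l = (u - t) / (u - s)" using 3 by (simp add: l_def field_simps)
    have "R s u x z \<and> fs_dist x y = l * fs_dist x z \<and> fs_dist y z = (1 - l) * fs_dist x z"
    proof (rule opt_rel_glue [OF _ _ _ l _ _ xy yz])
      show "W2 (m s) (m t) = l * W2 (m s) (m u)" "W2 (m t) (m u) = (1 - l) * W2 (m s) (m u)"
        unfolding l' l_def W2_eq [of s t, OF s(1,2) order.trans [OF s(3,4)]]
          W2_eq [of t u, OF order.trans [OF s(1,2)] s(3,4)]
          W2_eq [of s u, OF s(1) order.trans [OF s(2,3)] s(4)]
        using 3 by (simp_all add: field_simps)
    qed (use s fin in auto)
    moreover have "(u - s) * (l * k) = (t - s) * k" "(u - s) * ((1 - l) * k) = (u - t) * k" for k
      unfolding l' using 3 by (auto simp: l_def)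
    ultimately show ?thesis by simp
  qed
  then show "R s u x z" "(u - s) * fs_dist x y = (t - s) * fs_dist x z"
    "(u - s) * fs_dist y z = (u - t) * fs_dist x z" by auto
qed

lemma R_separation:
  assumes t: "0 \<le> t" "t \<le> 1" and "R 0 t x y" "R t 1 y z" "R 0 t x' y'" "R t 1 y' z'"
  shows "(fs_dist y y')\<^sup>2 \<ge> (1 - t)\<^sup>2 * (fs_dist x x')\<^sup>2 + t\<^sup>2 * (fs_dist z z')\<^sup>2"
proof -
  have g: "R 0 1 x z" "fs_dist x y = t * fs_dist x z" "fs_dist y z = (1 - t) * fs_dist x z"
    using R_glue [of 0 t 1 x y z] assms by auto
  have g': "R 0 1 x' z'" "fs_dist x' y' = t * fs_dist x' z'" "fs_dist y' z' = (1 - t) * fs_dist x' z'"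
    using R_glue [of 0 t 1 x' y' z'] assms by auto
  obtain f where f: "optimal (\<lambda>x y. (fs_dist x y)\<^sup>2) (m 0) (m 1) f" "f (x, z) > 0" "f (x', z') > 0"
    using opt_rel_mix [OF g(1) g'(1)] .
  have "(fs_dist x z)\<^sup>2 + (fs_dist x' z')\<^sup>2 \<le> (fs_dist x z')\<^sup>2 + (fs_dist x' z)\<^sup>2"
    using optimal_cyclically_monotone [OF fin fin f] by auto
  then show ?thesis using monotone_pairs_separation [OF t g(2,3) g'(2,3)] by blast
qed

text \<open>Non-branching: continue both trajectories from \<open>y\<close> to the same end point
  \<open>z\<close>. They coincide at time \<open>t\<close>, so the separation estimate bounds
  \<open>(1 - t)\<^sup>2 * (fs_dist x x')\<^sup>2\<close> by 0, and \<open>t < 1\<close> leaves a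
  positive factor.\<close>

lemma R_source_unique:
  assumes t: "0 \<le> t" "t < 1" and "R 0 t x y" "R 0 t x' y"
  shows "x = x'"
proof -
  have "y \<in> set_pmf (m t)" using assms opt_rel_mem by blast
  then obtain z where "R t 1 y z" using opt_rel_left [of "m t" "m 1"] fin t by (metis atLeastAtMost_iff less_imp_le order_refl zero_le_one)
  then have "0 \<ge> (1 - t)\<^sup>2 * (fs_dist x x')\<^sup>2 + t\<^sup>2 * 0\<^sup>2"
    using R_separation [of t x y z x' y z] assms by (simp add: fs_dist_self)
  then have le: "(1 - t)\<^sup>2 * (fs_dist x x')\<^sup>2 \<le> 0" by simp
  have "(1 - t)\<^sup>2 * (fs_dist x x')\<^sup>2 = 0" by (rule antisym [OF le]) simp
  then show ?thesis using t fs_dist_eq_0_iff by auto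
qed

lemma R_target_unique:
  assumes t: "0 < t" "t \<le> 1" and "R t 1 y z" "R t 1 y z'"
  shows "z = z'"
proof -
  have "y \<in> set_pmf (m t)" using assms opt_rel_mem by blast
  then obtain x where "R 0 t x y" using opt_rel_right [of "m 0" "m t"] fin t by (metis atLeastAtMost_iff less_imp_le order_refl zero_le_one)
  then have "0 \<ge> (1 - t)\<^sup>2 * 0\<^sup>2 + t\<^sup>2 * (fs_dist z z')\<^sup>2"
    using R_separation [of t x y z x y z'] assms by (simp add: fs_dist_self)
  then have le: "t\<^sup>2 * (fs_dist z z')\<^sup>2 \<le> 0" by simp
  have "t\<^sup>2 * (fs_dist z z')\<^sup>2 = 0" by (rule antisym [OF le]) simp
  then show ?thesis using t fs_dist_eq_0_iff by auto
qed

end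

context finite_geodesic
begin

lemma mem_Icc: "0 \<le> t \<Longrightarrow> t \<le> 1 \<Longrightarrow> t \<in> {0..1::real}" by simp

lemma R_source_exists:
  assumes "0 \<le> s" "s \<le> 1" "0 \<le> t" "t \<le> 1" "y \<in> set_pmf (m t)"
  obtains x where "R s t x y"
  using opt_rel_right [OF fin fin] assms mem_Icc by blast

lemma R_target_exists:
  assumes "0 \<le> s" "s \<le> 1" "0 \<le> t" "t \<le> 1" "x \<in> set_pmf (m s)"
  obtains y where "R s t x y"
  using opt_rel_left [OF fin fin] assms mem_Icc by blast

text \<open>As \<open>y\<close> has only one possible source, its column in an optimal coupling has
  a single nonzero entry, which carries the whole mass of \<open>y\<close>.\<close>

lemma optimal_mass_source:
  assumes t: "0 \<le> t" "t < 1" and f: "optimal (\<lambda>x y. (fs_dist x y)\<^sup>2) (m 0) (m t) f" "f (x, y) > 0"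
  shows "f (x, y) = pmf (m t) y"
proof -
  have cf: "coupling (m 0) (m t) f" using f by (simp add: optimal_def)
  have mem: "x \<in> set_pmf (m 0)" "y \<in> set_pmf (m t)" using couplingD(5,6) [OF cf f(2)] by auto
  have "f (x', y) = 0" if "x' \<noteq> x" for x'
  proof (rule ccontr)
    assume "f (x', y) \<noteq> 0"
    then have "f (x', y) > 0" using couplingD(1) [OF cf, of "(x', y)"] by simp
    then have "R 0 t x' y" "R 0 t x y" using f by (auto simp: opt_rel_def)
    then show False using R_source_unique [OF t] that by blast
  qed
  then have "(\<Sum>x'\<in>set_pmf (m 0). f (x', y)) = (\<Sum>x'\<in>{x}. f (x', y))"
    using fin [of 0] mem by (intro sum.mono_neutral_right) auto
  then show ?thesis using couplingD(4) [OF cf mem(2)] by simp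
qed

lemma optimal_mass_target:
  assumes t: "0 < t" "t \<le> 1" and f: "optimal (\<lambda>x y. (fs_dist x y)\<^sup>2) (m t) (m 1) f" "f (y, z) > 0"
  shows "f (y, z) = pmf (m t) y"
proof -
  have cf: "coupling (m t) (m 1) f" using f by (simp add: optimal_def)
  have mem: "y \<in> set_pmf (m t)" "z \<in> set_pmf (m 1)" using couplingD(5,6) [OF cf f(2)] by auto
  have "f (y, z') = 0" if "z' \<noteq> z" for z'
  proof (rule ccontr)
    assume "f (y, z') \<noteq> 0"
    then have "f (y, z') > 0" using couplingD(1) [OF cf, of "(y, z')"] by simp
    then have "R t 1 y z'" "R t 1 y z" using f by (auto simp: opt_rel_def)
    then show False using R_target_unique [OF t] that by blast
  qed
  then have "(\<Sum>z'\<in>set_pmf (m 1). f (y, z')) = (\<Sum>z'\<in>{z}. f (y, z'))"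
    using fin [of 1] mem by (intro sum.mono_neutral_right) auto
  then show ?thesis using couplingD(3) [OF cf mem(1)] by simp
qed

text \<open>Extend the step to a trajectory from time 0 to time 1. It has constant speed, equal to
  the distance of its end points, and the diameter of the projective line is pi/2.\<close>

lemma R_small_step:
  assumes s: "0 \<le> s" "s \<le> t" "t \<le> 1" and xy: "R s t y w"
  shows "fs_dist y w \<le> (t - s) * (pi / 2)"
proof (cases "s = t")
  case True
  then show ?thesis using R_refl_eq [of s y w] s xy by (simp add: fs_dist_self)
next
  case False
  then have st: "s < t" using s by simp
  have mem: "y \<in> set_pmf (m s)" "w \<in> set_pmf (m t)" using opt_rel_mem [OF xy] by auto
  obtain x where x: "R 0 s x y" using R_source_exists [of 0 s y] s mem by auto
  obtain z where z: "R t 1 w z" using R_target_exists [of t 1 w] s mem by auto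
  have 1: "R 0 t x w" "t * fs_dist y w = (t - s) * fs_dist x w"
    using R_glue [OF _ _ _ _ x xy] s by auto
  have 2: "fs_dist x w = t * fs_dist x z"
    using R_glue [OF _ _ _ _ 1(1) z] s by auto
  have "t * fs_dist y w = t * ((t - s) * fs_dist x z)" using 1(2) 2 by simp
  then have "fs_dist y w = (t - s) * fs_dist x z" using st s by simp
  also have "\<dots> \<le> (t - s) * (pi / 2)" using st fs_dist_le by (intro mult_left_mono) auto
  finally show ?thesis .
qed

text \<open>Over a short time both the curve and any trajectory starting on it move by less than
  half the gap \<delta>. Their positions are atoms of the same measure at distance below \<delta>,
  hence equal; short steps are chained with \<open>R_glue\<close>.\<close>

lemma R_along_curve:
  assumes sep: "\<And>t y y'. 0 \<le> t \<Longrightarrow> t \<le> 1 \<Longrightarrow> y \<in> set_pmf (m t) \<Longrightarrow> y' \<in> set_pmf (m t) \<Longrightarrow> y \<noteq> y' \<Longrightarrow> \<delta> \<le> fs_dist y y'"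
    and "\<delta> > 0"
    and mem: "\<And>t. 0 \<le> t \<Longrightarrow> t \<le> 1 \<Longrightarrow> y t \<in> set_pmf (m t)"
    and cont: "\<And>\<epsilon>. \<epsilon> > 0 \<Longrightarrow> \<exists>\<eta>>0. \<forall>s\<in>{0..1}. \<forall>t\<in>{0..1}. \<bar>s - t\<bar> < \<eta> \<longrightarrow> fs_dist (y s) (y t) < \<epsilon>"
    and st: "0 \<le> s" "s \<le> t" "t \<le> 1"
  shows "R s t (y s) (y t)"
proof -
  obtain \<eta> where \<eta>: "\<eta> > 0" "\<And>s t. s \<in> {0..1} \<Longrightarrow> t \<in> {0..1} \<Longrightarrow> \<bar>s - t\<bar> < \<eta> \<Longrightarrow> fs_dist (y s) (y t) < \<delta> / 2"
    using cont [of "\<delta> / 2"] \<open>\<delta> > 0\<close> by auto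
  \<comment> \<open>\<eta>/2 controls the curve. \<delta>/8 controls the trajectory: its speed is at
    most pi/2 < 2, so it moves by at most \<delta>/4.\<close>
  define h where "h = min (\<eta> / 2) (\<delta> / 8)"
  have h: "h > 0" "h < \<eta>" "h * 4 < \<delta>" using \<eta> \<open>\<delta> > 0\<close> by (auto simp: h_def min_def)
  have step: "R s t (y s) (y t)" if st: "0 \<le> s" "s \<le> t" "t \<le> 1" "t - s \<le> h" for s t
  proof -
    obtain w where w: "R s t (y s) w" using R_target_exists [of s t "y s"] mem [of s] st by auto
    have "fs_dist (y s) w \<le> (t - s) * (pi / 2)" using R_small_step [OF st(1-3) w] .
    also have "\<dots> \<le> h * 2" using st h pi_less_4 by (intro mult_mono) (auto simp: less_imp_le)
    also have "\<dots> < \<delta> / 2" using h by simp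
    finally have "fs_dist w (y s) < \<delta> / 2" by (simp add: fs_dist_commute)
    moreover have "fs_dist (y s) (y t) < \<delta> / 2" using st h by (intro \<eta>(2)) auto
    ultimately have "fs_dist w (y t) < \<delta>" using fs_dist_triangle [of w "y t" "y s"] by simp
    then have "w = y t" using sep [of t w "y t"] opt_rel_mem(2) [OF w] mem [of t] st by force
    then show ?thesis using w by simp
  qed
  have "\<forall>s t. 0 \<le> s \<longrightarrow> s \<le> t \<longrightarrow> t \<le> 1 \<longrightarrow> t - s \<le> real n * h \<longrightarrow> R s t (y s) (y t)" for n
  proof (induction n)
    case 0
    then show ?case using step h by auto
  next
    case (Suc n)
    show ?case
    proof (intro allI impI)
      fix s t :: real assume st: "0 \<le> s" "s \<le> t" "t \<le> 1" "t - s \<le> real (Suc n) * h"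
      define u where "u = max s (t - h)"
      have u: "s \<le> u" "u \<le> t" "t - u \<le> h" "u - s \<le> real n * h"
        using st h by (auto simp: u_def max_def algebra_simps)
      have "R s u (y s) (y u)" using Suc.IH st u by auto
      moreover have "R u t (y u) (y t)" using step st u by auto
      ultimately show "R s t (y s) (y t)" using R_glue(1) [of s u t "y s" "y u" "y t"] st u by auto
    qed
  qed
  moreover obtain n :: nat where "t - s \<le> real n * h"
    using reals_Archimedean3 [OF h(1)] less_imp_le by blast
  ultimately show ?thesis using st by blast
qed

end

section \<open>Geodesics whose end points have only atoms of mass 1/d\<close>

locale simple_endpoints_geodesic = finite_geodesic +
  fixes d :: nat
  assumes d: "0 < d"
    and mass: "\<And>t y. t \<in> {0..1} \<Longrightarrow> y \<in> set_pmf (m t) \<Longrightarrow> 1 / d \<le> pmf (m t) y"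
    and simple0: "\<And>x. pmf (m 0) x \<le> 1 / d" and simple1: "\<And>x. pmf (m 1) x \<le> 1 / d"
begin

text \<open>For \<open>t < 1\<close> all the mass of \<open>y\<close> comes from one atom
  \<open>x\<close> at time 0, whose mass is at most 1/d. For root measures this says that no
  multiple root appears.\<close>

lemma atom_mass_le:
  assumes t: "0 \<le> t" "t \<le> 1"
  shows "pmf (m t) y \<le> 1 / d"
proof (cases "y \<in> set_pmf (m t) \<and> t < 1")
  case True
  then obtain x where "R 0 t x y" using R_source_exists [of 0 t y] t by auto
  then obtain f where f: "optimal (\<lambda>x y. (fs_dist x y)\<^sup>2) (m 0) (m t) f" "f (x, y) > 0"
    by (auto simp: opt_rel_def)
  have cf: "coupling (m 0) (m t) f" using f by (simp add: optimal_def)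
  have mem: "x \<in> set_pmf (m 0)" "y \<in> set_pmf (m t)" using couplingD(5,6) [OF cf f(2)] by auto
  have "pmf (m t) y = f (x, y)" using optimal_mass_source [OF _ _ f] True t by auto
  also have "\<dots> \<le> (\<Sum>y'\<in>set_pmf (m t). f (x, y'))"
    using fin [of t] t mem couplingD(1) [OF cf] by (intro member_le_sum) auto
  also have "\<dots> = pmf (m 0) x" using couplingD(3) [OF cf mem(1)] .
  finally show ?thesis using simple0 [of x] by simp
next
  case False
  show ?thesis
  proof (cases "t = 1")
    case True
    then show ?thesis using simple1 by simp
  next
    case nt: False
    then have "pmf (m t) y = 0" using False t by (auto simp: pmf_eq_0_set_pmf)
    then show ?thesis by simp
  qed
qed

text \<open>Each of two distinct targets would draw its full mass, at least 1/d, from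
  \<open>x\<close>, which has only 1/d to give.\<close>

lemma R_source_inj:
  assumes t: "0 \<le> t" "t < 1" and "R 0 t x y" "R 0 t x y'"
  shows "y = y'"
proof (rule ccontr)
  assume ne: "y \<noteq> y'"
  obtain f where f: "optimal (\<lambda>x y. (fs_dist x y)\<^sup>2) (m 0) (m t) f" "f (x, y) > 0" "f (x, y') > 0"
    using opt_rel_mix [OF assms(3,4)] .
  have cf: "coupling (m 0) (m t) f" using f by (simp add: optimal_def)
  have mem: "x \<in> set_pmf (m 0)" "y \<in> set_pmf (m t)" "y' \<in> set_pmf (m t)"
    using couplingD(5,6) [OF cf f(2)] couplingD(6) [OF cf f(3)] by auto
  have "1 / d \<le> f (x, y)" "1 / d \<le> f (x, y')"
    using optimal_mass_source [OF t f(1,2)] optimal_mass_source [OF t f(1,3)] mass [of t] mem t by auto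
  moreover have "f (x, y) + f (x, y') = (\<Sum>u\<in>{y, y'}. f (x, u))" using ne by simp
  moreover have "\<dots> \<le> (\<Sum>u\<in>set_pmf (m t). f (x, u))"
    using fin [of t] t mem couplingD(1) [OF cf] by (intro sum_mono2) auto
  moreover have "\<dots> \<le> 1 / d" using couplingD(3) [OF cf mem(1)] simple0 [of x] by simp
  moreover have "0 < 1 / real d" using d by simp
  ultimately show False by linarith
qed

lemma R_target_inj:
  assumes t: "0 < t" "t \<le> 1" and "R t 1 y z" "R t 1 y' z"
  shows "y = y'"
proof (rule ccontr)
  assume ne: "y \<noteq> y'"
  obtain f where f: "optimal (\<lambda>x y. (fs_dist x y)\<^sup>2) (m t) (m 1) f" "f (y, z) > 0" "f (y', z) > 0"
    using opt_rel_mix [OF assms(3,4)] .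
  have cf: "coupling (m t) (m 1) f" using f by (simp add: optimal_def)
  have mem: "z \<in> set_pmf (m 1)" "y \<in> set_pmf (m t)" "y' \<in> set_pmf (m t)"
    using couplingD(5,6) [OF cf f(2)] couplingD(5) [OF cf f(3)] by auto
  have "1 / d \<le> f (y, z)" "1 / d \<le> f (y', z)"
    using optimal_mass_target [OF t f(1,2)] optimal_mass_target [OF t f(1,3)] mass [of t] mem t by auto
  moreover have "f (y, z) + f (y', z) = (\<Sum>u\<in>{y, y'}. f (u, z))" using ne by simp
  moreover have "\<dots> \<le> (\<Sum>u\<in>set_pmf (m t). f (u, z))"
    using fin [of t] t mem couplingD(1) [OF cf] by (intro sum_mono2) auto
  moreover have "\<dots> \<le> 1 / d" using couplingD(4) [OF cf mem(1)] simple1 [of z] by simp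
  moreover have "0 < 1 / real d" using d by simp
  ultimately show False by linarith
qed

text \<open>Only the gaps around the end points \<open>x\<close> and \<open>z\<close> of one
  trajectory enter. The estimate thus serves both the global root separation and a single tracked
  root.\<close>

lemma separation_from_endpoints:
  assumes t: "0 \<le> t" "t \<le> 1" and xy: "R 0 t x y" and yz: "R t 1 y z"
    and y': "y' \<in> set_pmf (m t)" "y' \<noteq> y" and s: "0 \<le> s"
    and s0: "\<And>x'. x' \<in> set_pmf (m 0) \<Longrightarrow> x' \<noteq> x \<Longrightarrow> s \<le> fs_dist x x'"
    and s1: "\<And>z'. z' \<in> set_pmf (m 1) \<Longrightarrow> z' \<noteq> z \<Longrightarrow> s \<le> fs_dist z z'"
  shows "s / 2 \<le> fs_dist y y'"
proof -
  consider "t = 0" | "t = 1" | "0 < t" "t < 1" using t by linarith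
  then show ?thesis
  proof cases
    case 1
    then have "x = y" using R_refl_eq [of 0 x y] xy by simp
    then show ?thesis using s0 [of y'] y' 1 s by simp
  next
    case 2
    then have "y = z" using R_refl_eq [of 1 y z] yz by simp
    then show ?thesis using s1 [of y'] y' 2 s by simp
  next
    case 3
    obtain x' where x': "R 0 t x' y'" using R_source_exists [of 0 t y'] y' t by auto
    obtain z' where z': "R t 1 y' z'" using R_target_exists [of t 1 y'] y' t by auto
    have "x' \<noteq> x" using R_source_inj [of t x y y'] 3 xy x' y' by auto
    then have "s \<le> fs_dist x x'" using s0 opt_rel_mem(1) [OF x'] by blast
    then have a: "s\<^sup>2 \<le> (fs_dist x x')\<^sup>2" using s by (intro power_mono) auto
    have "z' \<noteq> z" using R_target_inj [of t y z y'] 3 yz z' y' by auto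
    then have "s \<le> fs_dist z z'" using s1 opt_rel_mem(2) [OF z'] by blast
    then have b: "s\<^sup>2 \<le> (fs_dist z z')\<^sup>2" using s by (intro power_mono) auto
    \<comment> \<open>The minimum of the left-hand sum of squares is 1/2, at the midpoint; the
      weaker bound 1/4 yields the convenient factor \<open>s / 2\<close>.\<close>
    have "(1 - t)\<^sup>2 + t\<^sup>2 - 1 / 4 = 2 * (t - 1 / 2)\<^sup>2 + 1 / 4" by (simp add: power2_eq_square algebra_simps)
    then have "1 / 4 \<le> (1 - t)\<^sup>2 + t\<^sup>2" using zero_le_power2 [of "t - 1 / 2"] by linarith
    then have "(1 / 4) * s\<^sup>2 \<le> ((1 - t)\<^sup>2 + t\<^sup>2) * s\<^sup>2" by (intro mult_right_mono) auto
    also have "\<dots> = (1 - t)\<^sup>2 * s\<^sup>2 + t\<^sup>2 * s\<^sup>2" by (simp add: algebra_simps)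
    also have "\<dots> \<le> (1 - t)\<^sup>2 * (fs_dist x x')\<^sup>2 + t\<^sup>2 * (fs_dist z z')\<^sup>2"
      using a b by (intro add_mono mult_left_mono) auto
    also have "\<dots> \<le> (fs_dist y y')\<^sup>2" using R_separation [OF t xy yz x' z'] .
    finally have "(s / 2)\<^sup>2 \<le> (fs_dist y y')\<^sup>2" by (simp add: power_divide)
    then show ?thesis by (rule power2_le_imp_le) (rule fs_dist_nonneg)
  qed
qed

end

section \<open>The Bombieri--Weyl norm\<close>

lemma bw_norm_sq: "(bw_norm d a)\<^sup>2 = (\<Sum>k\<le>d. (cmod (a k))\<^sup>2 / real (d choose k))"
proof -
  have "Re (bw_inner d a a) = (\<Sum>k\<le>d. (cmod (a k))\<^sup>2 / real (d choose k))"
    unfolding bw_inner_def Re_sum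
  proof (rule sum.cong [OF refl])
    fix k
    have "a k * cnj (a k) / of_nat (d choose k) = of_real ((cmod (a k))\<^sup>2 / real (d choose k))"
      by (simp only: of_real_divide complex_norm_square of_real_of_nat_eq)
    then show "Re (a k * cnj (a k) / of_nat (d choose k)) = (cmod (a k))\<^sup>2 / real (d choose k)"
      by (metis Re_complex_of_real)
  qed
  moreover have "0 \<le> (\<Sum>k\<le>d. (cmod (a k))\<^sup>2 / real (d choose k))" by (intro sum_nonneg) auto
  ultimately show ?thesis by (simp add: bw_norm_def)
qed

lemma bw_inner_self: "bw_inner d a a = of_real ((bw_norm d a)\<^sup>2)"
  unfolding bw_norm_sq bw_inner_def of_real_sum
  by (intro sum.cong refl) (simp only: of_real_divide complex_norm_square of_real_of_nat_eq)

lemma bw_norm_nonneg: "0 \<le> bw_norm d a"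
  unfolding bw_norm_def by (rule real_sqrt_ge_zero)
    (metis bw_norm_def bw_norm_sq bw_inner_self Re_complex_of_real zero_le_power2)

text \<open>The weights \<open>1 / (d choose k)\<close> lie between 2^(-d) and 1, so the
  Bombieri-Weyl norm is comparable to the largest coefficient. Crude factors suffice because they
  depend on \<open>d\<close> only.\<close>

lemma norm_coeff_le_bw_norm:
  assumes "k \<le> d"
  shows "cmod (a k) \<le> 2 ^ d * bw_norm d a"
proof -
  have c: "0 < d choose k" using assms by simp
  have c2: "real (d choose k) \<le> 2 ^ d"
    using of_nat_mono [OF binomial_le_pow2 [of d k], where 'a = real] by simp
  have "(cmod (a k))\<^sup>2 / real (d choose k) \<le> (bw_norm d a)\<^sup>2"
    unfolding bw_norm_sq using assms
    by (intro member_le_sum [where f = "\<lambda>k. (cmod (a k))\<^sup>2 / real (d choose k)"]) auto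
  then have "(cmod (a k))\<^sup>2 \<le> real (d choose k) * (bw_norm d a)\<^sup>2" using c by (simp add: field_simps)
  also have "\<dots> \<le> 2 ^ d * (bw_norm d a)\<^sup>2" using c2 by (intro mult_right_mono) auto
  also have "\<dots> \<le> (2 ^ d)\<^sup>2 * (bw_norm d a)\<^sup>2" by (intro mult_right_mono) (auto simp: self_le_power)
  finally have "(cmod (a k))\<^sup>2 \<le> (2 ^ d * bw_norm d a)\<^sup>2" by (simp add: power_mult_distrib)
  then show ?thesis by (rule power2_le_imp_le) (simp add: bw_norm_nonneg)
qed

lemma bw_norm_le:
  assumes "\<And>k. k \<le> d \<Longrightarrow> cmod (a k) \<le> M"
  shows "bw_norm d a \<le> (real d + 1) * M"
proof -
  have M: "0 \<le> M" using assms [of 0] norm_ge_zero order_trans by blast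
  have "(bw_norm d a)\<^sup>2 \<le> (\<Sum>k\<le>d. M\<^sup>2)"
    unfolding bw_norm_sq
  proof (rule sum_mono)
    fix k assume k: "k \<in> {..d}"
    then have "0 < d choose k" by simp
    then have "1 \<le> real (d choose k)" by linarith
    then have "(cmod (a k))\<^sup>2 / real (d choose k) \<le> (cmod (a k))\<^sup>2 / 1"
      using k by (intro divide_left_mono) auto
    also have "\<dots> \<le> M\<^sup>2" using assms k by (simp add: power_mono)
    finally show "(cmod (a k))\<^sup>2 / real (d choose k) \<le> M\<^sup>2" .
  qed
  also have "\<dots> = (real d + 1) * M\<^sup>2" by simp
  also have "\<dots> \<le> (real d + 1)\<^sup>2 * M\<^sup>2" by (intro mult_right_mono) (auto simp: self_le_power)
  finally have "(bw_norm d a)\<^sup>2 \<le> ((real d + 1) * M)\<^sup>2" by (simp add: power_mult_distrib)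
  then show ?thesis by (rule power2_le_imp_le) (use M in simp)
qed

lemma bw_norm_pos:
  assumes "is_form d a" shows "0 < bw_norm d a"
proof -
  obtain k where k: "k \<le> d" "a k \<noteq> 0" using assms by (auto simp: is_form_def)
  then have "0 < 2 ^ d * bw_norm d a" 
    using norm_coeff_le_bw_norm [OF k(1), of a] zero_less_norm_iff [of "a k"] by linarith
  then show ?thesis by (simp add: zero_less_mult_iff)
qed

lemma bw_norm_diff_sq:
  "(bw_norm d (\<lambda>k. a k - l * b k))\<^sup>2
    = (bw_norm d a)\<^sup>2 - 2 * Re (cnj l * bw_inner d a b) + (cmod l)\<^sup>2 * (bw_norm d b)\<^sup>2"
proof -
  have "Re (cnj l * bw_inner d a b) = (\<Sum>k\<le>d. Re (cnj l * (a k * cnj (b k))) / real (d choose k))"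
    unfolding bw_inner_def sum_distrib_left Re_sum
    by (intro sum.cong refl) (simp only: times_divide_eq_right Re_divide_of_nat)
  moreover have "(cmod (a k - l * b k))\<^sup>2 / real (d choose k) = (cmod (a k))\<^sup>2 / real (d choose k)
     - 2 * (Re (cnj l * (a k * cnj (b k))) / real (d choose k))
     + (cmod l)\<^sup>2 * ((cmod (b k))\<^sup>2 / real (d choose k))" for k
  proof -
    have "(cmod (a k - l * b k))\<^sup>2 = (cmod (a k))\<^sup>2 - 2 * Re (cnj l * (a k * cnj (b k))) + (cmod l)\<^sup>2 * (cmod (b k))\<^sup>2"
      by (simp add: cmod_power2) algebra
    then show ?thesis by (simp add: add_divide_distrib diff_divide_distrib)
  qed
  ultimately show ?thesis
    unfolding bw_norm_sq by (simp add: sum.distrib sum_subtractf sum_distrib_left)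
qed

text \<open>The squared distance from \<open>a\<close> to the complex line through \<open>b\<close>:
  attained at the orthogonal projection, a lower bound for every other multiple of
  \<open>b\<close>.\<close>

lemma bw_norm_projection:
  assumes "0 < bw_norm d b"
  shows "(bw_norm d (\<lambda>k. a k - bw_inner d a b / of_real ((bw_norm d b)\<^sup>2) * b k))\<^sup>2
    = (bw_norm d a)\<^sup>2 - (cmod (bw_inner d a b))\<^sup>2 / (bw_norm d b)\<^sup>2"
    and "(bw_norm d a)\<^sup>2 - (cmod (bw_inner d a b))\<^sup>2 / (bw_norm d b)\<^sup>2
      \<le> (bw_norm d (\<lambda>k. a k - l * b k))\<^sup>2"
proof -
  define h where "h = bw_inner d a b"
  define N where "N = (bw_norm d b)\<^sup>2"
  have N: "N > 0" using assms by (simp add: N_def)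
  have re: "Re (cnj h * h) = (cmod h)\<^sup>2" unfolding cmod_power2 by (simp add: power2_eq_square)
  have "Re (cnj (h / of_real N) * h) = (cmod h)\<^sup>2 / N"
    unfolding re [symmetric] by (simp add: add_divide_distrib)
  moreover have "(cmod (h / of_real N))\<^sup>2 * N = (cmod h)\<^sup>2 / N"
    using N by (simp add: norm_divide power_divide power2_eq_square)
  ultimately show "(bw_norm d (\<lambda>k. a k - bw_inner d a b / of_real ((bw_norm d b)\<^sup>2) * b k))\<^sup>2
    = (bw_norm d a)\<^sup>2 - (cmod (bw_inner d a b))\<^sup>2 / (bw_norm d b)\<^sup>2"
    unfolding bw_norm_diff_sq h_def [symmetric] N_def [symmetric] by linarith
  have "2 * Re (cnj l * h) \<le> 2 * (cmod l * cmod h)"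
    using complex_Re_le_cmod [of "cnj l * h"] by (simp add: norm_mult)
  moreover have "0 \<le> (cmod h / sqrt N - cmod l * sqrt N)\<^sup>2" by simp
  then have "2 * (cmod l * cmod h) \<le> (cmod h)\<^sup>2 / N + (cmod l)\<^sup>2 * N"
    using N by (simp add: power2_diff power_divide power_mult_distrib mult_ac)
  ultimately show "(bw_norm d a)\<^sup>2 - (cmod (bw_inner d a b))\<^sup>2 / (bw_norm d b)\<^sup>2
      \<le> (bw_norm d (\<lambda>k. a k - l * b k))\<^sup>2"
    unfolding bw_norm_diff_sq h_def [symmetric] N_def [symmetric] by linarith
qed

text \<open>The last claim turns the projective distance into a linear one: its sine times the norm
  of \<open>a\<close> is the distance to the line of \<open>b\<close>. Nonnegativity of that
  distance is the Cauchy-Schwarz inequality which puts the argument of \<open>arccos\<close> in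
  [0, 1].\<close>

lemma bw_dist_properties:
  assumes a: "0 < bw_norm d a" and b: "0 < bw_norm d b"
  shows "0 \<le> bw_dist d a b" "bw_dist d a b \<le> pi / 2"
    "(sin (bw_dist d a b) * bw_norm d a)\<^sup>2 = (bw_norm d a)\<^sup>2 - (cmod (bw_inner d a b))\<^sup>2 / (bw_norm d b)\<^sup>2"
proof -
  define k where "k = cmod (bw_inner d a b) / (bw_norm d a * bw_norm d b)"
  have k0: "0 \<le> k" using a b by (simp add: k_def)
  have eq: "(bw_norm d a)\<^sup>2 * (1 - k\<^sup>2) = (bw_norm d a)\<^sup>2 - (cmod (bw_inner d a b))\<^sup>2 / (bw_norm d b)\<^sup>2"
    using a by (simp add: k_def power_divide power_mult_distrib right_diff_distrib)
  have "0 \<le> (bw_norm d a)\<^sup>2 * (1 - k\<^sup>2)"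
    unfolding eq bw_norm_projection(1) [OF b, symmetric] by simp
  then have "k\<^sup>2 \<le> 1" using a by (simp add: zero_le_mult_iff)
  then have k1: "k \<le> 1" using k0 by (simp add: abs_square_le_1)
  have th: "bw_dist d a b = arccos k" by (simp add: bw_dist_def k_def)
  show "0 \<le> bw_dist d a b" unfolding th using k0 k1 by (intro arccos_lbound) auto
  show "bw_dist d a b \<le> pi / 2" unfolding th using k0 k1 by (intro arccos_le_pi2)
  have "sin (bw_dist d a b) = sqrt (1 - k\<^sup>2)" unfolding th using k0 k1 by (intro sin_arccos) auto
  then have "(sin (bw_dist d a b))\<^sup>2 = 1 - k\<^sup>2" using \<open>k\<^sup>2 \<le> 1\<close> by simp
  then show "(sin (bw_dist d a b) * bw_norm d a)\<^sup>2 = (bw_norm d a)\<^sup>2 - (cmod (bw_inner d a b))\<^sup>2 / (bw_norm d b)\<^sup>2"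
    using eq by (simp add: power_mult_distrib mult.commute)
qed

lemma bw_dist_multiple_close:
  assumes a: "0 < bw_norm d a" and b: "0 < bw_norm d b"
  obtains l where "bw_norm d (\<lambda>k. a k - l * b k) \<le> bw_dist d a b * bw_norm d a"
proof -
  define l where "l = bw_inner d a b / of_real ((bw_norm d b)\<^sup>2)"
  note th = bw_dist_properties [OF a b]
  have s: "0 \<le> sin (bw_dist d a b)" using th by (intro sin_ge_zero) auto
  have "(bw_norm d (\<lambda>k. a k - l * b k))\<^sup>2 = (sin (bw_dist d a b) * bw_norm d a)\<^sup>2"
    unfolding th(3) l_def by (rule bw_norm_projection(1) [OF b])
  then have "bw_norm d (\<lambda>k. a k - l * b k) = sin (bw_dist d a b) * bw_norm d a"
    using s a bw_norm_nonneg by (simp add: power2_eq_iff_nonneg)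
  also have "\<dots> \<le> bw_dist d a b * bw_norm d a"
    using sin_x_le_x [OF th(1)] a by (intro mult_right_mono) auto
  finally show thesis using that by blast
qed

lemma bw_dist_le_bw_norm_diff:
  assumes a: "0 < bw_norm d a" and b: "0 < bw_norm d b"
  shows "bw_dist d a b * bw_norm d a \<le> 2 * bw_norm d (\<lambda>k. a k - b k)"
proof -
  note th = bw_dist_properties [OF a b]
  have "(sin (bw_dist d a b) * bw_norm d a)\<^sup>2 \<le> (bw_norm d (\<lambda>k. a k - 1 * b k))\<^sup>2"
    unfolding th(3) by (rule bw_norm_projection(2) [OF b])
  then have "sin (bw_dist d a b) * bw_norm d a \<le> bw_norm d (\<lambda>k. a k - 1 * b k)"
    by (rule power2_le_imp_le) (rule bw_norm_nonneg)
  moreover have "bw_dist d a b / 2 * bw_norm d a \<le> sin (bw_dist d a b) * bw_norm d a"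
    using half_le_sin [OF th(1,2)] a by (intro mult_right_mono) auto
  ultimately show ?thesis by simp
qed

section \<open>Values and directional derivatives of forms\<close>

definition hom_deriv :: "nat \<Rightarrow> (nat \<Rightarrow> complex) \<Rightarrow> complex \<times> complex \<Rightarrow> complex \<times> complex \<Rightarrow> complex" where
  "hom_deriv d a z v = (\<Sum>k\<le>d. a k * (of_nat k * fst z ^ (k - 1) * fst v * snd z ^ (d - k)
     + fst z ^ k * (of_nat (d - k) * snd z ^ (d - k - 1) * snd v)))"

text \<open>The truncated exponents \<open>k - 1\<close> and \<open>d - k - 1\<close> at the ends of
  the range are multiplied by \<open>of_nat 0\<close>, so the formula is the product rule for every
  \<open>k\<close>.\<close>

lemma hom_deriv:
  "((\<lambda>e. hom_eval d a (fst z + e * fst v, snd z + e * snd v)) has_field_derivative hom_deriv d a z v) (at 0)"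
  unfolding hom_eval_def hom_deriv_def fst_conv snd_conv mult.assoc
proof (rule DERIV_sum)
  fix k
  show "((\<lambda>e. a k * ((fst z + e * fst v) ^ k * (snd z + e * snd v) ^ (d - k))) has_field_derivative
      a k * (of_nat k * (fst z ^ (k - 1) * (fst v * snd z ^ (d - k)))
     + fst z ^ k * (of_nat (d - k) * (snd z ^ (d - k - 1) * snd v)))) (at 0)"
    by (auto intro!: derivative_eq_intros simp: mult_ac)
qed

lemma hom_eval_diff: "hom_eval d (\<lambda>k. a k - l * b k) z = hom_eval d a z - l * hom_eval d b z"
  by (simp add: hom_eval_def sum_distrib_left sum_subtractf algebra_simps)

lemma hom_deriv_diff: "hom_deriv d (\<lambda>k. a k - l * b k) z v = hom_deriv d a z v - l * hom_deriv d b z v"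
  unfolding hom_deriv_def sum_distrib_left sum_subtractf [symmetric]
  by (intro sum.cong refl) (simp add: left_diff_distrib mult.assoc)

lemma norm_hom_eval_le:
  assumes z: "cmod (fst z) \<le> 1" "cmod (snd z) \<le> 1"
  shows "cmod (hom_eval d a z) \<le> (real d + 1) * 2 ^ d * bw_norm d a"
proof -
  have "cmod (hom_eval d a z) \<le> (\<Sum>k\<le>d. 2 ^ d * bw_norm d a)"
    unfolding hom_eval_def
  proof (rule sum_norm_le)
    fix k assume k: "k \<in> {..d}"
    have "cmod (a k * fst z ^ k * snd z ^ (d - k)) = cmod (a k) * (cmod (fst z) ^ k * cmod (snd z) ^ (d - k))"
      by (simp add: norm_mult norm_power mult.assoc)
    also have "\<dots> \<le> cmod (a k) * 1"
      using z by (intro mult_left_mono mult_le_one power_le_one) auto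
    also have "\<dots> \<le> 2 ^ d * bw_norm d a" using norm_coeff_le_bw_norm k by simp
    finally show "cmod (a k * fst z ^ k * snd z ^ (d - k)) \<le> 2 ^ d * bw_norm d a" .
  qed
  then show ?thesis by (simp add: algebra_simps)
qed

lemma norm_hom_deriv_le:
  assumes z: "cmod (fst z) \<le> 1" "cmod (snd z) \<le> 1" and v: "cmod (fst v) \<le> 1" "cmod (snd v) \<le> 1"
  shows "cmod (hom_deriv d a z v) \<le> (real d + 1) * real d * 2 ^ d * bw_norm d a"
proof -
  have "cmod (hom_deriv d a z v) \<le> (\<Sum>k\<le>d. 2 ^ d * bw_norm d a * real d)"
    unfolding hom_deriv_def
  proof (rule sum_norm_le)
    fix k assume k: "k \<in> {..d}"
    have 1: "cmod (of_nat k * fst z ^ (k - 1) * fst v * snd z ^ (d - k)) \<le> real k"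
    proof -
      have "cmod (of_nat k * fst z ^ (k - 1) * fst v * snd z ^ (d - k))
        = real k * (cmod (fst z) ^ (k - 1) * (cmod (fst v) * cmod (snd z) ^ (d - k)))"
        by (simp add: norm_mult norm_power mult.assoc)
      also have "\<dots> \<le> real k * 1"
        using z v by (intro mult_left_mono mult_le_one power_le_one) auto
      finally show ?thesis by simp
    qed
    have 2: "cmod (fst z ^ k * (of_nat (d - k) * snd z ^ (d - k - 1) * snd v)) \<le> real (d - k)"
    proof -
      have "cmod (fst z ^ k * (of_nat (d - k) * snd z ^ (d - k - 1) * snd v))
        = real (d - k) * (cmod (fst z) ^ k * (cmod (snd z) ^ (d - k - 1) * cmod (snd v)))"
        by (simp add: norm_mult norm_power mult_ac)
      also have "\<dots> \<le> real (d - k) * 1"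
        using z v by (intro mult_left_mono mult_le_one power_le_one) auto
      finally show ?thesis by simp
    qed
    let ?u = "of_nat k * fst z ^ (k - 1) * fst v * snd z ^ (d - k)
     + fst z ^ k * (of_nat (d - k) * snd z ^ (d - k - 1) * snd v)"
    have "cmod ?u \<le> real d"
      using norm_triangle_mono [OF 1 2] k by (simp add: of_nat_diff)
    then have "cmod (a k) * cmod ?u \<le> 2 ^ d * bw_norm d a * real d"
      using norm_coeff_le_bw_norm [of k d a] k bw_norm_nonneg by (intro mult_mono) auto
    then show "cmod (a k * ?u) \<le> 2 ^ d * bw_norm d a * real d" by (simp add: norm_mult)
  qed
  then show ?thesis by (simp add: algebra_simps)
qed

section \<open>Forms as products of linear forms\<close>

text \<open>The pair \<open>(b, a)\<close> stands for the linear form \<open>a z\<^sub>0 + b z\<^sub>1\<close>, in the order of coefficients of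
  its dehomogenization.\<close>

definition lin_prod :: "nat \<Rightarrow> (nat \<Rightarrow> complex \<times> complex) \<Rightarrow> complex poly" where
  "lin_prod n g = (\<Prod>i<n. [:fst (g i), snd (g i):])"

lemma lin_prod_0 [simp]: "lin_prod 0 g = 1"
  and lin_prod_Suc: "lin_prod (Suc n) g = lin_prod n g * [:fst (g n), snd (g n):]"
  by (simp_all add: lin_prod_def)

lemma degree_lin_prod: "degree (lin_prod n g) \<le> n"
proof (induction n)
  case (Suc n)
  have "degree (lin_prod (Suc n) g) \<le> degree (lin_prod n g) + degree [:fst (g n), snd (g n):]"
    unfolding lin_prod_Suc by (rule degree_mult_le)
  also have "\<dots> \<le> n + 1" using Suc by (intro add_mono) auto
  finally show ?case by simp
qed simp

lemma coeff_mult_linear: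
  fixes F :: "complex poly"
  shows "coeff (F * [:b, a:]) k = b * coeff F k + a * (if k = 0 then 0 else coeff F (k - 1))"
  by (cases k) (simp_all add: mult_pCons_right)

lemma norm_coeff_lin_prod_le:
  "cmod (coeff (lin_prod n g) k) \<le> (\<Prod>i<n. cmod (fst (g i)) + cmod (snd (g i)))"
proof (induction n arbitrary: k)
  case 0
  then show ?case by (simp add: coeff_1)
next
  case (Suc n)
  let ?M = "\<Prod>i<n. cmod (fst (g i)) + cmod (snd (g i))"
  have M: "0 \<le> ?M" by (intro prod_nonneg) auto
  have "cmod (coeff (lin_prod (Suc n) g) k)
      \<le> cmod (fst (g n)) * ?M + cmod (snd (g n)) * ?M"
    unfolding lin_prod_Suc coeff_mult_linear
    using Suc.IH M by (intro order_trans [OF norm_triangle_ineq] add_mono) (auto simp: norm_mult intro!: mult_left_mono)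
  then show ?case by (simp add: algebra_simps)
qed

lemma hom_eval_mult_linear:
  assumes "degree F \<le> n"
  shows "hom_eval (Suc n) (coeff (F * [:b, a:])) z = hom_eval n (coeff F) z * (a * fst z + b * snd z)"
proof -
  have F: "coeff F (Suc n) = 0" using assms by (simp add: coeff_eq_0)
  have 1: "(\<Sum>k\<le>Suc n. b * coeff F k * fst z ^ k * snd z ^ (Suc n - k)) = b * snd z * hom_eval n (coeff F) z"
    unfolding hom_eval_def sum_distrib_left by (simp add: F Suc_diff_le mult_ac)
  have 2: "(\<Sum>k\<le>Suc n. a * (if k = 0 then 0 else coeff F (k - 1)) * fst z ^ k * snd z ^ (Suc n - k))
      = a * fst z * hom_eval n (coeff F) z"
    unfolding hom_eval_def sum_distrib_left by (subst sum.atMost_Suc_shift) (simp add: mult_ac)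
  have "hom_eval (Suc n) (coeff (F * [:b, a:])) z = (\<Sum>k\<le>Suc n. b * coeff F k * fst z ^ k * snd z ^ (Suc n - k))
      + (\<Sum>k\<le>Suc n. a * (if k = 0 then 0 else coeff F (k - 1)) * fst z ^ k * snd z ^ (Suc n - k))"
    unfolding sum.distrib [symmetric] hom_eval_def coeff_mult_linear distrib_right ..
  then show ?thesis unfolding 1 2 by (simp only: algebra_simps)
qed

lemma hom_eval_lin_prod:
  "hom_eval n (coeff (lin_prod n g)) z = (\<Prod>i<n. snd (g i) * fst z + fst (g i) * snd z)"
proof (induction n)
  case 0
  then show ?case by (simp add: hom_eval_def)
next
  case (Suc n)
  then show ?case
    by (simp only: lin_prod_Suc hom_eval_mult_linear [OF degree_lin_prod] prod.lessThan_Suc)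
qed

section \<open>Normalised linear factors\<close>

definition unit_hom :: "cp1 \<Rightarrow> complex \<times> complex" where
  "unit_hom r = (fst (hom r) / of_real (hnorm2 (hom r)), snd (hom r) / of_real (hnorm2 (hom r)))"

text \<open>The linear form vanishing at \<open>r\<close>, with a unit coefficient vector. For
  \<open>Some w\<close> it is a multiple of X - w; for \<open>None\<close> it is the constant -1, so
  that a root at infinity appears as a drop of the degree.\<close>

definition lin_at :: "cp1 \<Rightarrow> complex \<times> complex" where
  "lin_at r = (- fst (unit_hom r), snd (unit_hom r))"

definition lin_val :: "cp1 \<Rightarrow> complex \<times> complex \<Rightarrow> complex" where
  "lin_val r z = snd (unit_hom r) * fst z - fst (unit_hom r) * snd z"

lemma sqn_unit_hom: "(cmod (fst (unit_hom r)))\<^sup>2 + (cmod (snd (unit_hom r)))\<^sup>2 = 1"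
proof -
  have "(cmod (fst (unit_hom r)))\<^sup>2 + (cmod (snd (unit_hom r)))\<^sup>2 = sqn (hom r) / (hnorm2 (hom r))\<^sup>2"
    by (simp add: unit_hom_def norm_divide power_divide sqn_def add_divide_distrib)
  then show ?thesis using sqn_pos [of "hom r"] by (simp add: hnorm2_sq)
qed

lemma unit_hom_le_1: "cmod (fst (unit_hom r)) \<le> 1" "cmod (snd (unit_hom r)) \<le> 1"
proof -
  have 1: "(cmod (fst (unit_hom r)))\<^sup>2 \<le> 1\<^sup>2" and 2: "(cmod (snd (unit_hom r)))\<^sup>2 \<le> 1\<^sup>2"
    using sqn_unit_hom [of r] zero_le_power2 [of "cmod (fst (unit_hom r))"]
      zero_le_power2 [of "cmod (snd (unit_hom r))"] unfolding one_power2 by linarith+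
  show "cmod (fst (unit_hom r)) \<le> 1" "cmod (snd (unit_hom r)) \<le> 1"
    using power2_le_imp_le [OF 1] power2_le_imp_le [OF 2] by auto
qed

lemma norm_lin_val_unit_hom: "cmod (lin_val r (unit_hom w)) = sin (fs_dist r w)"
proof -
  have "lin_val r (unit_hom w) = - (fst (hom r) * snd (hom w) - snd (hom r) * fst (hom w))
      / of_real (hnorm2 (hom r) * hnorm2 (hom w))"
    by (simp add: lin_val_def unit_hom_def diff_divide_distrib mult.commute)
  then have "cmod (lin_val r (unit_hom w)) = cmod (fst (hom r) * snd (hom w) - snd (hom r) * fst (hom w))
      / \<bar>hnorm2 (hom r) * hnorm2 (hom w)\<bar>"
    by (simp only: norm_divide norm_minus_cancel norm_of_real)
  then show ?thesis
    using hnorm2_pos [of "hom r"] hnorm2_pos [of "hom w"] by (simp add: sin_fs_dist)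
qed

definition form_of :: "nat \<Rightarrow> complex \<Rightarrow> (nat \<Rightarrow> cp1) \<Rightarrow> nat \<Rightarrow> complex" where
  "form_of d c r k = c * coeff (lin_prod d (\<lambda>i. lin_at (r i))) k"

lemma hom_eval_form_of: "hom_eval d (form_of d c r) z = c * (\<Prod>i<d. lin_val (r i) z)"
proof -
  have "hom_eval d (form_of d c r) z = c * hom_eval d (coeff (lin_prod d (\<lambda>i. lin_at (r i)))) z"
    by (simp add: hom_eval_def form_of_def sum_distrib_left mult.assoc)
  then show ?thesis by (simp add: hom_eval_lin_prod lin_at_def lin_val_def)
qed

text \<open>Both sides are derivatives of the same function of the increment, once through the
  coefficients and once by the Leibniz rule for the product.\<close>

lemma hom_deriv_form_of:
  "hom_deriv d (form_of d c r) z v = c * (\<Sum>i<d. lin_val (r i) v * (\<Prod>j\<in>{..<d} - {i}. lin_val (r j) z))"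
proof -
  have lin: "((\<lambda>e. lin_val (r i) (fst z + e * fst v, snd z + e * snd v)) has_field_derivative lin_val (r i) v) (at 0)" for i
    unfolding lin_val_def fst_conv snd_conv
    by (auto intro!: derivative_eq_intros)
  have "((\<lambda>e. c * (\<Prod>i<d. lin_val (r i) (fst z + e * fst v, snd z + e * snd v))) has_field_derivative
     c * (\<Sum>i<d. lin_val (r i) v * (\<Prod>j\<in>{..<d} - {i}. lin_val (r j) (fst z + 0 * fst v, snd z + 0 * snd v)))) (at 0)"
    by (intro DERIV_cmult has_field_derivative_prod lin)
  moreover have "((\<lambda>e. c * (\<Prod>i<d. lin_val (r i) (fst z + e * fst v, snd z + e * snd v))) has_field_derivative
     hom_deriv d (form_of d c r) z v) (at 0)"
    using hom_deriv [of d "form_of d c r" z v] by (simp add: hom_eval_form_of)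
  ultimately show ?thesis using DERIV_unique by fastforce
qed

lemma lin_at_Some: "[:fst (lin_at (Some w)), snd (lin_at (Some w)):]
    = smult (1 / of_real (hnorm2 (hom (Some w)))) [:- w, 1:]"
  by (simp add: lin_at_def unit_hom_def hom_def)

lemma lin_at_None: "[:fst (lin_at None), snd (lin_at None):] = [:-1:]"
  by (simp add: lin_at_def unit_hom_def hom_def hnorm2_eq sqn_def)

lemma lin_at_nonzero: "[:fst (lin_at r), snd (lin_at r):] \<noteq> 0"
proof (cases r)
  case None
  then show ?thesis unfolding None lin_at_None by simp
next
  case (Some w)
  then show ?thesis unfolding Some lin_at_Some using hnorm2_pos [of "hom (Some w)"] by simp
qed

lemma lin_prod_lin_at_nonzero: "lin_prod n (\<lambda>i. lin_at (r i)) \<noteq> 0"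
  unfolding lin_prod_def using lin_at_nonzero by (simp add: prod_zero_iff del: pCons_eq_0_iff)

lemma poly_factorization:
  fixes F :: "complex poly"
  assumes "F \<noteq> 0" "degree F \<le> n"
  shows "\<exists>c r. c \<noteq> 0 \<and> F = smult c (lin_prod n (\<lambda>i. lin_at (r i)))"
  using assms
proof (induction n arbitrary: F)
  case 0
  then obtain c where "F = [:c:]" using degree_eq_zeroE by blast
  then show ?case using 0 by (intro exI [of _ c]) auto
next
  case (Suc n)
  show ?case
  proof (cases "degree F \<le> n")
    case True
    then obtain c r where cr: "c \<noteq> 0" "F = smult c (lin_prod n (\<lambda>i. lin_at (r i)))"
      using Suc by blast
    \<comment> \<open>The missing degree is filled by a root at infinity. Its factor is -1, and the
      sign goes into the constant.\<close>
    define r' where "r' = r(n := None)"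
    have "lin_prod n (\<lambda>i. lin_at (r' i)) = lin_prod n (\<lambda>i. lin_at (r i))"
      unfolding lin_prod_def r'_def by (intro prod.cong) auto
    moreover have "r' n = None" "[:-1:] = (-1 :: complex poly)" by (simp_all add: r'_def one_pCons)
    ultimately have "lin_prod (Suc n) (\<lambda>i. lin_at (r' i)) = - lin_prod n (\<lambda>i. lin_at (r i))"
      by (simp only: lin_prod_Suc lin_at_None mult_minus_right mult_1_right)
    then have "F = smult (- c) (lin_prod (Suc n) (\<lambda>i. lin_at (r' i)))" using cr by simp
    then show ?thesis using cr by (metis neg_equal_0_iff_equal)
  next
    case False
    then have "\<not> constant (poly F)" using Suc.prems by (simp add: constant_degree)
    then obtain w where "poly F w = 0" using fundamental_theorem_of_algebra by blast
    then obtain G where G: "F = [:- w, 1:] * G" by (auto simp: poly_eq_0_iff_dvd)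
    then have "G \<noteq> 0" using Suc.prems by auto
    moreover have "degree G \<le> n"
      using Suc.prems G \<open>G \<noteq> 0\<close> by (auto simp: degree_mult_eq simp del: mult_pCons_left)
    ultimately obtain c r where cr: "c \<noteq> 0" "G = smult c (lin_prod n (\<lambda>i. lin_at (r i)))"
      using Suc.IH by blast
    define r' where "r' = r(n := Some w)"
    define h where "h = complex_of_real (hnorm2 (hom (Some w)))"
    have h: "h \<noteq> 0" using hnorm2_pos [of "hom (Some w)"] by (simp add: h_def)
    have "lin_prod n (\<lambda>i. lin_at (r' i)) = lin_prod n (\<lambda>i. lin_at (r i))"
      unfolding lin_prod_def r'_def by (intro prod.cong) auto
    moreover have "r' n = Some w" by (simp add: r'_def)
    ultimately have L: "lin_prod (Suc n) (\<lambda>i. lin_at (r' i)) = lin_prod n (\<lambda>i. lin_at (r i)) * smult (1 / h) [:- w, 1:]"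
      unfolding h_def by (simp only: lin_prod_Suc lin_at_Some)
    define q where "q = [:- w, 1:]"
    have "F = smult (c * h) (lin_prod (Suc n) (\<lambda>i. lin_at (r' i)))"
      using cr h unfolding G L q_def [symmetric] by (simp add: mult.commute)
    then show ?thesis using cr h by (metis mult_eq_0_iff)
  qed
qed

lemma coeff_form_poly: "is_form d a \<Longrightarrow> coeff (form_poly d a) k = a k"
  by (auto simp: form_poly_def is_form_def nth_default_def not_less_eq simp del: upt_Suc)

lemma is_form_obtain:
  assumes "is_form d a"
  obtains c r where "c \<noteq> 0" "a = form_of d c r"
proof -
  have "form_poly d a \<noteq> 0" using assms coeff_form_poly [OF assms] by (metis coeff_0 is_form_def)
  moreover have "degree (form_poly d a) \<le> d"
    using assms by (intro degree_le) (simp add: coeff_form_poly is_form_def)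
  ultimately obtain c r where "c \<noteq> 0" "form_poly d a = smult c (lin_prod d (\<lambda>i. lin_at (r i)))"
    using poly_factorization by blast
  then have "c \<noteq> 0" "a = form_of d c r"
    using coeff_form_poly [OF assms] by (auto simp: form_of_def fun_eq_iff)
  then show thesis using that by blast
qed

lemma is_form_form_of:
  assumes "c \<noteq> 0" shows "is_form d (form_of d c r)"
proof -
  let ?F = "lin_prod d (\<lambda>i. lin_at (r i))"
  have "coeff ?F k = 0" if "k > d" for k
    using that degree_lin_prod [of d "\<lambda>i. lin_at (r i)"] by (simp add: coeff_eq_0)
  moreover have "coeff ?F (degree ?F) \<noteq> 0" using lin_prod_lin_at_nonzero by simp
  ultimately show ?thesis using assms degree_lin_prod
    unfolding is_form_def form_of_def by (metis mult_eq_0_iff)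
qed

lemma form_poly_form_of:
  "c \<noteq> 0 \<Longrightarrow> form_poly d (form_of d c r) = smult c (lin_prod d (\<lambda>i. lin_at (r i)))"
  by (rule poly_eqI) (simp add: coeff_form_poly [OF is_form_form_of] form_of_def)

section \<open>Root multiplicities and root measures of products\<close>

lemma card_filter_Suc: "card {i. i < Suc n \<and> P i} = card {i. i < n \<and> P i} + (if P n then 1 else 0)"
proof -
  have "{i. i < Suc n \<and> P i} = (if P n then insert n {i. i < n \<and> P i} else {i. i < n \<and> P i})"
    by (auto simp: less_Suc_eq)
  then show ?thesis by simp
qed

lemma order_lin_prod: "order w (lin_prod n (\<lambda>i. lin_at (r i))) = card {i. i < n \<and> r i = Some w}"
proof (induction n)
  case 0
  then show ?case by (simp add: order_1_eq_0)
next
  case (Suc n)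
  have "order w [:fst (lin_at (r n)), snd (lin_at (r n)):] = (if r n = Some w then 1 else 0)"
  proof (cases "r n")
    case None
    then show ?thesis unfolding None lin_at_None by (simp add: order_0I)
  next
    case (Some v)
    have "order w (smult (1 / of_real (hnorm2 (hom (Some v)))) [:- v, 1:]) = order w [:- v, 1:]"
      using hnorm2_pos [of "hom (Some v)"] by (intro order_smult) auto
    also have "\<dots> = (if v = w then 1 else 0)"
      using order_power_n_n [of v 1] by (auto intro: order_0I)
    finally show ?thesis unfolding Some lin_at_Some by auto
  qed
  moreover have "lin_prod n (\<lambda>i. lin_at (r i)) * [:fst (lin_at (r n)), snd (lin_at (r n)):] \<noteq> 0"
    using lin_prod_lin_at_nonzero lin_at_nonzero no_zero_divisors by blast
  then have "order w (lin_prod n (\<lambda>i. lin_at (r i)) * [:fst (lin_at (r n)), snd (lin_at (r n)):])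
      = order w (lin_prod n (\<lambda>i. lin_at (r i))) + order w [:fst (lin_at (r n)), snd (lin_at (r n)):]"
    by (rule order_mult)
  ultimately show ?case using Suc by (simp only: lin_prod_Suc card_filter_Suc)
qed

lemma degree_lin_prod_lin_at: "degree (lin_prod n (\<lambda>i. lin_at (r i))) = card {i. i < n \<and> r i \<noteq> None}"
proof (induction n)
  case 0
  then show ?case by simp
next
  case (Suc n)
  have "degree [:fst (lin_at (r n)), snd (lin_at (r n)):] = (if r n \<noteq> None then 1 else 0)"
  proof (cases "r n")
    case None
    then show ?thesis unfolding None lin_at_None by simp
  next
    case (Some v)
    then show ?thesis unfolding Some lin_at_Some using hnorm2_pos [of "hom (Some v)"] by simp
  qed
  then show ?case using Suc
    unfolding lin_prod_Suc
    by (simp only: degree_mult_eq [OF lin_prod_lin_at_nonzero lin_at_nonzero] card_filter_Suc)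
qed

lemma root_mult_form_of:
  assumes "c \<noteq> 0" shows "root_mult d (form_of d c r) x = card {i. i < d \<and> r i = x}"
proof (cases x)
  case None
  have "card {i. i < d \<and> r i = None} + card {i. i < d \<and> r i \<noteq> None} = card {i. i < d}"
  proof -
    have "{i. i < d} = {i. i < d \<and> r i = None} \<union> {i. i < d \<and> r i \<noteq> None}" by blast
    then have "card {i. i < d} = card ({i. i < d \<and> r i = None} \<union> {i. i < d \<and> r i \<noteq> None})"
      by (rule arg_cong)
    also have "\<dots> = card {i. i < d \<and> r i = None} + card {i. i < d \<and> r i \<noteq> None}"
      by (rule card_Un_disjoint) auto
    finally show ?thesis by (rule sym)
  qed
  then show ?thesis
    using None assms by (simp add: root_mult_def form_poly_form_of degree_lin_prod_lin_at)
next
  case (Some w)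
  then show ?thesis
    using assms by (simp add: root_mult_def form_poly_form_of order_smult order_lin_prod)
qed

lemma pmf_map_roots:
  assumes "c \<noteq> 0" "0 < d"
  shows "pmf (map_pmf r (pmf_of_set {..<d})) x = real (root_mult d (form_of d c r) x) / real d"
proof -
  have "pmf (map_pmf r (pmf_of_set {..<d})) x = real (card ({..<d} \<inter> r -` {x})) / real d"
    using assms by (simp add: pmf_map measure_pmf_of_set lessThan_empty_iff)
  also have "{..<d} \<inter> r -` {x} = {i. i < d \<and> r i = x}" by auto
  finally show ?thesis by (simp add: root_mult_form_of assms)
qed

text \<open>The push-forward of the uniform measure on the indices. This also certifies that the
  multiplicities divided by \<open>d\<close> sum to 1, so \<open>embed_pmf\<close> acts on a genuine
  mass function.\<close>

lemma root_measure_form_of: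
  assumes "c \<noteq> 0" "0 < d"
  shows "root_measure d (form_of d c r) = map_pmf r (pmf_of_set {..<d})"
proof -
  have "root_measure d (form_of d c r) = embed_pmf (pmf (map_pmf r (pmf_of_set {..<d})))"
    unfolding root_measure_def
    by (intro arg_cong [where f = embed_pmf] ext pmf_map_roots [OF assms, symmetric])
  then show ?thesis using type_definition.Rep_inverse [OF td_pmf_embed_pmf] by metis
qed

lemma norm_form_of_le: "cmod (form_of d c r k) \<le> cmod c * 2 ^ d"
proof -
  have "(\<Prod>i<d. cmod (fst (lin_at (r i))) + cmod (snd (lin_at (r i)))) \<le> (\<Prod>i<d. 2)"
  proof (rule prod_mono)
    fix i
    show "0 \<le> cmod (fst (lin_at (r i))) + cmod (snd (lin_at (r i))) \<and>
      cmod (fst (lin_at (r i))) + cmod (snd (lin_at (r i))) \<le> 2"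
      using add_mono [OF unit_hom_le_1 [of "r i"]] by (simp add: lin_at_def)
  qed
  then have "cmod (coeff (lin_prod d (\<lambda>i. lin_at (r i))) k) \<le> 2 ^ d"
    using norm_coeff_lin_prod_le [of d "\<lambda>i. lin_at (r i)" k] by simp
  then show ?thesis unfolding form_of_def norm_mult by (intro mult_left_mono) auto
qed

lemma bw_norm_form_of_le: "bw_norm d (form_of d c r) \<le> (real d + 1) * 2 ^ d * cmod c"
  using bw_norm_le [of d "form_of d c r" "cmod c * 2 ^ d", OF norm_form_of_le] by (simp add: mult_ac)

lemma norm_lin_val_le_2:
  assumes "cmod (fst z) \<le> 1" "cmod (snd z) \<le> 1"
  shows "cmod (lin_val r z) \<le> 2"
proof -
  have "cmod (lin_val r z) \<le> cmod (snd (unit_hom r)) * cmod (fst z) + cmod (fst (unit_hom r)) * cmod (snd z)"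
    unfolding lin_val_def norm_mult [symmetric] by (rule norm_triangle_ineq4)
  also have "\<dots> \<le> 1 + 1"
    using unit_hom_le_1 [of r] assms by (intro add_mono mult_le_one) auto
  finally show ?thesis by simp
qed

lemma norm_lin_val_unit_hom_le_1: "cmod (lin_val r (unit_hom w)) \<le> 1"
  unfolding norm_lin_val_unit_hom by (rule sin_le_one)

text \<open>Pigeonhole: the \<open>d\<close> roots cannot all come close to each of the \<open>d + 1\<close> points
  \<open>[k / (d + 1) : 1]\<close>.\<close>

lemma leading_factor_le_bw_norm:
  "cmod c \<le> (real d + 1) * 2 ^ d * (4 * real d + 5) ^ d * bw_norm d (form_of d c r)"
proof -
  \<comment> \<open>Chosen to contradict \<open>bad\<close>: a factor smaller than \<delta> at two
    sample points has coefficients with |h1| at most 2 (d + 1) \<delta> and |h0| < |h1| + \<delta>,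
    hence total size below (4 d + 5) \<delta> = 1, whereas a unit vector has |h0| + |h1| at least
    1.\<close>
  define \<delta> where "\<delta> = 1 / (4 * real d + 5)"
  have \<delta>: "\<delta> > 0" by (simp add: \<delta>_def)
  define z where "z k = (of_real (real k / (real d + 1)) :: complex, 1 :: complex)" for k :: nat
  have z1: "cmod (fst (z k)) \<le> 1" "cmod (snd (z k)) \<le> 1" if "k \<le> d" for k
  proof -
    have "cmod (fst (z k)) = real k / (real d + 1)"
      unfolding z_def fst_conv norm_of_real by simp
    then show "cmod (fst (z k)) \<le> 1" using that by simp
  qed (simp add: z_def)
  have bad: False if "k < l" "l \<le> d" and s: "cmod (lin_val (r i) (z k)) < \<delta>" "cmod (lin_val (r i) (z l)) < \<delta>" for i k l
  proof -
    define h0 h1 where "h0 = fst (unit_hom (r i))" and "h1 = snd (unit_hom (r i))"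
    have "h1 * of_real ((real l - real k) / (real d + 1)) = lin_val (r i) (z l) - lin_val (r i) (z k)"
      by (simp add: lin_val_def z_def h1_def h0_def diff_divide_distrib algebra_simps)
    then have "cmod h1 * \<bar>(real l - real k) / (real d + 1)\<bar> \<le> cmod (lin_val (r i) (z l)) + cmod (lin_val (r i) (z k))"
      by (metis norm_mult norm_of_real norm_triangle_ineq4)
    also have "\<dots> \<le> 2 * \<delta>" using s by simp
    finally have "cmod h1 * ((real l - real k) / (real d + 1)) \<le> 2 * \<delta>" using that by simp
    moreover have "cmod h1 * (1 / (real d + 1)) \<le> cmod h1 * ((real l - real k) / (real d + 1))"
      using that by (intro mult_left_mono divide_right_mono) auto
    ultimately have "cmod h1 / (real d + 1) \<le> 2 * \<delta>" by simp
    then have h1: "cmod h1 \<le> 2 * \<delta> * (real d + 1)" by (simp add: pos_divide_le_eq)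
    have "h0 = h1 * fst (z k) - lin_val (r i) (z k)"
      by (simp add: lin_val_def z_def h0_def h1_def)
    then have "cmod h0 \<le> cmod h1 * cmod (fst (z k)) + cmod (lin_val (r i) (z k))"
      by (metis norm_mult norm_triangle_ineq4)
    moreover have "cmod h1 * cmod (fst (z k)) \<le> cmod h1 * 1"
      using z1 [of k] that by (intro mult_left_mono) auto
    ultimately have h0: "cmod h0 < cmod h1 + \<delta>" using s by simp
    have "(cmod h0)\<^sup>2 \<le> cmod h0" "(cmod h1)\<^sup>2 \<le> cmod h1"
      using unit_hom_le_1 [of "r i"] by (auto simp: h0_def h1_def power2_eq_square mult_left_le)
    then have "1 \<le> cmod h0 + cmod h1"
      using sqn_unit_hom [of "r i"] by (simp add: h0_def h1_def)
    then have "1 < \<delta> * (4 * real d + 5)" using h0 h1 by (simp add: algebra_simps)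
    then show False by (simp add: \<delta>_def)
  qed
  have "\<exists>k\<le>d. \<forall>i<d. \<delta> \<le> cmod (lin_val (r i) (z k))"
  proof (rule ccontr)
    assume "\<not> (\<exists>k\<le>d. \<forall>i<d. \<delta> \<le> cmod (lin_val (r i) (z k)))"
    then obtain f where f: "\<And>k. k \<le> d \<Longrightarrow> f k < d \<and> cmod (lin_val (r (f k)) (z k)) < \<delta>"
      by (metis not_le)
    have "card (f ` {..d}) \<le> card {..<d}" using f by (intro card_mono) auto
    then have "\<not> inj_on f {..d}" using pigeonhole [of f "{..d}"] by simp
    then obtain k l where kl: "k \<le> d" "l \<le> d" "k \<noteq> l" "f k = f l" by (auto simp: inj_on_def)
    then consider "k < l" | "l < k" by linarith
    then show False
    proof cases
      case 1
      then show ?thesis using bad [of k l "f k"] f [of k] f [of l] kl by auto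
    next
      case 2
      then show ?thesis using bad [of l k "f k"] f [of k] f [of l] kl by auto
    qed
  qed
  then obtain k where k: "k \<le> d" "\<And>i. i < d \<Longrightarrow> \<delta> \<le> cmod (lin_val (r i) (z k))" by blast
  have "cmod c * \<delta> ^ d \<le> cmod c * (\<Prod>i<d. cmod (lin_val (r i) (z k)))"
    using prod_mono [of "{..<d}" "\<lambda>_. \<delta>" "\<lambda>i. cmod (lin_val (r i) (z k))"] k \<delta>
    by (intro mult_left_mono) auto
  also have "\<dots> = cmod (hom_eval d (form_of d c r) (z k))"
    by (simp add: hom_eval_form_of norm_mult prod_norm)
  also have "\<dots> \<le> (real d + 1) * 2 ^ d * bw_norm d (form_of d c r)"
    by (rule norm_hom_eval_le [OF z1 [OF k(1)]])
  finally have "cmod c \<le> (real d + 1) * 2 ^ d * bw_norm d (form_of d c r) * (4 * real d + 5) ^ d"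
    by (simp add: \<delta>_def power_one_over divide_simps)
  then show ?thesis by (simp add: mult_ac)
qed

text \<open>At \<open>w\<close> the form and its derivative in a direction transversal to the factor \<open>i\<^sub>0\<close> cannot both
  be small, while both vanish for a form with a double root at \<open>w\<close>.\<close>

lemma bw_dist_Disc_at_lower:
  assumes c: "c \<noteq> 0" and i0: "i0 < d" and s: "0 \<le> s"
    and sep: "\<And>j. j < d \<Longrightarrow> j \<noteq> i0 \<Longrightarrow> s \<le> fs_dist (r j) w"
    and b: "b \<in> Disc_at d w"
  shows "((s / 2) ^ (d - 1))\<^sup>2 \<le> 4 * real d * ((real d + 1)\<^sup>2 * real d * 4 ^ d) * bw_dist d (form_of d c r) b"
proof -
  define a where "a = form_of d c r"
  define C where "C = (real d + 1)\<^sup>2 * real d * 4 ^ d"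
  define \<theta> where "\<theta> = bw_dist d a b"
  have bf: "is_form d b" "2 \<le> root_mult d b w" using b by (auto simp: Disc_at_def)
  obtain cb rb where cb: "cb \<noteq> 0" "b = form_of d cb rb" using is_form_obtain [OF bf(1)] .
  have "2 \<le> card {i. i < d \<and> rb i = w}" using bf(2) cb by (simp add: root_mult_form_of)
  then obtain i1 i2 where i12: "i1 < d" "rb i1 = w" "i2 < d" "rb i2 = w" "i1 \<noteq> i2"
    unfolding numeral_2_eq_2 card_le_Suc_iff by blast
  define z where "z = unit_hom w"
  define h where "h = unit_hom (r i0)"
  \<comment> \<open>The conjugate of the coefficient vector of the factor \<open>i0\<close>, so that
    this factor takes the value 1 at \<open>v\<close>.\<close>
  define v where "v = (cnj (snd h), - cnj (fst h))"
  have z1: "cmod (fst z) \<le> 1" "cmod (snd z) \<le> 1" using unit_hom_le_1 by (auto simp: z_def)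
  have v1: "cmod (fst v) \<le> 1" "cmod (snd v) \<le> 1" using unit_hom_le_1 by (auto simp: v_def h_def)
  have lw: "lin_val w z = 0" by (simp add: lin_val_def z_def)
  have "(\<Prod>j<d. lin_val (rb j) z) = 0"
    using i12 lw by (intro prod_zero) auto
  then have eb: "hom_eval d b z = 0" by (simp add: cb hom_eval_form_of)
  \<comment> \<open>Two factors of \<open>b\<close> vanish at \<open>z\<close>, so each Leibniz
    term, which omits only one factor, still contains a zero.\<close>
  have "(\<Prod>j\<in>{..<d} - {i}. lin_val (rb j) z) = 0" for i
  proof (rule prod_zero)
    have "(if i = i1 then i2 else i1) \<in> {..<d} - {i}" "lin_val (rb (if i = i1 then i2 else i1)) z = 0"
      using i12 lw by auto
    then show "\<exists>a\<in>{..<d} - {i}. lin_val (rb a) z = 0" by (rule bexI [rotated])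
  qed simp
  then have db: "hom_deriv d b z v = 0"
    unfolding cb hom_deriv_form_of by (simp only: mult_zero_right sum.neutral_const)
  have pos: "0 < bw_norm d a" "0 < bw_norm d b"
    using bw_norm_pos [OF is_form_form_of [OF c]] bw_norm_pos [OF bf(1)] by (auto simp: a_def)
  \<comment> \<open>Subtracting a multiple of \<open>b\<close> changes neither the value at
    \<open>z\<close> nor the derivative along \<open>v\<close>, but makes the norm as small as
    \<theta>.\<close>
  obtain l where l: "bw_norm d (\<lambda>k. a k - l * b k) \<le> \<theta> * bw_norm d a"
    using bw_dist_multiple_close [OF pos] by (auto simp: \<theta>_def)
  have th0: "0 \<le> \<theta>" using bw_dist_properties(1) [OF pos] by (simp add: \<theta>_def)
  have "bw_norm d (\<lambda>k. a k - l * b k) \<le> \<theta> * ((real d + 1) * 2 ^ d * cmod c)"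
    using l mult_left_mono [OF bw_norm_form_of_le [of d c r] th0] by (simp add: a_def)
  then have close: "K * bw_norm d (\<lambda>k. a k - l * b k) \<le> K * (\<theta> * ((real d + 1) * 2 ^ d * cmod c))" if "0 \<le> K" for K
    using that by (rule mult_left_mono)
  have d1: "1 \<le> real d" using i0 by simp
  have four: "(4::real) ^ d = 2 ^ d * 2 ^ d" by (simp flip: power_mult_distrib)
  have "cmod (hom_eval d a z) = cmod (hom_eval d (\<lambda>k. a k - l * b k) z)"
    by (simp add: hom_eval_diff eb)
  also have "\<dots> \<le> (real d + 1) * 2 ^ d * bw_norm d (\<lambda>k. a k - l * b k)"
    by (rule norm_hom_eval_le [OF z1])
  also have "\<dots> \<le> (real d + 1) * 2 ^ d * (\<theta> * ((real d + 1) * 2 ^ d * cmod c))"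
    by (rule close) simp
  also have "\<dots> = ((real d + 1)\<^sup>2 * 1 * 4 ^ d) * \<theta> * cmod c"
    unfolding four by (simp add: power2_eq_square mult_ac)
  also have "\<dots> \<le> C * \<theta> * cmod c"
    unfolding C_def using d1 th0 by (intro mult_right_mono mult_left_mono) auto
  finally have 1: "cmod (hom_eval d a z) \<le> C * \<theta> * cmod c" .
  have "cmod (hom_deriv d a z v) = cmod (hom_deriv d (\<lambda>k. a k - l * b k) z v)"
    by (simp add: hom_deriv_diff db)
  also have "\<dots> \<le> (real d + 1) * real d * 2 ^ d * bw_norm d (\<lambda>k. a k - l * b k)"
    by (rule norm_hom_deriv_le [OF z1 v1])
  also have "\<dots> \<le> (real d + 1) * real d * 2 ^ d * (\<theta> * ((real d + 1) * 2 ^ d * cmod c))"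
    by (rule close) simp
  also have "\<dots> = C * \<theta> * cmod c"
    unfolding C_def four by (simp add: power2_eq_square mult_ac)
  finally have 2: "cmod (hom_deriv d a z v) \<le> C * \<theta> * cmod c" .
  let ?J = "{..<d} - {i0}"
  define x where "x = cmod (lin_val (r i0) z)"
  define \<sigma> where "\<sigma> = (s / 2) ^ (d - 1)"
  define G where "G = (\<Prod>j\<in>?J. lin_val (r j) z)"
  have x: "0 \<le> x" by (simp add: x_def)
  have L1: "cmod (lin_val (r j) z) \<le> 1" for j unfolding z_def by (rule norm_lin_val_unit_hom_le_1)
  have G: "\<sigma> \<le> cmod G" "cmod G \<le> 1"
  proof -
    have "(\<Prod>j\<in>?J. s / 2) \<le> (\<Prod>j\<in>?J. cmod (lin_val (r j) z))"
    proof (rule prod_mono)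
      fix j assume j: "j \<in> ?J"
      have "s / 2 \<le> fs_dist (r j) w / 2" using sep j by simp
      also have "\<dots> \<le> sin (fs_dist (r j) w)" by (rule half_le_sin [OF fs_dist_nonneg fs_dist_le])
      finally show "0 \<le> s / 2 \<and> s / 2 \<le> cmod (lin_val (r j) z)"
        using s by (simp add: z_def norm_lin_val_unit_hom)
    qed
    then show "\<sigma> \<le> cmod G" using i0 by (simp add: \<sigma>_def G_def prod_norm)
    show "cmod G \<le> 1" unfolding G_def prod_norm [symmetric] using L1 by (intro prod_le_1) auto
  qed
  have \<sigma>: "0 \<le> \<sigma>" "\<sigma> \<le> 1" using G s by (auto simp: \<sigma>_def)
  have "hom_eval d a z = c * (lin_val (r i0) z * G)"
    unfolding a_def hom_eval_form_of G_def using i0 by (subst prod.remove [of "{..<d}" i0]) auto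
  then have "cmod c * (x * cmod G) \<le> cmod c * (C * \<theta>)" using 1 by (simp add: norm_mult x_def mult_ac)
  then have "x * cmod G \<le> C * \<theta>" using c by simp
  moreover have "x * \<sigma> \<le> x * cmod G" using G x by (intro mult_left_mono) auto
  ultimately have A: "x * \<sigma> \<le> C * \<theta>" by linarith
  have lv: "lin_val (r i0) v = 1"
  proof -
    have "lin_val (r i0) v = of_real ((cmod (snd h))\<^sup>2 + (cmod (fst h))\<^sup>2)"
      unfolding of_real_add complex_norm_square by (simp add: lin_val_def v_def h_def)
    then show ?thesis using sqn_unit_hom [of "r i0"] by (simp add: h_def add.commute)
  qed
  \<comment> \<open>The Leibniz terms other than the one of \<open>i0\<close>. Each of them contains
    the factor \<open>i0\<close> and is therefore of size at most 2x.\<close>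
  define E where "E = (\<Sum>i\<in>?J. lin_val (r i) v * (\<Prod>j\<in>{..<d} - {i}. lin_val (r j) z))"
  have "hom_deriv d a z v = c * (G + E)"
    unfolding a_def hom_deriv_form_of G_def E_def using i0 by (subst sum.remove [of "{..<d}" i0]) (auto simp: lv)
  then have "cmod c * cmod (G + E) \<le> cmod c * (C * \<theta>)" using 2 by (simp add: norm_mult mult_ac)
  then have GE: "cmod (G + E) \<le> C * \<theta>" using c by simp
  have "cmod E \<le> (\<Sum>i\<in>?J. 2 * x)"
    unfolding E_def
  proof (rule sum_norm_le)
    fix i assume i: "i \<in> ?J"
    have "(\<Prod>j\<in>{..<d} - {i}. lin_val (r j) z) = lin_val (r i0) z * (\<Prod>j\<in>{..<d} - {i} - {i0}. lin_val (r j) z)"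
      using i i0 by (intro prod.remove) auto
    then have "cmod (\<Prod>j\<in>{..<d} - {i}. lin_val (r j) z) = x * (\<Prod>j\<in>{..<d} - {i} - {i0}. cmod (lin_val (r j) z))"
      by (simp add: norm_mult x_def prod_norm)
    also have "\<dots> \<le> x * 1" using L1 x by (intro mult_left_mono prod_le_1) auto
    finally have "cmod (\<Prod>j\<in>{..<d} - {i}. lin_val (r j) z) \<le> x" by simp
    then show "cmod (lin_val (r i) v * (\<Prod>j\<in>{..<d} - {i}. lin_val (r j) z)) \<le> 2 * x"
      unfolding norm_mult using norm_lin_val_le_2 [OF v1] x by (intro mult_mono) auto
  qed
  also have "\<dots> = real (card ?J) * (2 * x)" by simp
  also have "\<dots> \<le> real d * (2 * x)"
    using x i0 by (intro mult_right_mono) auto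
  finally have "cmod E \<le> real d * (2 * x)" .
  moreover have "cmod G \<le> cmod (G + E) + cmod E"
    using norm_triangle_ineq4 [of "G + E" E] by simp
  ultimately have B: "\<sigma> - 2 * real d * x \<le> C * \<theta>" using GE G by linarith
  have "\<sigma>\<^sup>2 \<le> 4 * real d * (C * \<theta>)"
  \<comment> \<open>If x is at least \<sigma>/(4 d), the value, of size at least x \<sigma>, gives
    the bound; otherwise the derivative loses at most half of \<sigma> to \<open>E\<close>.\<close>
  proof (cases "\<sigma> \<le> 4 * real d * x")
    case True
    then have "\<sigma> * \<sigma> \<le> 4 * real d * x * \<sigma>" using \<sigma> by (intro mult_right_mono) auto
    also have "\<dots> = 4 * real d * (x * \<sigma>)" by simp
    also have "\<dots> \<le> 4 * real d * (C * \<theta>)" using A by (intro mult_left_mono) auto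
    finally show ?thesis by (simp add: power2_eq_square)
  next
    case False
    have "\<sigma>\<^sup>2 \<le> \<sigma>" using \<sigma> by (simp add: power2_eq_square mult_left_le)
    also have "\<dots> \<le> 2 * (C * \<theta>)" using B False by linarith
    also have "\<dots> \<le> 4 * real d * (C * \<theta>)"
      using d1 th0 by (intro mult_right_mono) (auto simp: C_def)
    finally show ?thesis .
  qed
  then show ?thesis by (simp add: \<sigma>_def C_def \<theta>_def a_def mult.assoc)
qed

text \<open>The product is linear in each of its factors separately.\<close>

lemma lin_prod_update_diff:
  assumes "j < d"
  shows "lin_prod d (g(j := u)) - lin_prod d (g(j := w)) = lin_prod d (g(j := u - w))"
proof -
  have *: "lin_prod d (g(j := y)) = [:fst y, snd y:] * (\<Prod>i\<in>{..<d} - {j}. [:fst (g i), snd (g i):])" for y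
  proof -
    have "lin_prod d (g(j := y)) = [:fst ((g(j := y)) j), snd ((g(j := y)) j):]
        * (\<Prod>i\<in>{..<d} - {j}. [:fst ((g(j := y)) i), snd ((g(j := y)) i):])"
      unfolding lin_prod_def using assms by (intro prod.remove) auto
    moreover have "(\<Prod>i\<in>{..<d} - {j}. [:fst ((g(j := y)) i), snd ((g(j := y)) i):])
        = (\<Prod>i\<in>{..<d} - {j}. [:fst (g i), snd (g i):])"
      by (intro prod.cong) auto
    ultimately show ?thesis by simp
  qed
  show ?thesis unfolding * left_diff_distrib [symmetric] by simp
qed

lemma exists_near_Disc_at:
  assumes c: "c \<noteq> 0" and ij: "i < d" "j < d" "i \<noteq> j"
  obtains b where "b \<in> Disc_at d (r i)"
    "bw_dist d (form_of d c r) b \<le> 2 * (real d + 1)\<^sup>2 * 4 ^ d * (4 * real d + 5) ^ d * fs_dist (r i) (r j)"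
proof -
  define a where "a = form_of d c r"
  define \<theta> where "\<theta> = fs_dist (r i) (r j)"
  define p q where "p = lin_at (r j)" and "q = lin_at (r i)"
  define I where "I = herm2 (unit_hom (r j)) (unit_hom (r i))"
  \<comment> \<open>A phase aligning the unit vectors of the two roots, arbitrary when they are
    orthogonal. It makes |p - e q|^2 equal to 2 - 2 cos \<theta> = 4 sin^2(\<theta>/2), which is at
    most \<theta>^2.\<close>
  define e where "e = (if I = 0 then 1 else sgn I)"
  have e1: "cmod e = 1" by (simp add: e_def norm_sgn)
  have th: "0 \<le> \<theta>" "\<theta> \<le> pi / 2" unfolding \<theta>_def by (rule fs_dist_nonneg fs_dist_le)+
  have cI: "cmod I = cos \<theta>"
  proof -
    have "I = herm2 (hom (r j)) (hom (r i)) / of_real (hnorm2 (hom (r j)) * hnorm2 (hom (r i)))"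
      by (simp add: I_def herm2_def unit_hom_def add_divide_distrib)
    then have "cmod I = cmod (herm2 (hom (r j)) (hom (r i))) / (hnorm2 (hom (r j)) * hnorm2 (hom (r i)))"
      using hnorm2_pos [of "hom (r j)"] hnorm2_pos [of "hom (r i)"] by (simp add: norm_divide norm_mult)
    moreover have "0 \<le> cmod I" by simp
    moreover have "cmod (herm2 (hom (r j)) (hom (r i))) / (hnorm2 (hom (r j)) * hnorm2 (hom (r i))) \<le> 1"
      by (rule herm2_ratio_le_1) auto
    moreover have "\<theta> = fs_dist (r j) (r i)" unfolding \<theta>_def by (rule fs_dist_commute)
    ultimately show ?thesis by (simp add: fs_dist_def cos_arccos)
  qed
  define u where "u = (fst p - e * fst q, snd p - e * snd q)"
  have "(cmod (fst u))\<^sup>2 + (cmod (snd u))\<^sup>2 \<le> \<theta>\<^sup>2"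
  proof -
    have expand: "(cmod (\<alpha> - e * \<beta>))\<^sup>2 = (cmod \<alpha>)\<^sup>2 + (cmod \<beta>)\<^sup>2 - 2 * Re (cnj e * (\<alpha> * cnj \<beta>))" for \<alpha> \<beta>
    proof -
      have "(cmod (\<alpha> - e * \<beta>))\<^sup>2 = (cmod \<alpha>)\<^sup>2 + (cmod e)\<^sup>2 * (cmod \<beta>)\<^sup>2 - 2 * Re (cnj e * (\<alpha> * cnj \<beta>))"
        by (simp add: cmod_power2) algebra
      then show ?thesis by (simp add: e1)
    qed
    have "Re (cnj e * (fst p * cnj (fst q))) + Re (cnj e * (snd p * cnj (snd q))) = Re (cnj e * I)"
      by (simp add: p_def q_def lin_at_def I_def herm2_def algebra_simps)
    moreover have "cnj e * I = of_real (cmod I)"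
    proof (cases "I = 0")
      case False
      have "cnj I * I = of_real (cmod I) * of_real (cmod I)"
        by (metis complex_norm_square mult.commute power2_eq_square of_real_mult)
      then show ?thesis using False by (simp add: e_def sgn_div_norm scaleR_conv_of_real field_simps)
    qed simp
    moreover have "(cmod (fst p))\<^sup>2 + (cmod (snd p))\<^sup>2 = 1" "(cmod (fst q))\<^sup>2 + (cmod (snd q))\<^sup>2 = 1"
      using sqn_unit_hom by (auto simp: p_def q_def lin_at_def)
    ultimately have "(cmod (fst u))\<^sup>2 + (cmod (snd u))\<^sup>2 = 2 - 2 * cos \<theta>"
      unfolding u_def fst_conv snd_conv expand by (simp add: cI)
    also have "\<dots> = 4 * (sin (\<theta> / 2))\<^sup>2"
      using cos_double_sin [of "\<theta> / 2"] by simp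
    also have "\<dots> = (2 * sin (\<theta> / 2))\<^sup>2" by (simp add: power_mult_distrib)
    also have "\<dots> \<le> \<theta>\<^sup>2"
      using sin_x_le_x [of "\<theta> / 2"] th sin_ge_zero [of "\<theta> / 2"] by (intro power_mono) auto
    finally show ?thesis .
  qed
  then have "(cmod (fst u))\<^sup>2 \<le> \<theta>\<^sup>2" "(cmod (snd u))\<^sup>2 \<le> \<theta>\<^sup>2"
    using zero_le_power2 [of "cmod (fst u)"] zero_le_power2 [of "cmod (snd u)"] by linarith+
  then have u: "cmod (fst u) \<le> \<theta>" "cmod (snd u) \<le> \<theta>"
    using power2_le_imp_le [OF _ th(1)] by auto
  define b where "b = form_of d (c * e) (r(j := r i))"
  have ce: "c * e \<noteq> 0" using c e1 by auto
  have bD: "b \<in> Disc_at d (r i)"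
  proof -
    have "card {i, j} \<le> card {k. k < d \<and> (r(j := r i)) k = r i}"
      using ij by (intro card_mono) auto
    then have "2 \<le> card {k. k < d \<and> (r(j := r i)) k = r i}" using ij by simp
    then show ?thesis
      unfolding Disc_at_def b_def using is_form_form_of [OF ce] root_mult_form_of [OF ce] by simp
  qed
  define g where "g k = lin_at (r k)" for k
  have ga: "lin_prod d (g(j := p)) = lin_prod d (\<lambda>i. lin_at (r i))"
    unfolding g_def p_def lin_prod_def by (intro prod.cong) auto
  have gb: "lin_prod d (g(j := (e * fst q, e * snd q))) = smult e (lin_prod d (\<lambda>k. lin_at ((r(j := r i)) k)))"
  proof -
    have "lin_prod d (g(j := (e * fst q, e * snd q)))
        = (\<Prod>k<d. smult (if k = j then e else 1) [:fst (lin_at ((r(j := r i)) k)), snd (lin_at ((r(j := r i)) k)):])"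
      unfolding lin_prod_def by (intro prod.cong) (auto simp: g_def q_def)
    also have "\<dots> = smult (\<Prod>k<d. if k = j then e else 1) (lin_prod d (\<lambda>k. lin_at ((r(j := r i)) k)))"
      unfolding lin_prod_def by (rule prod_smult)
    also have "(\<Prod>k<d. if k = j then e else 1) = e" using ij by (simp add: prod.delta)
    finally show ?thesis .
  qed
  have diff: "a k - b k = c * coeff (lin_prod d (g(j := u))) k" for k
  proof -
    have "u = p - (e * fst q, e * snd q)" by (simp add: u_def prod_eq_iff)
    then have "lin_prod d (g(j := u)) = lin_prod d (\<lambda>i. lin_at (r i)) - smult e (lin_prod d (\<lambda>k. lin_at ((r(j := r i)) k)))"
      using lin_prod_update_diff [OF ij(2), of g p "(e * fst q, e * snd q)"] ga gb by simp
    then have "coeff (lin_prod d (g(j := u))) k = coeff (lin_prod d (\<lambda>i. lin_at (r i))) k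
        - e * coeff (lin_prod d (\<lambda>k. lin_at ((r(j := r i)) k))) k"
      by (simp only: coeff_diff coeff_smult)
    then show ?thesis unfolding a_def b_def form_of_def by (simp only: right_diff_distrib mult.assoc)
  qed
  have "cmod (a k - b k) \<le> cmod c * (2 ^ d * \<theta>)" for k
  proof -
    have "cmod (coeff (lin_prod d (g(j := u))) k) \<le> (\<Prod>i<d. cmod (fst ((g(j := u)) i)) + cmod (snd ((g(j := u)) i)))"
      by (rule norm_coeff_lin_prod_le)
    also have "\<dots> \<le> (\<Prod>i<d. 2 * (if i = j then \<theta> else 1))"
    proof (rule prod_mono)
      fix i
      show "0 \<le> cmod (fst ((g(j := u)) i)) + cmod (snd ((g(j := u)) i)) \<and>
        cmod (fst ((g(j := u)) i)) + cmod (snd ((g(j := u)) i)) \<le> 2 * (if i = j then \<theta> else 1)"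
        using add_mono [OF u] add_mono [OF unit_hom_le_1 [of "r i"]] by (auto simp: g_def lin_at_def)
    qed
    also have "\<dots> = 2 ^ d * \<theta>" using ij by (simp add: prod.distrib prod.delta)
    finally show ?thesis unfolding diff norm_mult by (intro mult_left_mono) auto
  qed
  then have nd: "bw_norm d (\<lambda>k. a k - b k) \<le> (real d + 1) * (cmod c * (2 ^ d * \<theta>))"
    by (intro bw_norm_le)
  have pos: "0 < bw_norm d a" "0 < bw_norm d b"
    using bw_norm_pos [OF is_form_form_of [OF c]] bw_norm_pos [OF is_form_form_of [OF ce]]
    by (auto simp: a_def b_def)
  \<comment> \<open>The factor from \<open>leading_factor_le_bw_norm\<close>: it replaces |c| by the
    norm of \<open>a\<close>, which then cancels and leaves a bound on the projective
    distance.\<close>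
  define D where "D = (real d + 1) * 2 ^ d * (4 * real d + 5) ^ d"
  have four: "(4::real) ^ d = 2 ^ d * 2 ^ d" by (simp flip: power_mult_distrib)
  have "bw_dist d a b * bw_norm d a \<le> 2 * ((real d + 1) * (cmod c * (2 ^ d * \<theta>)))"
    using bw_dist_le_bw_norm_diff [OF pos] nd by linarith
  also have "\<dots> = 2 * (real d + 1) * 2 ^ d * \<theta> * cmod c" by simp
  also have "\<dots> \<le> 2 * (real d + 1) * 2 ^ d * \<theta> * (D * bw_norm d a)"
    using leading_factor_le_bw_norm [of c d r] th unfolding D_def a_def by (intro mult_left_mono) auto
  also have "\<dots> = (2 * (real d + 1)\<^sup>2 * 4 ^ d * (4 * real d + 5) ^ d * \<theta>) * bw_norm d a"
    unfolding four D_def by (simp add: power2_eq_square mult_ac)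
  finally have "bw_dist d a b \<le> 2 * (real d + 1)\<^sup>2 * 4 ^ d * (4 * real d + 5) ^ d * \<theta>"
    using pos by simp
  then show thesis using that bD by (simp add: a_def \<theta>_def)
qed

section \<open>Distance to the discriminant and root separation\<close>

definition low_const :: "nat \<Rightarrow> real" where
  "low_const d = 4 * real d * ((real d + 1)\<^sup>2 * real d * 4 ^ d)"

definition up_const :: "nat \<Rightarrow> real" where
  "up_const d = 2 * (real d + 1)\<^sup>2 * 4 ^ d * (4 * real d + 5) ^ d"

lemma low_const_pos: "0 < d \<Longrightarrow> 0 < low_const d" and up_const_pos: "0 < up_const d"
  by (auto simp: low_const_def up_const_def intro!: mult_pos_pos)

definition roots :: "nat \<Rightarrow> (nat \<Rightarrow> complex) \<Rightarrow> cp1 set" where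
  "roots d a = {z. 0 < root_mult d a z}"

lemma roots_form_of: "c \<noteq> 0 \<Longrightarrow> roots d (form_of d c r) = r ` {..<d}"
  by (auto simp: roots_def root_mult_form_of card_gt_0_iff)

lemma finite_roots: "is_form d a \<Longrightarrow> finite (roots d a)"
  by (metis finite_imageI finite_lessThan is_form_obtain roots_form_of)

lemma pmf_root_measure:
  assumes "is_form d a" "0 < d"
  shows "pmf (root_measure d a) z = real (root_mult d a z) / real d"
proof -
  obtain c r where cr: "c \<noteq> 0" "a = form_of d c r" using is_form_obtain [OF assms(1)] .
  then show ?thesis using assms by (simp add: root_measure_form_of pmf_map_roots)
qed

lemma set_root_measure: "is_form d a \<Longrightarrow> 0 < d \<Longrightarrow> set_pmf (root_measure d a) = roots d a"
  by (auto simp: set_pmf_iff pmf_root_measure roots_def)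

lemma bw_dist_Disc_at_nonneg: "is_form d a \<Longrightarrow> b \<in> Disc_at d z \<Longrightarrow> 0 \<le> bw_dist d a b"
  by (intro bw_dist_properties bw_norm_pos) (auto simp: Disc_at_def)

lemma Disc_eq_Union: "Disc d = (\<Union>z. Disc_at d z)"
  by (auto simp: Disc_def Disc_at_def)

lemma Disc_at_nonempty: "2 \<le> d \<Longrightarrow> Disc_at d z \<noteq> {}"
proof -
  assume d: "2 \<le> d"
  have "form_of d 1 (\<lambda>_. z) \<in> Disc_at d z"
    using d by (simp add: Disc_at_def is_form_form_of root_mult_form_of)
  then show ?thesis by blast
qed

text \<open>Simplicity of \<open>w\<close> is what excludes a second index of the factorization at
  \<open>w\<close>, so every other factor has its root at distance at least \<open>s\<close> from
  \<open>w\<close>.\<close>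

lemma dist_Disc_at_lower:
  assumes d: "2 \<le> d" and a: "is_form d a" and w: "w \<in> roots d a" "root_mult d a w < 2" and s: "0 \<le> s"
    and sep: "\<And>y. y \<in> roots d a \<Longrightarrow> y \<noteq> w \<Longrightarrow> s \<le> fs_dist w y"
  shows "((s / 2) ^ (d - 1))\<^sup>2 \<le> low_const d * Inf (bw_dist d a ` Disc_at d w)"
proof -
  obtain c r where cr: "c \<noteq> 0" "a = form_of d c r" using is_form_obtain [OF a] .
  obtain i0 where i0: "i0 < d" "r i0 = w" using w cr by (auto simp: roots_form_of)
  have "s \<le> fs_dist (r j) w" if j: "j < d" "j \<noteq> i0" for j
  proof -
    have "r j \<noteq> w"
    proof
      assume "r j = w"
      then have "card {j, i0} \<le> card {i. i < d \<and> r i = w}"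
        using i0 j by (intro card_mono) auto
      then show False using w(2) j cr by (simp add: root_mult_form_of)
    qed
    then show ?thesis using sep [of "r j"] j cr by (auto simp: roots_form_of fs_dist_commute)
  qed
  then have "((s / 2) ^ (d - 1))\<^sup>2 \<le> low_const d * bw_dist d a b" if "b \<in> Disc_at d w" for b
    using bw_dist_Disc_at_lower [OF cr(1) i0(1) s _ that, of r] cr by (simp add: low_const_def)
  then have "((s / 2) ^ (d - 1))\<^sup>2 / low_const d \<le> Inf (bw_dist d a ` Disc_at d w)"
    using low_const_pos [of d] d Disc_at_nonempty [OF d]
    by (intro cInf_greatest) (auto simp: divide_le_eq mult.commute)
  then show ?thesis using low_const_pos [of d] d by (simp add: divide_le_eq mult.commute)
qed

text \<open>The double root \<open>w\<close> of the competing form is arbitrary. Distinguishing the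
  root of \<open>a\<close> nearest to \<open>w\<close>, the triangle inequality keeps all other
  roots at distance \<open>s / 2\<close> from \<open>w\<close>; this explains \<open>s / 4\<close>
  in place of \<open>s / 2\<close>.\<close>

lemma dist_Disc_lower:
  assumes d: "2 \<le> d" and a: "is_form d a" "a \<notin> Disc d" and s: "0 \<le> s"
    and sep: "\<And>y y'. y \<in> roots d a \<Longrightarrow> y' \<in> roots d a \<Longrightarrow> y \<noteq> y' \<Longrightarrow> s \<le> fs_dist y y'"
  shows "((s / 4) ^ (d - 1))\<^sup>2 \<le> low_const d * dist_Disc d a"
proof -
  obtain c r where cr: "c \<noteq> 0" "a = form_of d c r" using is_form_obtain [OF a(1)] .
  have inj: "r i \<noteq> r j" if "i < d" "j < d" "i \<noteq> j" for i j
  proof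
    assume "r i = r j"
    then have "card {i, j} \<le> card {k. k < d \<and> r k = r i}"
      using that by (intro card_mono) auto
    then have "2 \<le> root_mult d a (r i)" using that cr by (simp add: root_mult_form_of)
    then show False using a by (auto simp: Disc_def)
  qed
  have "((s / 4) ^ (d - 1))\<^sup>2 \<le> low_const d * bw_dist d a b" if "b \<in> Disc_at d w" for b w
  proof -
    define i0 where "i0 = arg_min_on (\<lambda>i. fs_dist (r i) w) {..<d}"
    have ne: "finite {..<d}" "{..<d} \<noteq> {}" using d by (auto simp: lessThan_empty_iff)
    have i0: "i0 < d" using arg_min_if_finite(1) [OF ne] by (auto simp: i0_def)
    have min: "fs_dist (r i0) w \<le> fs_dist (r j) w" if "j < d" for j
      using arg_min_least [OF ne, of j "\<lambda>i. fs_dist (r i) w"] that by (simp add: i0_def)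
    have "s / 2 \<le> fs_dist (r j) w" if j: "j < d" "j \<noteq> i0" for j
    proof -
      have "s \<le> fs_dist (r j) (r i0)"
        using sep [of "r j" "r i0"] inj [of j i0] j i0 cr by (auto simp: roots_form_of)
      also have "\<dots> \<le> fs_dist (r j) w + fs_dist (r i0) w"
        using fs_dist_triangle [of "r j" "r i0" w] by (simp add: fs_dist_commute)
      finally show ?thesis using min [OF j(1)] by simp
    qed
    then show ?thesis
      using bw_dist_Disc_at_lower [OF cr(1) i0 _ _ that, of "s / 2" r] cr s by (simp add: low_const_def)
  qed
  then have "((s / 4) ^ (d - 1))\<^sup>2 / low_const d \<le> dist_Disc d a"
    unfolding dist_Disc_def Disc_eq_Union using low_const_pos [of d] d Disc_at_nonempty [OF d]
    by (intro cInf_greatest) (auto simp: divide_le_eq mult.commute)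
  then show ?thesis using low_const_pos [of d] d by (simp add: divide_le_eq mult.commute)
qed

lemma dist_Disc_upper:
  assumes a: "is_form d a" and y: "y \<in> roots d a" "y' \<in> roots d a" "y \<noteq> y'"
  shows "Inf (bw_dist d a ` Disc_at d y) \<le> up_const d * fs_dist y y'"
    and "dist_Disc d a \<le> up_const d * fs_dist y y'"
proof -
  obtain c r where cr: "c \<noteq> 0" "a = form_of d c r" using is_form_obtain [OF a] .
  obtain i j where ij: "i < d" "j < d" "y = r i" "y' = r j" "i \<noteq> j"
    using y cr by (auto simp: roots_form_of)
  obtain b where b: "b \<in> Disc_at d y" "bw_dist d a b \<le> up_const d * fs_dist y y'"
    using exists_near_Disc_at [OF cr(1) ij(1,2,5), of r] cr ij by (auto simp: up_const_def)
  have "Inf (bw_dist d a ` Disc_at d y) \<le> bw_dist d a b"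
    using b bw_dist_Disc_at_nonneg [OF a] by (intro cInf_lower bdd_belowI [of _ 0]) auto
  then show "Inf (bw_dist d a ` Disc_at d y) \<le> up_const d * fs_dist y y'" using b by linarith
  have "dist_Disc d a \<le> bw_dist d a b"
    unfolding dist_Disc_def Disc_eq_Union
    using b bw_dist_Disc_at_nonneg [OF a] by (intro cInf_lower bdd_belowI [of _ 0]) auto
  then show "dist_Disc d a \<le> up_const d * fs_dist y y'" using b by linarith
qed

lemma dist_Disc_nonneg:
  assumes "2 \<le> d" "is_form d a" shows "0 \<le> dist_Disc d a"
  unfolding dist_Disc_def Disc_eq_Union
  using Disc_at_nonempty [OF assms(1)] bw_dist_Disc_at_nonneg [OF assms(2)]
  by (intro cInf_greatest) auto

lemma finite_separated:
  assumes "finite F"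
  obtains s where "0 < s" "\<And>x y. x \<in> F \<Longrightarrow> y \<in> F \<Longrightarrow> x \<noteq> y \<Longrightarrow> s \<le> fs_dist x y"
proof -
  \<comment> \<open>The inserted 1 keeps the minimum meaningful when there are no two distinct
    points.\<close>
  define S where "S = insert 1 ((\<lambda>(x, y). fs_dist x y) ` {p \<in> F \<times> F. fst p \<noteq> snd p})"
  have S: "finite S" "S \<noteq> {}" using assms by (auto simp: S_def)
  have "\<forall>s\<in>S. 0 < s"
    using fs_dist_nonneg fs_dist_eq_0_iff by (auto simp: S_def less_le)
  then have "0 < Min S" using S by simp
  moreover have "Min S \<le> fs_dist x y" if "x \<in> F" "y \<in> F" "x \<noteq> y" for x y
    using S that by (intro Min_le) (auto simp: S_def)
  ultimately show thesis using that by blast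
qed

text \<open>Positivity guarantees that \<open>nu_norm\<close> is an honest reciprocal and not the
  default value of a division by 0.\<close>

lemma dist_Disc_at_pos:
  assumes d: "2 \<le> d" and a: "is_form d a" and w: "w \<in> roots d a" "root_mult d a w < 2"
  shows "0 < Inf (bw_dist d a ` Disc_at d w)"
proof -
  obtain s where s: "0 < s" "\<And>x y. x \<in> roots d a \<Longrightarrow> y \<in> roots d a \<Longrightarrow> x \<noteq> y \<Longrightarrow> s \<le> fs_dist x y"
    using finite_separated [OF finite_roots [OF a]] by metis
  have "((s / 2) ^ (d - 1))\<^sup>2 \<le> low_const d * Inf (bw_dist d a ` Disc_at d w)"
    using dist_Disc_at_lower [OF d a w, of s] s w by auto
  moreover have "0 < ((s / 2) ^ (d - 1))\<^sup>2" using s by simp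
  ultimately have "0 < low_const d * Inf (bw_dist d a ` Disc_at d w)" by linarith
  then show ?thesis using low_const_pos [of d] d by (simp add: zero_less_mult_iff)
qed

lemma cls_mem_roots:
  assumes a: "is_form d a" and z: "z \<noteq> 0" "hom_eval d a z = 0"
  shows "cls z \<in> roots d a"
proof -
  obtain c r where cr: "c \<noteq> 0" "a = form_of d c r" using is_form_obtain [OF a] .
  then obtain i where i: "i < d" "lin_val (r i) z = 0"
    using z by (auto simp: hom_eval_form_of)
  have "snd (hom (r i)) * fst z = fst (hom (r i)) * snd z"
    using i(2) hnorm2_pos [of "hom (r i)"] by (simp add: lin_val_def unit_hom_def diff_divide_distrib [symmetric])
  then have "r i = cls z"
    using z(1) by (cases "r i"; cases z) (auto simp: hom_def cls_def zero_prod_def)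
  then have "cls z \<in> r ` {..<d}" using i(1) by (metis imageI lessThan_iff)
  then show ?thesis using cr by (simp add: roots_form_of)
qed

section \<open>Continuity of lifts and comparison of lengths\<close>

lemma abs_cont_on_imp_continuous_on:
  assumes "abs_cont_on {a..b} f"
  shows "continuous_on {a..b} f"
  unfolding continuous_on_iff
proof (intro ballI allI impI)
  fix x and e :: real assume x: "x \<in> {a..b}" and "0 < e"
  then obtain \<delta> where \<delta>: "\<delta> > 0" "\<And>(n::nat) (u::nat \<Rightarrow> real) v.
      (\<forall>i<n. u i \<le> v i \<and> {u i..v i} \<subseteq> {a..b}) \<and>
      (\<forall>i<n. \<forall>j<n. i \<noteq> j \<longrightarrow> v i \<le> u j \<or> v j \<le> u i) \<and>
      (\<Sum>i<n. v i - u i) < \<delta> \<longrightarrow> (\<Sum>i<n. norm (f (v i) - f (u i))) < e"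
    using assms unfolding abs_cont_on_def by blast
  have "dist (f y) (f x) < e" if y: "y \<in> {a..b}" "dist y x < \<delta>" for y
    \<comment> \<open>A single interval, ordered by \<open>min\<close> and \<open>max\<close>, is
      enough to extract continuity.\<close>
    using \<delta>(2) [of 1 "\<lambda>_. min x y" "\<lambda>_. max x y"] x y
    by (cases "x \<le> y") (auto simp: dist_norm norm_minus_commute)
  then show "\<exists>d>0. \<forall>x'\<in>{a..b}. dist x' x < d \<longrightarrow> dist (f x') (f x) < e" using \<delta>(1) by blast
qed

lemma continuous_on_hopf:
  assumes "continuous_on S Z" "\<And>t. t \<in> S \<Longrightarrow> Z t \<noteq> 0"
  shows "continuous_on S (\<lambda>t. hopf (Z t))"
proof -
  have "continuous_on S (\<lambda>t. sqn (Z t))"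
    unfolding sqn_def using assms(1) by (intro continuous_intros)
  moreover have "sqn (Z t) \<noteq> 0" if "t \<in> S" for t using sqn_pos [OF assms(2) [OF that]] by simp
  ultimately show ?thesis
    unfolding hopf_def using assms(1) by (intro continuous_intros) auto
qed

text \<open>Through \<open>hopf\<close> the distance becomes a continuous function on the compact
  square of times that vanishes on the diagonal; compare \<open>(s, t)\<close> with
  \<open>(s, s)\<close>.\<close>

lemma fs_dist_cls_uniformly_continuous:
  assumes Z: "continuous_on {0..1::real} Z" "\<And>t. t \<in> {0..1} \<Longrightarrow> Z t \<noteq> 0" and e: "0 < e"
  shows "\<exists>\<eta>>0. \<forall>s\<in>{0..1}. \<forall>t\<in>{0..1}. \<bar>s - t\<bar> < \<eta> \<longrightarrow> fs_dist (cls (Z s)) (cls (Z t)) < e"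
proof -
  let ?F = "\<lambda>p. arccos (hopf (Z (fst p)) \<bullet> hopf (Z (snd p))) / 2"
  let ?Q = "{0..1::real} \<times> {0..1::real}"
  have H: "continuous_on {0..1} (\<lambda>t. hopf (Z t))" using continuous_on_hopf [OF Z] .
  have "continuous_on ?Q (\<lambda>p. hopf (Z (fst p)))" "continuous_on ?Q (\<lambda>p. hopf (Z (snd p)))"
    by (rule continuous_on_compose2 [OF H], auto intro!: continuous_intros)+
  then have "continuous_on ?Q ?F"
    using Z(2) unit_inner_bounds [OF norm_hopf norm_hopf] by (intro continuous_intros) auto
  then have "uniformly_continuous_on ?Q ?F"
    by (intro compact_uniformly_continuous compact_Times) auto
  then obtain \<eta> where \<eta>: "\<eta> > 0" "\<And>p q. p \<in> ?Q \<Longrightarrow> q \<in> ?Q \<Longrightarrow> dist q p < \<eta> \<Longrightarrow> dist (?F q) (?F p) < e"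
    using e unfolding uniformly_continuous_on_def by metis
  have "fs_dist (cls (Z s)) (cls (Z t)) < e" if st: "s \<in> {0..1}" "t \<in> {0..1}" "\<bar>s - t\<bar> < \<eta>" for s t
  proof -
    have "dist (s, t) (s, s) < \<eta>" using st by (simp add: dist_prod_def dist_real_def abs_minus_commute)
    then have "dist (?F (s, t)) (?F (s, s)) < e" using \<eta>(2) [of "(s, s)" "(s, t)"] st by auto
    moreover have "?F (s, t) = fs_dist (cls (Z s)) (cls (Z t))" "?F (s, s) = 0"
      using fs_dist_cls [of "Z s" "Z t"] fs_dist_cls [of "Z s" "Z s"] Z(2) st by (auto simp: fs_dist_self)
    ultimately show ?thesis by (simp add: dist_real_def)
  qed
  then show ?thesis using \<eta>(1) by blast
qed

text \<open>No measurability is needed: a simple function below \<open>c f\<close> is \<open>c\<close> times one below \<open>f\<close>.\<close>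

lemma nn_integral_cmult_le:
  fixes f :: "'a \<Rightarrow> ennreal"
  assumes c: "0 < c"
  shows "(\<integral>\<^sup>+ x. ennreal c * f x \<partial>M) \<le> ennreal c * (\<integral>\<^sup>+ x. f x \<partial>M)"
  unfolding nn_integral_def [of M "\<lambda>x. ennreal c * f x"]
proof (rule SUP_least)
  fix g assume "g \<in> {g. simple_function M g \<and> g \<le> (\<lambda>x. ennreal c * f x)}"
  then have g: "simple_function M g" "\<And>x. g x \<le> ennreal c * f x" by (auto simp: le_fun_def)
  define h where "h x = ennreal (1 / c) * g x" for x
  have h: "simple_function M h" unfolding h_def using g(1) by (intro simple_function_mult) auto
  have one: "ennreal c * ennreal (1 / c) = 1" "ennreal (1 / c) * ennreal c = 1"
    using c by (simp_all flip: ennreal_mult)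
  have gh: "g x = ennreal c * h x" for x
    using one by (simp add: h_def mult.assoc [symmetric])
  have hf: "h x \<le> f x" for x
  proof -
    have "h x \<le> ennreal (1 / c) * (ennreal c * f x)" unfolding h_def using g(2) by (rule mult_left_mono) simp
    then show ?thesis using one by (simp add: mult.assoc [symmetric])
  qed
  have "integral\<^sup>S M g = (\<integral>\<^sup>+ x. ennreal c * h x \<partial>M)"
    unfolding gh [symmetric] by (rule nn_integral_eq_simple_integral [OF g(1), symmetric])
  also have "\<dots> = ennreal c * (\<integral>\<^sup>+ x. h x \<partial>M)"
    using h by (intro nn_integral_cmult borel_measurable_simple_function)
  also have "\<dots> \<le> ennreal c * (\<integral>\<^sup>+ x. f x \<partial>M)"
    using hf by (intro mult_left_mono nn_integral_mono) auto
  finally show "integral\<^sup>S M g \<le> ennreal c * (\<integral>\<^sup>+ x. f x \<partial>M)" .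
qed

lemma L_cond_le:
  assumes K: "0 < K" and nu: "\<And>t. t \<in> {0..1} \<Longrightarrow> nu_norm d (P t) (cls (Z t)) \<le> K"
  shows "L_cond d P Z \<le> ennreal K * L_V d P Z"
proof -
  have "L_cond d P Z \<le> (\<integral>\<^sup>+ t. ennreal K * (ennreal (speed_V d P Z t) * indicator {0..1} t) \<partial>lborel)"
    unfolding L_cond_def
  proof (rule nn_integral_mono)
    fix t
    have sp: "0 \<le> speed_V d P Z t" by (simp add: speed_V_def)
    show "ennreal (nu_norm d (P t) (cls (Z t)) * speed_V d P Z t) * indicator {0..1} t
        \<le> ennreal K * (ennreal (speed_V d P Z t) * indicator {0..1} t)"
    proof (cases "t \<in> {0..1}")
      case True
      then have "ennreal (nu_norm d (P t) (cls (Z t)) * speed_V d P Z t) \<le> ennreal (K * speed_V d P Z t)"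
        using nu [OF True] sp by (intro ennreal_leI mult_right_mono)
      then show ?thesis using True K sp by (simp add: ennreal_mult)
    qed simp
  qed
  also have "\<dots> \<le> ennreal K * L_V d P Z"
    unfolding L_V_def by (rule nn_integral_cmult_le [OF K])
  finally show ?thesis .
qed

lemma simple_endpoints_geodesic_root_measure:
  assumes d: "2 \<le> d" and form: "\<And>t. t \<in> {0..1} \<Longrightarrow> is_form d (P t)"
    and simple: "P 0 \<notin> Disc d" "P 1 \<notin> Disc d"
    and geo: "W2_geodesic (\<lambda>t. root_measure d (P t))"
  shows "simple_endpoints_geodesic (\<lambda>t. root_measure d (P t)) d"
proof
  have d0: "0 < d" using d by simp
  show "0 < d" by (rule d0)
  show "W2_geodesic (\<lambda>t. root_measure d (P t))" by (rule geo)
  show "finite (set_pmf (root_measure d (P t)))" if "t \<in> {0..1}" for t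
    using form [OF that] d0 by (simp add: set_root_measure finite_roots)
  show "1 / real d \<le> pmf (root_measure d (P t)) y"
    if "t \<in> {0..1}" "y \<in> set_pmf (root_measure d (P t))" for t y
    using that form [OF that(1)] d0
    by (simp add: set_root_measure pmf_root_measure roots_def divide_right_mono)
  have le: "pmf (root_measure d a) x \<le> 1 / real d" if "is_form d a" "a \<notin> Disc d" for a x
  proof -
    have "\<not> 2 \<le> root_mult d a x" using that by (auto simp: Disc_def)
    then have "root_mult d a x \<le> 1" by linarith
    then show ?thesis using that d0 by (simp add: pmf_root_measure divide_right_mono)
  qed
  show "pmf (root_measure d (P 0)) x \<le> 1 / real d" "pmf (root_measure d (P 1)) x \<le> 1 / real d" for x
    using le form simple by auto
qed

text \<open>Curves are given by representatives. A lift avoids the critical points when its root is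
  simple, and \<open>2 \<le> d\<close> makes the discriminant nonempty, so the infima are genuine
  distances.\<close>

theorem mainTheorem20:
  fixes d :: nat
  assumes "2 \<le> d"
  shows "\<exists>\<beta>1 \<beta>2 \<beta>3 \<beta>4 :: real. \<beta>1 > 0 \<and> \<beta>2 > 0 \<and> \<beta>3 > 0 \<and> \<beta>4 > 0 \<and>
    (\<forall>P :: real \<Rightarrow> nat \<Rightarrow> complex.
       (\<forall>t\<in>{0..1}. is_form d (P t)) \<and>
       (\<forall>k. continuous_on {0..1} (\<lambda>t. P t k)) \<and>
       P 0 \<notin> Disc d \<and> P 1 \<notin> Disc d \<and>
       W2_geodesic (\<lambda>t. root_measure d (P t)) \<longrightarrow>
         (\<forall>t\<in>{0..1}. (dist_Disc d (P t))\<^sup>2 \<ge>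
             \<beta>1 * (min (dist_Disc d (P 0)) (dist_Disc d (P 1))) powr \<beta>2) \<and>
         (\<forall>t\<in>{0..1}. P t \<notin> Disc d) \<and>
         (\<forall>Z :: real \<Rightarrow> complex \<times> complex.
            (\<forall>k. abs_cont_on {0..1} (\<lambda>t. P t k)) \<and> abs_cont_on {0..1} Z \<and>
            (\<forall>t\<in>{0..1}. Z t \<noteq> 0 \<and> hom_eval d (P t) (Z t) = 0 \<and>
                         root_mult d (P t) (cls (Z t)) < 2) \<longrightarrow>
            L_cond d P Z \<le> ennreal \<beta>3 * L_V d P Z *
              ennreal ((max (nu_norm d (P 0) (cls (Z 0))) (nu_norm d (P 1) (cls (Z 1)))) powr \<beta>4)))"
proof -
  define N where "N = d - 1"
  define U L where "U = up_const d" and "L = low_const d"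
  have U: "0 < U" and L: "0 < L" using up_const_pos low_const_pos assms by (auto simp: U_def L_def)
  have N: "0 < N" using assms by (simp add: N_def)
  have d0: "0 < d" using assms by simp
  \<comment> \<open>With q the smaller end point distance, the end point gaps are at least q/U; the
    geodesic halves them and \<open>dist_Disc_lower\<close> divides by 4. This gives (q/(8U))^(2N)
    at most L times the distance, to be squared.\<close>
  define \<beta>1 where "\<beta>1 = 1 / ((8 * U) ^ (4 * N) * L\<^sup>2)"
  \<comment> \<open>The same chain around a tracked root divides only by 2 in its last step, hence
    4U, and nothing is squared at the end.\<close>
  define \<beta>3 where "\<beta>3 = L * (4 * U) ^ (2 * N)"
  have \<beta>: "0 < \<beta>1" "0 < \<beta>3" using U L by (auto simp: \<beta>1_def \<beta>3_def)
  show ?thesis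
  proof (rule exI [of _ \<beta>1], rule exI [of _ "real (4 * N)"], rule exI [of _ \<beta>3],
      rule exI [of _ "real (2 * N)"], intro conjI allI impI)
    show "0 < \<beta>1" "0 < \<beta>3" "0 < real (4 * N)" "0 < real (2 * N)" using \<beta> N by auto
  next
    fix P :: "real \<Rightarrow> nat \<Rightarrow> complex"
    assume P: "(\<forall>t\<in>{0..1}. is_form d (P t)) \<and>
       (\<forall>k. continuous_on {0..1} (\<lambda>t. P t k)) \<and>
       P 0 \<notin> Disc d \<and> P 1 \<notin> Disc d \<and> W2_geodesic (\<lambda>t. root_measure d (P t))"
    then have form: "\<And>t. t \<in> {0..1} \<Longrightarrow> is_form d (P t)" by blast
    define m where "m t = root_measure d (P t)" for t
    interpret simple_endpoints_geodesic m d
      unfolding m_def [abs_def]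
      using P by (intro simple_endpoints_geodesic_root_measure [OF assms]) auto
    have supp: "set_pmf (m t) = roots d (P t)" if "t \<in> {0..1}" for t
      using form [OF that] d0 by (simp add: m_def set_root_measure)
    have simple: "P t \<notin> Disc d" if t: "t \<in> {0..1}" for t
    proof -
      have le1: "root_mult d (P t) y \<le> 1" for y
        using atom_mass_le [of t y] t pmf_root_measure [OF form [OF t] d0, of y] d0
        by (simp add: m_def divide_le_cancel)
      have "\<not> 2 \<le> root_mult d (P t) y" for y using le1 [of y] by linarith
      then show ?thesis by (simp add: Disc_def)
    qed
    have endpoints_sep: "s / 2 \<le> fs_dist y y'"
      if t: "t \<in> {0..1}" and y: "y \<in> roots d (P t)" "y' \<in> roots d (P t)" "y \<noteq> y'" and s: "0 \<le> s"
        and s0: "\<And>x x'. x \<in> roots d (P 0) \<Longrightarrow> x' \<in> roots d (P 0) \<Longrightarrow> x \<noteq> x' \<Longrightarrow> s \<le> fs_dist x x'"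
        and s1: "\<And>x x'. x \<in> roots d (P 1) \<Longrightarrow> x' \<in> roots d (P 1) \<Longrightarrow> x \<noteq> x' \<Longrightarrow> s \<le> fs_dist x x'"
      for s t y y'
    proof -
      obtain x where x: "R 0 t x y" using R_source_exists [of 0 t y] t y supp by auto
      obtain z where z: "R t 1 y z" using R_target_exists [of t 1 y] t y supp by auto
      have "x \<in> roots d (P 0)" "z \<in> roots d (P 1)"
        using opt_rel_mem(1) [OF x] opt_rel_mem(2) [OF z] supp by auto
      then show ?thesis
        using t y s s0 s1 supp by (intro separation_from_endpoints [OF _ _ x z]) auto
    qed
    show "\<forall>t\<in>{0..1}. P t \<notin> Disc d" using simple by blast
    show "\<forall>t\<in>{0..1}. (dist_Disc d (P t))\<^sup>2 \<ge>
        \<beta>1 * (min (dist_Disc d (P 0)) (dist_Disc d (P 1))) powr real (4 * N)"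
    proof
      fix t :: real assume t: "t \<in> {0..1}"
      define q where "q = min (dist_Disc d (P 0)) (dist_Disc d (P 1))"
      have q0: "0 \<le> q" using dist_Disc_nonneg [OF assms form] by (auto simp: q_def)
      have "q / U \<le> fs_dist x x'"
        if "x \<in> roots d (P e)" "x' \<in> roots d (P e)" "x \<noteq> x'" "e = 0 \<or> e = 1" for x x' e
      proof -
        have "q \<le> dist_Disc d (P e)" using that by (auto simp: q_def)
        also have "\<dots> \<le> U * fs_dist x x'"
          using dist_Disc_upper(2) [OF form that(1-3)] that(4) by (auto simp: U_def)
        finally show ?thesis using U by (simp add: divide_le_eq mult.commute)
      qed
      then have "q / U / 2 \<le> fs_dist y y'" if "y \<in> roots d (P t)" "y' \<in> roots d (P t)" "y \<noteq> y'" for y y'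
        using q0 U by (intro endpoints_sep [OF t that]) auto
      then have low: "((q / U / 2 / 4) ^ N)\<^sup>2 \<le> L * dist_Disc d (P t)"
        unfolding L_def N_def using q0 U
        by (intro dist_Disc_lower [OF assms form [OF t] simple [OF t]]) auto
      have "q powr real (4 * N) \<le> q ^ (4 * N)"
        using q0 N by (cases "q = 0") (auto simp: powr_realpow simp del: of_nat_mult)
      then have "\<beta>1 * q powr real (4 * N) \<le> \<beta>1 * q ^ (4 * N)" using \<beta> by (intro mult_left_mono) auto
      also have "\<dots> = (((q / U / 2 / 4) ^ N)\<^sup>2 / L)\<^sup>2"
        by (simp add: \<beta>1_def power_divide power_mult_distrib flip: power_mult)
      also have "\<dots> \<le> (dist_Disc d (P t))\<^sup>2"
        using low L by (intro power_mono) (auto simp: divide_le_eq mult.commute)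
      finally show "\<beta>1 * (min (dist_Disc d (P 0)) (dist_Disc d (P 1))) powr real (4 * N) \<le> (dist_Disc d (P t))\<^sup>2"
        by (simp add: q_def)
    qed
    fix Z :: "real \<Rightarrow> complex \<times> complex"
    assume Z: "(\<forall>k. abs_cont_on {0..1} (\<lambda>t. P t k)) \<and> abs_cont_on {0..1} Z \<and>
            (\<forall>t\<in>{0..1}. Z t \<noteq> 0 \<and> hom_eval d (P t) (Z t) = 0 \<and> root_mult d (P t) (cls (Z t)) < 2)"
    define y where "y t = cls (Z t)" for t
    have y_root: "y t \<in> roots d (P t)" and y_mult: "root_mult d (P t) (y t) < 2" if "t \<in> {0..1}" for t
      using cls_mem_roots [OF form [OF that]] Z that by (auto simp: y_def)
    define I where "I t = Inf (bw_dist d (P t) ` Disc_at d (y t))" for t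
    have I: "0 < I t" if "t \<in> {0..1}" for t
      unfolding I_def using that y_root y_mult by (intro dist_Disc_at_pos [OF assms form]) auto
    have nu: "nu_norm d (P t) (cls (Z t)) = 1 / I t" for t by (simp add: nu_norm_def I_def y_def)
    \<comment> \<open>A purely qualitative gap: it serves to show that the lift follows one
      trajectory and does not enter the constants.\<close>
    obtain s0 where s0: "0 < s0" "\<And>x x'. x \<in> roots d (P 0) \<union> roots d (P 1) \<Longrightarrow> x' \<in> roots d (P 0) \<union> roots d (P 1)
        \<Longrightarrow> x \<noteq> x' \<Longrightarrow> s0 \<le> fs_dist x x'"
      using finite_separated [of "roots d (P 0) \<union> roots d (P 1)"] finite_roots form by auto
    have along: "R s t (y s) (y t)" if "0 \<le> s" "s \<le> t" "t \<le> 1" for s t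
    proof (rule R_along_curve [where \<delta> = "s0 / 2", OF _ _ _ _ that])
      show "s0 / 2 \<le> fs_dist x x'"
        if "0 \<le> u" "u \<le> 1" "x \<in> set_pmf (m u)" "x' \<in> set_pmf (m u)" "x \<noteq> x'" for u x x'
        using that supp [of u] s0 by (intro endpoints_sep [of u]) auto
      show "0 < s0 / 2" using s0 by simp
      show "y u \<in> set_pmf (m u)" if "0 \<le> u" "u \<le> 1" for u using that y_root supp by auto
      show "\<exists>\<eta>>0. \<forall>s\<in>{0..1}. \<forall>t\<in>{0..1}. \<bar>s - t\<bar> < \<eta> \<longrightarrow> fs_dist (y s) (y t) < \<epsilon>" if "0 < \<epsilon>" for \<epsilon>
        unfolding y_def using Z that
        by (intro fs_dist_cls_uniformly_continuous abs_cont_on_imp_continuous_on) auto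
    qed
    \<comment> \<open>Now only the end point distances to the forms with a double root at the
      tracked root are used; 1/q is the larger of the two end point condition numbers.\<close>
    define q where "q = min (I 0) (I 1)"
    have q: "0 < q" using I by (simp add: q_def)
    define K where "K = \<beta>3 * (1 / q) ^ (2 * N)"
    have K: "0 < K" using \<beta> q by (simp add: K_def)
    have "nu_norm d (P t) (cls (Z t)) \<le> K" if t: "t \<in> {0..1}" for t
    proof -
      have end_sep: "q / U \<le> fs_dist (y e) x'"
        if "x' \<in> roots d (P e)" "x' \<noteq> y e" "e = 0 \<or> e = 1" for x' e
      proof -
        have "q \<le> I e" using that by (auto simp: q_def)
        also have "\<dots> \<le> U * fs_dist (y e) x'"
          unfolding I_def U_def using that y_root by (intro dist_Disc_upper(1) form) auto
        finally show ?thesis using U by (simp add: divide_le_eq mult.commute)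
      qed
      have "q / U / 2 \<le> fs_dist (y t) y'" if "y' \<in> roots d (P t)" "y' \<noteq> y t" for y'
        using t that q U supp end_sep along
        by (intro separation_from_endpoints [of t "y 0" "y t" "y 1"]) auto
      then have "((q / U / 2 / 2) ^ N)\<^sup>2 \<le> L * I t"
        unfolding L_def N_def I_def using q U
        by (intro dist_Disc_at_lower [OF assms form [OF t] y_root [OF t] y_mult [OF t]]) auto
      moreover have "((q / U / 2 / 2) ^ N)\<^sup>2 = L / K"
        using L U q by (simp add: K_def \<beta>3_def power_divide power_mult_distrib flip: power_mult)
          (simp add: mult_ac)
      ultimately have "1 / K \<le> I t" using L K by (simp add: divide_le_eq mult_ac)
      then show ?thesis unfolding nu using I [OF t] K by (simp add: divide_le_eq mult.commute)
    qed
    then have "L_cond d P Z \<le> ennreal K * L_V d P Z" by (rule L_cond_le [OF K])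
    also have "max (nu_norm d (P 0) (cls (Z 0))) (nu_norm d (P 1) (cls (Z 1))) = 1 / q"
      unfolding nu q_def using I [of 0] I [of 1] by (auto simp: max_def min_def frac_le divide_le_cancel field_simps)
    then have "ennreal K = ennreal \<beta>3 *
        ennreal ((max (nu_norm d (P 0) (cls (Z 0))) (nu_norm d (P 1) (cls (Z 1)))) powr real (2 * N))"
      using q \<beta> powr_realpow [of "1 / q" "2 * N"]
      by (simp only: K_def flip: ennreal_mult) (simp add: ennreal_mult)
    finally show "L_cond d P Z \<le> ennreal \<beta>3 * L_V d P Z *
        ennreal ((max (nu_norm d (P 0) (cls (Z 0))) (nu_norm d (P 1) (cls (Z 1)))) powr real (2 * N))"
      by (simp add: mult_ac)
  qed
qed

end
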